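(* Let $a\in\mathbb{R}^n$ and $\mathbb{B}(a,r)=\{x\in\mathbb{R}^n:|x-a|<r\}$. Let $T$ be an $m$-positive current of bidimension $(p,p)$ on $\mathbb{R}^n\times\mathbb{R}^n$ such that $T\wedge\beta^{p-1}$ is convex and $m+p>n$. Then the limit $$\nu_T^{m}(a):=\lim_{r\to0}r^{-\frac{n}{m}(m-n+p)}\int_{\mathbb{B}(a,r)\times\mathbb{R}^n}T\wedge\beta^p$$ exists (it is called the $m$-Lelong number of $T$ at $a$).
   Context: Superformalism. On $\mathbb{R}^n\times\mathbb{R}^n$ with coordinates $(x,\xi)$, a form of bidegree $(p,q)$ is $\sum_{|K|=p,|L|=q}\alpha_{KL}(x)\,dx_K\wedge d\xi_L$ with smooth coefficients depending only on $x$; $dx_i,d\xi_j$ all anticommute. $d=\sum_i dx_i\wedge\partial_{x_i}$, $d^{\#}=\sum_j d\xi_j\wedge\partial_{x_j}$, $\beta=\frac12dd^{\#}|x|^2=\sum_i dx_i\wedge d\xi_i$. For $\alpha=\sum_i a_i\,dx_i$ put $J(\alpha)=\sum_i a_i\,d\xi_i$. A form of bidegree $(n,n)$ is $\ge0$ if it equals $g\beta^n$ with $g\ge0$. The integral of $\alpha_0(x)\,dx_1\wedge d\xi_1\wedge\dots\wedge dx_n\wedge d\xi_n$ over $A\times\mathbb{R}^n$ is $\int_A\alpha_0\,dx$ (similarly for measures). Currents. A current of bidegree $(p,q)$ is $T=\sum_{|I|=p,|J|=q}T_{IJ}\,dx_I\wedge d\xi_J$ with $T_{IJ}$ distributions in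 $x$; it acts on forms of bidegree $(n-p,n-q)$ with compactly supported coefficients by $\langle T,\alpha\rangle=\int T\wedge\alpha$. Bidimension $(p,p)$ means bidegree $(n-p,n-p)$. Forms or currents of bidegree $(k,k)$ are symmetric if their coefficients are symmetric in $(I,J)$. A form of bidegree $(k,k)$ is strongly positive if it is a finite sum $\sum_s\lambda_s\alpha_{1,s}\wedge J(\alpha_{1,s})\wedge\dots\wedge\alpha_{k,s}\wedge J(\alpha_{k,s})$, $\lambda_s\ge0$, $\alpha_{i,s}$ of bidegree $(1,0)$. A symmetric current of bidimension $(p,p)$ is weakly positive if it is $\ge0$ on all compactly supported strongly positive forms of bidegree $(p,p)$. A current $S$ is convex if $dd^{\#}S$ is weakly positive. $m$-positivity ($1\le m\le n$). A symmetric form $\alpha$ of bidegree $(1,1)$ is $m$-positive if $\alpha^j\wedge\beta^{n-j}\ge0$ at every point for $j=1,\dots,m$. A symmetric current $T$ of bidegree $(q,q)$, $q\le m$, is $m$-positive if $T\wedge\beta^{n-m}\wedge\alpha_1\wedge\dots\wedge\alpha_{m-q}\ge0$ for all $m$-positive forms $\alpha_1,\dots,\alpha_{m-q}$ of bidegree $(1,1)$. *)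

theory Defs
  imports "HOL-Analysis.Analysis"
begin

section \<open>Smooth functions and distributions on Euclidean space\<close>

definition pdiff :: "'n::finite \<Rightarrow> (real^'n \<Rightarrow> real) \<Rightarrow> real^'n \<Rightarrow> real" where
  "pdiff i f = (\<lambda>x. frechet_derivative f (at x) (axis i 1))"

text \<open>Since every iterated partial derivative is required to be Frechet differentiable everywhere
  (hence continuous), this is exactly being infinitely differentiable.\<close>

definition smooth :: "(real^'n::finite \<Rightarrow> real) \<Rightarrow> bool" where
  "smooth f \<longleftrightarrow> (\<forall>is. foldr pdiff is f differentiable_on UNIV)"

definition test_fun :: "(real^'n::finite \<Rightarrow> real) \<Rightarrow> bool" where
  "test_fun \<phi> \<longleftrightarrow> smooth \<phi> \<and> compact (closure {x. \<phi> x \<noteq> 0})"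

text \<open>A distribution is a functional whose values are only meaningful on test functions.\<close>

definition distribution :: "((real^'n::finite \<Rightarrow> real) \<Rightarrow> real) \<Rightarrow> bool" where
  "distribution u \<longleftrightarrow>
     (\<forall>\<phi> \<psi> a b. test_fun \<phi> \<longrightarrow> test_fun \<psi> \<longrightarrow>
        u (\<lambda>x. a * \<phi> x + b * \<psi> x) = a * u \<phi> + b * u \<psi>) \<and>
     (\<forall>K. compact K \<longrightarrow> (\<exists>C N. \<forall>\<phi>. test_fun \<phi> \<longrightarrow> {x. \<phi> x \<noteq> 0} \<subseteq> K \<longrightarrow>
        \<bar>u \<phi>\<bar> \<le> C * (\<Sum>is | length is \<le> N. SUP x. \<bar>foldr pdiff is \<phi> x\<bar>)))"

text \<open>The Radon measure representing a nonnegative distribution.  It is unique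
  because a Radon measure is determined by its integrals against test functions.\<close>

definition density_measure :: "((real^'n::finite \<Rightarrow> real) \<Rightarrow> real) \<Rightarrow> (real^'n) measure" where
  "density_measure u = (THE \<mu>. sets \<mu> = sets borel \<and>
     (\<forall>K. compact K \<longrightarrow> emeasure \<mu> K < \<infinity>) \<and>
     (\<forall>\<phi>. test_fun \<phi> \<longrightarrow> (LINT x|\<mu>. \<phi> x) = u \<phi>))"

section \<open>Superforms\<close>

text \<open>A superform is given by its coefficients: \<open>\<alpha> K L x\<close> is the coefficient at \<open>x\<close> of
  \<open>dx\<^sub>K \<and> d\<xi>\<^sub>L\<close>, where the indices in \<open>K\<close> and in \<open>L\<close> are listed in increasing order.\<close>

type_synonym 'n superform = "'n set \<Rightarrow> 'n set \<Rightarrow> real^'n \<Rightarrow> real"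

definition superform :: "nat \<Rightarrow> nat \<Rightarrow> 'n::{finite,linorder} superform \<Rightarrow> bool" where
  "superform p q \<alpha> \<longleftrightarrow> (\<forall>K L. smooth (\<alpha> K L)) \<and>
     (\<forall>K L. card K \<noteq> p \<or> card L \<noteq> q \<longrightarrow> \<alpha> K L = (\<lambda>x. 0))"

definition symmetric_form :: "'n::{finite,linorder} superform \<Rightarrow> bool" where
  "symmetric_form \<alpha> \<longleftrightarrow> (\<forall>K L. \<alpha> K L = \<alpha> L K)"

text \<open>For disjoint \<open>A\<close> and \<open>B\<close>, \<open>dx\<^sub>A \<and> dx\<^sub>B = merge_sign A B dx\<^bsub>A \<union> B\<^esub>\<close>.\<close>

definition merge_sign :: "'n::{finite,linorder} set \<Rightarrow> 'n set \<Rightarrow> real" where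
  "merge_sign A B = (- 1) ^ card {(a, b). a \<in> A \<and> b \<in> B \<and> b < a}"

text \<open>For \<open>K\<close>, \<open>K'\<close> disjoint and \<open>L\<close>, \<open>L'\<close> disjoint,
  \<open>(dx\<^sub>K \<and> d\<xi>\<^sub>L) \<and> (dx\<^bsub>K'\<^esub> \<and> d\<xi>\<^bsub>L'\<^esub>) =
    wedge_sign K L K' L' dx\<^bsub>K \<union> K'\<^esub> \<and> d\<xi>\<^bsub>L \<union> L'\<^esub>\<close>;
  the first factor comes from moving \<open>dx\<^bsub>K'\<^esub>\<close> past \<open>d\<xi>\<^sub>L\<close>.\<close>

definition wedge_sign ::
  "'n::{finite,linorder} set \<Rightarrow> 'n set \<Rightarrow> 'n set \<Rightarrow> 'n set \<Rightarrow> real" where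
  "wedge_sign K L K' L' = (- 1) ^ (card L * card K') * merge_sign K K' * merge_sign L L'"

definition wedge ::
  "'n::{finite,linorder} superform \<Rightarrow> 'n superform \<Rightarrow> 'n superform" where
  "wedge \<alpha> \<gamma> = (\<lambda>M N x. \<Sum>K\<in>Pow M. \<Sum>L\<in>Pow N.
     wedge_sign K L (M - K) (N - L) * (\<alpha> K L x * \<gamma> (M - K) (N - L) x))"

definition function_form :: "(real^'n::{finite,linorder} \<Rightarrow> real) \<Rightarrow> 'n superform" where
  "function_form f = (\<lambda>K L. if K = {} \<and> L = {} then f else (\<lambda>x. 0))"

definition dx :: "'n::{finite,linorder} \<Rightarrow> 'n superform" where
  "dx i = (\<lambda>K L x. if K = {i} \<and> L = {} then 1 else 0)"

definition dxi :: "'n::{finite,linorder} \<Rightarrow> 'n superform" where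
  "dxi i = (\<lambda>K L x. if K = {} \<and> L = {i} then 1 else 0)"

primrec form_power :: "'n::{finite,linorder} superform \<Rightarrow> nat \<Rightarrow> 'n superform" where
  "form_power \<alpha> 0 = function_form (\<lambda>x. 1)"
| "form_power \<alpha> (Suc k) = wedge (form_power \<alpha> k) \<alpha>"

definition beta :: "'n::{finite,linorder} superform" where
  "beta = (\<lambda>K L x. \<Sum>i\<in>UNIV. wedge (dx i) (dxi i) K L x)"

text \<open>The map \<open>J\<close> on forms of bidegree \<open>(1,0)\<close>.\<close>

definition J_map :: "'n::{finite,linorder} superform \<Rightarrow> 'n superform" where
  "J_map \<alpha> = (\<lambda>K L. if K = {} then \<alpha> L {} else (\<lambda>x. 0))"

text \<open>The coefficient (which is \<open>1\<close> or \<open>- 1\<close>) of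
  \<open>dx\<^sub>1 \<and> d\<xi>\<^sub>1 \<and> \<dots> \<and> dx\<^sub>n \<and> d\<xi>\<^sub>n\<close> with respect to
  \<open>dx\<^sub>1 \<and> \<dots> \<and> dx\<^sub>n \<and> d\<xi>\<^sub>1 \<and> \<dots> \<and> d\<xi>\<^sub>n\<close>.\<close>

definition vol_sign :: "'n::{finite,linorder} itself \<Rightarrow> real" where
  "vol_sign _ = foldr (\<lambda>i \<omega>. wedge (wedge (dx i) (dxi i)) \<omega>)
     (sorted_list_of_set (UNIV :: 'n set)) (function_form (\<lambda>x. 1)) UNIV UNIV 0"

definition nonneg_top_form :: "'n::{finite,linorder} superform \<Rightarrow> bool" where
  "nonneg_top_form \<omega> \<longleftrightarrow> (\<exists>g. (\<forall>x. 0 \<le> g x) \<and>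
     \<omega> = (\<lambda>K L x. g x * form_power beta CARD('n) K L x))"

text \<open>The weights are nonnegative smooth functions, so that in bidegree \<open>(0,0)\<close> the strongly
  positive forms are the nonnegative smooth functions.\<close>

definition strongly_positive_form :: "nat \<Rightarrow> 'n::{finite,linorder} superform \<Rightarrow> bool" where
  "strongly_positive_form k \<alpha> \<longleftrightarrow> (\<exists>(S::nat) l A.
     (\<forall>s<S. smooth (l s) \<and> (\<forall>x. 0 \<le> l s x) \<and>
        length (A s) = k \<and> (\<forall>a\<in>set (A s). superform 1 0 a)) \<and>
     \<alpha> = (\<lambda>K L x. \<Sum>s<S. l s x *
       foldr (\<lambda>a \<omega>. wedge (wedge a (J_map a)) \<omega>) (A s) (function_form (\<lambda>x. 1)) K L x))"

definition compactly_supported_form :: "'n::{finite,linorder} superform \<Rightarrow> bool" where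
  "compactly_supported_form \<alpha> \<longleftrightarrow> (\<forall>K L. compact (closure {x. \<alpha> K L x \<noteq> 0}))"

definition m_positive_form :: "nat \<Rightarrow> 'n::{finite,linorder} superform \<Rightarrow> bool" where
  "m_positive_form m \<alpha> \<longleftrightarrow> superform 1 1 \<alpha> \<and> symmetric_form \<alpha> \<and>
     (\<forall>j\<in>{1..m}. nonneg_top_form (wedge (form_power \<alpha> j) (form_power beta (CARD('n) - j))))"

section \<open>Supercurrents\<close>

text \<open>\<open>T K L\<close> is the coefficient of \<open>dx\<^sub>K \<and> d\<xi>\<^sub>L\<close>, a distribution in \<open>x\<close>.\<close>

type_synonym 'n supercurrent = "'n set \<Rightarrow> 'n set \<Rightarrow> (real^'n \<Rightarrow> real) \<Rightarrow> real"

definition supercurrent :: "nat \<Rightarrow> nat \<Rightarrow> 'n::{finite,linorder} supercurrent \<Rightarrow> bool" where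
  "supercurrent p q T \<longleftrightarrow> (\<forall>K L. distribution (T K L)) \<and>
     (\<forall>K L \<phi>. card K \<noteq> p \<or> card L \<noteq> q \<longrightarrow> test_fun \<phi> \<longrightarrow> T K L \<phi> = 0)"

definition symmetric_current :: "'n::{finite,linorder} supercurrent \<Rightarrow> bool" where
  "symmetric_current T \<longleftrightarrow> (\<forall>K L \<phi>. test_fun \<phi> \<longrightarrow> T K L \<phi> = T L K \<phi>)"

text \<open>A distribution \<open>u\<close> times a smooth function \<open>f\<close> is \<open>\<phi> \<mapsto> u (f \<phi>)\<close>.\<close>

definition wedge_current ::
  "'n::{finite,linorder} supercurrent \<Rightarrow> 'n superform \<Rightarrow> 'n supercurrent" where
  "wedge_current T \<alpha> = (\<lambda>M N \<phi>. \<Sum>K\<in>Pow M. \<Sum>L\<in>Pow N.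
     wedge_sign K L (M - K) (N - L) * T K L (\<lambda>x. \<alpha> (M - K) (N - L) x * \<phi> x))"

text \<open>\<open>d T = \<Sum>\<^sub>i dx\<^sub>i \<and> \<partial>\<^sub>i T\<close> and \<open>d\<^sup># T = \<Sum>\<^sub>j d\<xi>\<^sub>j \<and> \<partial>\<^sub>j T\<close>, with
  \<open>(\<partial>\<^sub>i u)(\<phi>) = - u(\<partial>\<^sub>i \<phi>)\<close>.\<close>

definition d_current :: "'n::{finite,linorder} supercurrent \<Rightarrow> 'n supercurrent" where
  "d_current T = (\<lambda>M N \<phi>. \<Sum>i\<in>M.
     wedge_sign {i} {} (M - {i}) N * - T (M - {i}) N (pdiff i \<phi>))"

definition d_sharp_current :: "'n::{finite,linorder} supercurrent \<Rightarrow> 'n supercurrent" where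
  "d_sharp_current T = (\<lambda>M N \<phi>. \<Sum>j\<in>N.
     wedge_sign {} {j} M (N - {j}) * - T M (N - {j}) (pdiff j \<phi>))"

text \<open>The pairing \<open>\<langle>T, \<alpha>\<rangle> = \<integral> T \<and> \<alpha>\<close>: the total mass of the top coefficient of \<open>T \<and> \<alpha>\<close> with
  respect to \<open>dx\<^sub>1 \<and> d\<xi>\<^sub>1 \<and> \<dots> \<and> dx\<^sub>n \<and> d\<xi>\<^sub>n\<close>.\<close>

definition current_pairing ::
  "'n::{finite,linorder} supercurrent \<Rightarrow> 'n superform \<Rightarrow> real" where
  "current_pairing T \<alpha> =
     vol_sign TYPE('n) * (\<Sum>K\<in>UNIV. \<Sum>L\<in>UNIV. wedge_sign K L (- K) (- L) * T K L (\<alpha> (- K) (- L)))"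

text \<open>For a current of bidegree \<open>(n,n)\<close>: nonnegativity, and integration over \<open>A \<times> \<real>\<^sup>n\<close>.
  Both refer to the coefficient distribution with respect to
  \<open>dx\<^sub>1 \<and> d\<xi>\<^sub>1 \<and> \<dots> \<and> dx\<^sub>n \<and> d\<xi>\<^sub>n = \<beta>\<^sup>n / n!\<close>.\<close>

definition nonneg_top_current :: "'n::{finite,linorder} supercurrent \<Rightarrow> bool" where
  "nonneg_top_current S \<longleftrightarrow> (\<forall>\<phi>. test_fun \<phi> \<longrightarrow> (\<forall>x. 0 \<le> \<phi> x) \<longrightarrow>
     0 \<le> current_pairing S (function_form \<phi>))"

definition super_integral ::
  "(real^'n::{finite,linorder}) set \<Rightarrow> 'n supercurrent \<Rightarrow> real" where
  "super_integral A S = measure (density_measure (\<lambda>\<phi>. current_pairing S (function_form \<phi>))) A"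

text \<open>The parameter \<open>q\<close> stands for the bidegree \<open>(q,q)\<close>; the bidimension is
  \<open>(CARD('n) - q, CARD('n) - q)\<close>.\<close>

definition weakly_positive_current :: "nat \<Rightarrow> 'n::{finite,linorder} supercurrent \<Rightarrow> bool" where
  "weakly_positive_current q T \<longleftrightarrow> supercurrent q q T \<and> symmetric_current T \<and>
     (\<forall>\<alpha>. superform (CARD('n) - q) (CARD('n) - q) \<alpha> \<longrightarrow>
        compactly_supported_form \<alpha> \<longrightarrow> strongly_positive_form (CARD('n) - q) \<alpha> \<longrightarrow>
        0 \<le> current_pairing T \<alpha>)"

definition convex_current :: "nat \<Rightarrow> 'n::{finite,linorder} supercurrent \<Rightarrow> bool" where
  "convex_current q S \<longleftrightarrow> weakly_positive_current (Suc q) (d_current (d_sharp_current S))"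

definition m_positive_current ::
  "nat \<Rightarrow> nat \<Rightarrow> 'n::{finite,linorder} supercurrent \<Rightarrow> bool" where
  "m_positive_current m q T \<longleftrightarrow> q \<le> m \<and> supercurrent q q T \<and> symmetric_current T \<and>
     (\<forall>\<alpha>s. length \<alpha>s = m - q \<longrightarrow> (\<forall>\<alpha>\<in>set \<alpha>s. m_positive_form m \<alpha>) \<longrightarrow>
        nonneg_top_current
          (foldl wedge_current (wedge_current T (form_power beta (CARD('n) - m))) \<alpha>s))"

end

theory Submission
  imports Defs "HOL-Computational_Algebra.Polynomial"
begin

text \<open>Write \<open>s(x) = \<bar>x - a\<bar>\<^sup>2 / 2\<close>, \<open>S = T \<and> \<beta>\<^bsup>p-1\<^esup>\<close>, \<open>\<sigma> = T \<and> \<beta>\<^sup>p\<close> and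
  \<open>\<omega> = \<Sum>\<^sub>i\<^sub>j (x\<^sub>i - a\<^sub>i) (x\<^sub>j - a\<^sub>j) dx\<^sub>i \<and> d\<xi>\<^sub>j\<close>, and let \<open>2\<kappa> = (n/m) (m - n + p)\<close> be the exponent.
  The limit exists because \<open>r\<^bsup>-2\<kappa>\<^esup> \<sigma>(ball a r)\<close> is a nondecreasing function of \<open>r\<close>.  Two inequalities
  give this.

  The first comes from \<open>m\<close>-positivity.  As \<open>\<omega> \<and> \<omega> = 0\<close>, the powers of \<open>\<beta> - c \<omega>\<close> are
  \<open>\<beta>\<^sup>j - j c \<omega> \<and> \<beta>\<^bsup>j-1\<^esup>\<close>, and \<open>\<omega> \<and> \<beta>\<^bsup>n-1\<^esup> = (\<bar>x - a\<bar>\<^sup>2 / n) \<beta>\<^sup>n\<close>, so \<open>\<beta> - c \<omega>\<close> is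
  \<open>m\<close>-positive whenever \<open>0 \<le> c \<bar>x - a\<bar>\<^sup>2 \<le> n/m\<close>.  In the extreme case \<open>c = n / (m \<bar>x - a\<bar>\<^sup>2)\<close> it is,
  up to a positive factor, \<open>dd\<^sup>#\<close> of the radial function \<open>\<plusminus> \<bar>x - a\<bar>\<^bsup>2-n/m\<^esup>\<close> (a logarithm if \<open>n = 2m\<close>),
  and its \<open>m\<close>-th power wedged with \<open>\<beta>\<^bsup>n-m\<^esup>\<close> vanishes.  Taking all \<open>m - n + p\<close> forms in the definition of
  \<open>m\<close>-positivity of \<open>T\<close> equal to \<open>\<beta> - c \<omega>\<close> yields \<open>\<sigma> \<ge> (m - n + p) c S \<and> \<omega>\<close>, that is,
  \<open>\<kappa> S \<and> \<omega> \<le> s \<sigma>\<close> (\<open>m_positive_current_rank_one_inequality\<close>; the singularity of \<open>c\<close> at \<open>a\<close>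
  is avoided by a small additive constant in the denominator).

  The second comes from convexity.  The Hessian of \<open>g(s)\<close> is \<open>g'(s) \<beta> + g''(s) \<omega>\<close>, so convexity of \<open>S\<close>
  tested on \<open>g(s) \<ge> 0\<close> says \<open>\<integral> g'(s) d\<sigma> + \<integral> g''(s) S \<and> \<omega> \<ge> 0\<close>
  (\<open>convex_current_radial_inequality\<close>).

  With \<open>g' = - h\<close> for a decreasing profile \<open>h\<close> the two combine to
  \<open>\<kappa> \<integral> h(s) d\<sigma> + \<integral> s h'(s) d\<sigma> \<le> 0\<close> (\<open>decreasing_profile\<close>).  For \<open>h(s/t)\<close> in place of \<open>h\<close> this is
  the statement that \<open>t\<^bsup>-\<kappa>\<^esup> \<integral> h(s/t) d\<sigma>\<close> has nonnegative derivative in \<open>t\<close>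
  (\<open>scaled_profile_monotone\<close>), and when \<open>h\<close> tends to the indicator function of \<open>s < 1\<close> the integral
  becomes the mass of the ball of radius \<open>\<surd>(2t)\<close> (\<open>mass_ratio_monotone\<close>).

  The mass of a ball refers to the Radon measure representing the nonnegative distribution \<open>\<sigma>\<close>.
  Its existence and uniqueness are a Riesz representation theorem for functionals on smooth
  functions, obtained from an outer measure (\<open>density_measure_eq\<close>).\<close>

section \<open>Smooth functions of one real variable\<close>

text \<open>Being \<open>k\<close> times continuously differentiable, as a recursion on \<open>k\<close>: closure properties then follow
  by induction, without formulas for higher derivatives.\<close>

primrec ck_real :: "nat \<Rightarrow> (real \<Rightarrow> real) \<Rightarrow> bool" where
  "ck_real 0 f \<longleftrightarrow> continuous_on UNIV f"
| "ck_real (Suc k) f \<longleftrightarrow> (\<exists>f'. (\<forall>x. (f has_real_derivative f' x) (at x)) \<and> ck_real k f')"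

lemma ck_real_continuous: "ck_real k f \<Longrightarrow> continuous_on UNIV f"
  by (cases k) (auto intro!: continuous_at_imp_continuous_on intro: DERIV_isCont)

lemma ck_real_Suc_imp: "ck_real (Suc k) f \<Longrightarrow> ck_real k f"
proof (induction k arbitrary: f)
  case 0
  then show ?case using ck_real_continuous[of "Suc 0"] by simp
next
  case (Suc k)
  then obtain f' where "\<forall>x. (f has_real_derivative f' x) (at x)" "ck_real (Suc k) f'"
    by (auto simp del: ck_real.simps simp: ck_real.simps(2)[of "Suc k"])
  with Suc.IH show ?case by (auto simp del: ck_real.simps simp: ck_real.simps(2)[of k])
qed

lemma ck_real_const: "ck_real k (\<lambda>x. c)"
proof (induction k arbitrary: c)
  case (Suc k)
  then show ?case by (auto intro!: exI[of _ "\<lambda>x. 0"])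
qed simp

lemma ck_real_add: "ck_real k f \<Longrightarrow> ck_real k g \<Longrightarrow> ck_real k (\<lambda>x. f x + g x)"
proof (induction k arbitrary: f g)
  case 0
  then show ?case by (auto intro: continuous_on_add)
next
  case (Suc k)
  from Suc.prems obtain f' g' where fg: "\<forall>x. (f has_real_derivative f' x) (at x)" "ck_real k f'"
    "\<forall>x. (g has_real_derivative g' x) (at x)" "ck_real k g'" by auto
  then have "\<forall>x. ((\<lambda>x. f x + g x) has_real_derivative f' x + g' x) (at x)"
    by (auto intro: DERIV_add)
  with Suc.IH[OF fg(2,4)] show ?case by auto
qed

lemma ck_real_mult: "ck_real k f \<Longrightarrow> ck_real k g \<Longrightarrow> ck_real k (\<lambda>x. f x * g x)"
proof (induction k arbitrary: f g)
  case 0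
  then show ?case by (auto intro: continuous_on_mult)
next
  case (Suc k)
  from Suc.prems obtain f' g' where fg: "\<forall>x. (f has_real_derivative f' x) (at x)" "ck_real k f'"
    "\<forall>x. (g has_real_derivative g' x) (at x)" "ck_real k g'" by auto
  then have "\<forall>x. ((\<lambda>x. f x * g x) has_real_derivative f' x * g x + g' x * f x) (at x)"
    by (auto intro: DERIV_mult)
  moreover have "ck_real k f" "ck_real k g" using Suc.prems ck_real_Suc_imp by auto
  then have "ck_real k (\<lambda>x. f' x * g x + g' x * f x)"
    using Suc.IH fg by (intro ck_real_add) auto
  ultimately show ?case unfolding ck_real.simps
    by (intro exI[of _ "\<lambda>x. f' x * g x + g' x * f x"]) auto
qed

lemma ck_real_affine: "ck_real k f \<Longrightarrow> ck_real k (\<lambda>x. f (c * x + d))"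
proof (induction k arbitrary: f)
  case 0
  then show ?case
    by (auto intro!: continuous_on_compose2[of UNIV f] continuous_intros)
next
  case (Suc k)
  from Suc.prems obtain f' where f: "\<forall>x. (f has_real_derivative f' x) (at x)" "ck_real k f'"
    by auto
  have "((\<lambda>x. f (c * x + d)) has_real_derivative c * f' (c * x + d)) (at x)" for x
  proof -
    have 1: "((\<lambda>x. c * x + d) has_real_derivative c) (at x)"
      by (auto intro!: derivative_eq_intros)
    show ?thesis using DERIV_chain2[OF f(1)[rule_format] 1] by (simp add: mult.commute)
  qed
  moreover have "ck_real k (\<lambda>x. c * f' (c * x + d))"
    using Suc.IH[OF f(2)] by (intro ck_real_mult ck_real_const)
  ultimately show ?case unfolding ck_real.simps
    by (intro exI[of _ "\<lambda>x. c * f' (c * x + d)"]) auto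
qed

lemma continuous_has_antiderivative:
  fixes f :: "real \<Rightarrow> real"
  assumes "continuous_on UNIV f"
  shows "\<exists>F. \<forall>x. (F has_real_derivative f x) (at x)"
proof (intro exI allI)
  fix x :: real
  define a b where "a = min 0 x - 1" and "b = max 0 x + 1"
  have "continuous_on {a..b} f" using assms continuous_on_subset by blast
  then have "((\<lambda>u. LBINT y=ereal 0..ereal u. f y) has_vector_derivative f x) (at x within {a..b})"
    by (intro interval_integral_FTC2) (auto simp: a_def b_def)
  then have "((\<lambda>u. LBINT y=ereal 0..ereal u. f y) has_real_derivative f x) (at x within {a..b})"
    by (simp add: has_real_derivative_iff_has_vector_derivative)
  moreover have "at x within {a..b} = at x"
    by (rule at_within_interior) (auto simp: a_def b_def)
  ultimately show "((\<lambda>u. LBINT y=ereal 0..ereal u. f y) has_real_derivative f x) (at x)" by simp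
qed

text \<open>Averages of the rescalings \<open>f(s/t)\<close> with a power weight in \<open>t\<close>; each derivative in \<open>s\<close> lowers the
  exponent of the weight by one.\<close>

lemma scale_integral_has_derivative:
  assumes f: "\<And>x. (f has_real_derivative f' x) (at x)" and cf': "continuous_on UNIV f'"
    and "0 < t1"
  shows "((\<lambda>s. integral {t1..t2} (\<lambda>t. t powr e * f (s / t))) has_real_derivative
      integral {t1..t2} (\<lambda>t. t powr (e - 1) * f' (s / t))) (at s)"
proof -
  have cf: "continuous_on UNIV f"
    using f by (auto intro!: continuous_at_imp_continuous_on intro: DERIV_isCont)
  have "((\<lambda>s. integral (cbox t1 t2) (\<lambda>t. t powr e * f (s / t))) has_real_derivative
      integral (cbox t1 t2) (\<lambda>t. t powr (e - 1) * f' (s / t))) (at s within UNIV)"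
  proof (rule leibniz_rule_field_derivative)
    fix x t assume t: "t \<in> cbox t1 t2"
    with assms(3) have "t > 0" by auto
    have 1: "((\<lambda>x. x / t) has_real_derivative 1 / t) (at x)"
      using \<open>t > 0\<close> by (auto intro!: derivative_eq_intros)
    have "((\<lambda>x. t powr e * f (x / t)) has_real_derivative t powr e * (f' (x / t) * (1 / t))) (at x)"
      by (intro DERIV_cmult DERIV_chain2[OF f 1])
    moreover have "t powr e * (f' (x / t) * (1 / t)) = t powr (e - 1) * f' (x / t)"
      using \<open>t > 0\<close> by (simp add: powr_diff)
    ultimately show "((\<lambda>x. t powr e * f (x / t)) has_real_derivative t powr (e - 1) * f' (x / t))
      (at x within UNIV)" by simp
  next
    fix x
    show "(\<lambda>t. t powr e * f (x / t)) integrable_on cbox t1 t2"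
      using assms(3) by (intro integrable_continuous continuous_intros continuous_on_compose2[OF cf]) auto
  next
    show "continuous_on (UNIV \<times> cbox t1 t2) (\<lambda>(x, t). t powr (e - 1) * f' (x / t))"
      using assms(3) cf' unfolding split_beta
      by (auto intro!: continuous_intros continuous_on_compose2[of UNIV f'])
  qed auto
  then show ?thesis by simp
qed

lemma ck_real_scale_integral:
  assumes "ck_real k f" "0 < t1"
  shows "ck_real k (\<lambda>s. integral {t1..t2} (\<lambda>t. t powr e * f (s / t)))"
  using assms(1)
proof (induction k arbitrary: f e)
  case 0
  have "continuous_on (UNIV \<times> cbox t1 t2) (\<lambda>(s, t). t powr e * f (s / t))"
    using assms(2) 0 unfolding split_beta
    by (auto intro!: continuous_intros continuous_on_compose2[of UNIV f])
  from integral_continuous_on_param[OF this]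
  show ?case by simp
next
  case (Suc k)
  from Suc.prems obtain f' where f: "\<And>x. (f has_real_derivative f' x) (at x)" "ck_real k f'"
    by auto
  note scale_integral_has_derivative[OF f(1) ck_real_continuous[OF f(2)] assms(2)]
  with Suc.IH[OF f(2), of "e - 1"] show ?case
    by (auto intro!: exI[of _ "\<lambda>s. integral {t1..t2} (\<lambda>t. t powr (e - 1) * f' (s / t))"])
qed

text \<open>The classical flat functions.  The polynomial factor makes the family closed under
  differentiation.\<close>

definition flat_exp :: "real poly \<Rightarrow> real \<Rightarrow> real" where
  "flat_exp p t = (if t > 0 then poly p (1 / t) * exp (- (1 / t)) else 0)"

lemma poly_times_exp_minus_tendsto_0: "((\<lambda>s::real. poly p s * exp (- s)) \<longlongrightarrow> 0) at_top"
proof -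
  have "((\<lambda>s::real. \<Sum>i\<le>degree p. coeff p i * (s ^ i / exp s)) \<longlongrightarrow> 0) at_top"
    by (intro tendsto_null_sum tendsto_mult_right_zero tendsto_power_div_exp_0)
  then show ?thesis
    by (simp add: poly_altdef exp_minus sum_distrib_right divide_inverse mult.assoc)
qed

lemma flat_exp_deriv:
  "(flat_exp p has_real_derivative flat_exp ([:0, 0, 1:] * (p - pderiv p)) x) (at x)"
proof -
  consider "x > 0" | "x < 0" | "x = 0" by linarith
  then show ?thesis
  proof cases
    case 1
    have "((\<lambda>t. poly p (1 / t) * exp (- (1 / t))) has_real_derivative
       flat_exp ([:0, 0, 1:] * (p - pderiv p)) x) (at x)"
      unfolding flat_exp_def using 1
      by (auto intro!: derivative_eq_intros poly_DERIV[THEN DERIV_chain2] simp: field_simps power2_eq_square)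
    moreover have "\<forall>\<^sub>F t in nhds x. poly p (1 / t) * exp (- (1 / t)) = flat_exp p t"
      using eventually_nhds_in_open[of "{0<..}" x] 1
      by (auto elim!: eventually_mono simp: flat_exp_def)
    ultimately show ?thesis by (rule DERIV_cong_ev[OF refl _ refl, THEN iffD1, rotated])
  next
    case 2
    have "\<forall>\<^sub>F t in nhds x. 0 = flat_exp p t"
      using eventually_nhds_in_open[of "{..<0}" x] 2
      by (auto elim!: eventually_mono simp: flat_exp_def)
    moreover have "((\<lambda>t. 0) has_real_derivative flat_exp ([:0, 0, 1:] * (p - pderiv p)) x) (at x)"
      using 2 by (simp add: flat_exp_def)
    ultimately show ?thesis by (rule DERIV_cong_ev[OF refl _ refl, THEN iffD1])
  next
    case 3
    have "((\<lambda>t. flat_exp p t / t) \<longlongrightarrow> 0) (at_right 0)"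
    proof (rule Lim_transform_eventually)
      show "((\<lambda>t. poly (pCons 0 p) (inverse t) * exp (- inverse t)) \<longlongrightarrow> 0) (at_right (0::real))"
        by (rule filterlim_compose[OF poly_times_exp_minus_tendsto_0 filterlim_inverse_at_top_right])
      show "\<forall>\<^sub>F t in at_right 0. poly (pCons 0 p) (inverse t) * exp (- inverse t) = flat_exp p t / t"
        using eventually_at_right_less[of "0::real"]
        by (auto elim!: eventually_mono simp: flat_exp_def field_simps)
    qed
    moreover have "((\<lambda>t. flat_exp p t / t) \<longlongrightarrow> 0) (at_left 0)"
    proof (rule Lim_transform_eventually)
      show "\<forall>\<^sub>F t in at_left 0. 0 = flat_exp p t / t"
        unfolding eventually_at_filter by (auto simp: flat_exp_def)
    qed simp
    ultimately have "((\<lambda>t. flat_exp p t / t) \<longlongrightarrow> 0) (at 0)"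
      by (simp add: filterlim_split_at)
    then show ?thesis unfolding 3 has_field_derivative_iff by (simp add: flat_exp_def)
  qed
qed

lemma flat_exp_smooth: "ck_real k (flat_exp p)"
proof (induction k arbitrary: p)
  case 0
  show ?case using flat_exp_deriv by (auto intro!: DERIV_continuous_on)
next
  case (Suc k)
  then show ?case using flat_exp_deriv unfolding ck_real.simps by blast
qed

text \<open>A normalised antiderivative of a smooth bump supported in \<open>[0, 1]\<close>.\<close>

lemma smooth_step_exists:
  obtains h h' :: "real \<Rightarrow> real"
  where "\<And>k. ck_real k h" "\<And>k. ck_real k h'"
    "\<And>t. (h has_real_derivative h' t) (at t)" "\<And>t. h' t \<ge> 0"
    "\<And>t. t \<le> 0 \<Longrightarrow> h t = 0" "\<And>t. t \<ge> 1 \<Longrightarrow> h t = 1" "\<And>t. 0 \<le> h t" "\<And>t. h t \<le> 1"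
proof -
  define b where "b t = flat_exp 1 t * flat_exp 1 (- 1 * t + 1)" for t
  have bs: "ck_real k b" for k unfolding b_def[abs_def]
    by (intro ck_real_mult ck_real_affine flat_exp_smooth)
  have b0: "b t \<ge> 0" for t by (simp add: b_def flat_exp_def)
  have bz: "b t = 0" if "t \<le> 0 \<or> t \<ge> 1" for t using that by (auto simp: b_def flat_exp_def)
  have bp: "b t > 0" if "0 < t" "t < 1" for t using that by (auto simp: b_def flat_exp_def)
  obtain B where B: "\<And>t. (B has_real_derivative b t) (at t)"
    using continuous_has_antiderivative[OF ck_real_continuous[OF bs]] by blast
  have mono: "B s \<le> B t" if "s \<le> t" for s t
    by (rule DERIV_nonneg_imp_nondecreasing[OF that]) (use B b0 in blast)
  have "B 0 < B 1"
    by (rule DERIV_pos_imp_increasing_open[of 0 1 B])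
      (use B bp in \<open>auto intro!: DERIV_continuous_on[OF has_field_derivative_at_within]\<close>)
  have c0: "B t = B 0" if "t \<le> 0" for t
  proof -
    have "B 0 \<le> B t"
      by (rule DERIV_nonpos_imp_nonincreasing[OF that]) (use B bz in fastforce)
    with mono[OF that] show ?thesis by simp
  qed
  have c1: "B t = B 1" if "t \<ge> 1" for t
  proof -
    have "B t \<le> B 1"
      by (rule DERIV_nonpos_imp_nonincreasing[OF that]) (use B bz in fastforce)
    with mono[OF that] show ?thesis by simp
  qed
  define c where "c = 1 / (B 1 - B 0)"
  define h where "h t = c * (B t + - B 0)" for t
  define h' where "h' t = c * b t" for t
  have "c > 0" using \<open>B 0 < B 1\<close> by (simp add: c_def)
  have h': "ck_real k h'" for k unfolding h'_def[abs_def] by (intro ck_real_mult ck_real_const bs)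
  have d: "(h has_real_derivative h' t) (at t)" for t
    unfolding h_def h'_def by (intro DERIV_cmult) (auto intro!: derivative_eq_intros B)
  have hs: "ck_real k h" for k
  proof (rule ck_real_Suc_imp)
    show "ck_real (Suc k) h" using d h' by auto
  qed
  show ?thesis
  proof
    fix t
    show "h' t \<ge> 0" using \<open>c > 0\<close> b0 by (simp add: h'_def)
    show "0 \<le> h t"
      using mono[of 0 t] c0[of t] \<open>c > 0\<close> by (cases "t \<le> 0") (auto simp: h_def)
    have "B t \<le> B 1" using mono[of t 1] c1[of t] by (cases "t \<le> 1") auto
    then show "h t \<le> 1" using \<open>B 0 < B 1\<close> by (simp add: h_def c_def)
    show "t \<le> 0 \<Longrightarrow> h t = 0" using c0[of t] by (simp add: h_def)
    show "t \<ge> 1 \<Longrightarrow> h t = 1" using c1[of t] \<open>B 0 < B 1\<close> by (simp add: h_def c_def)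
  qed (use h' d hs in auto)
qed

section \<open>Smooth functions on Euclidean space\<close>

text \<open>As for functions of one variable, a recursive form of smoothness in which closure under products and
  compositions can be proved by induction on the order.\<close>

primrec ck :: "nat \<Rightarrow> (real^'n::finite \<Rightarrow> real) \<Rightarrow> bool" where
  "ck 0 f \<longleftrightarrow> True"
| "ck (Suc k) f \<longleftrightarrow> f differentiable_on UNIV \<and> (\<forall>i. ck k (pdiff i f))"

lemma smooth_iff_ck: "smooth f \<longleftrightarrow> (\<forall>k. ck k f)"
proof -
  have "ck k f \<longleftrightarrow> (\<forall>is. length is < k \<longrightarrow> foldr pdiff is f differentiable_on UNIV)" for k
  proof (induction k arbitrary: f)
    case (Suc k)
    show ?case
    proof
      assume *: "ck (Suc k) f"
      show "\<forall>is. length is < Suc k \<longrightarrow> foldr pdiff is f differentiable_on UNIV"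
      proof (intro allI impI)
        fix is' :: "'a list" assume "length is' < Suc k"
        then show "foldr pdiff is' f differentiable_on UNIV"
          using * Suc by (cases is' rule: rev_cases) auto
      qed
    next
      assume *: "\<forall>is. length is < Suc k \<longrightarrow> foldr pdiff is f differentiable_on UNIV"
      have "f differentiable_on UNIV" using *[rule_format, of "[]"] by simp
      moreover have "foldr pdiff is' (pdiff i f) differentiable_on UNIV" if "length is' < k" for i is'
        using *[rule_format, of "is' @ [i]"] that by simp
      ultimately show "ck (Suc k) f" using Suc by simp
    qed
  qed simp
  then show ?thesis unfolding smooth_def by (metis lessI)
qed

lemma ck_Suc_imp: "ck (Suc k) f \<Longrightarrow> ck k f"
  by (induction k arbitrary: f) auto

lemma pdiff_eq: "(f has_derivative f') (at x) \<Longrightarrow> pdiff i f x = f' (axis i 1)"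
  unfolding pdiff_def by (metis frechet_derivative_at)

lemma has_derivative_frechet:
  "f differentiable_on UNIV \<Longrightarrow> (f has_derivative frechet_derivative f (at x)) (at x)"
  by (simp add: differentiable_on_def frechet_derivative_works[symmetric])

lemma ck_const: "ck k (\<lambda>x. c)"
proof (induction k arbitrary: c)
  case (Suc k)
  have "pdiff i (\<lambda>x. c) = (\<lambda>x. 0)" for i :: 'a
    by (auto simp: pdiff_eq[OF has_derivative_const])
  with Suc show ?case by simp
qed simp

lemma pdiff_add:
  assumes "f differentiable_on UNIV" "g differentiable_on UNIV"
  shows "pdiff i (\<lambda>x. f x + g x) = (\<lambda>x. pdiff i f x + pdiff i g x)"
proof
  fix x
  show "pdiff i (\<lambda>x. f x + g x) x = pdiff i f x + pdiff i g x"
    using pdiff_eq[OF has_derivative_add[OF has_derivative_frechet[OF assms(1)]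
      has_derivative_frechet[OF assms(2)]], of i x] by (simp add: pdiff_def)
qed

lemma pdiff_mult:
  assumes "f differentiable_on UNIV" "g differentiable_on UNIV"
  shows "pdiff i (\<lambda>x. f x * g x) = (\<lambda>x. f x * pdiff i g x + pdiff i f x * g x)"
proof
  fix x
  show "pdiff i (\<lambda>x. f x * g x) x = f x * pdiff i g x + pdiff i f x * g x"
    using pdiff_eq[OF has_derivative_mult[OF has_derivative_frechet[OF assms(1)]
      has_derivative_frechet[OF assms(2)]], of i x] by (simp add: pdiff_def)
qed

lemma pdiff_compose_real:
  assumes "\<And>t. (h has_real_derivative h' t) (at t)" "f differentiable_on UNIV"
  shows "pdiff i (\<lambda>x. h (f x)) = (\<lambda>x. h' (f x) * pdiff i f x)"
    and "(\<lambda>x. h (f x)) differentiable_on UNIV"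
proof -
  have *: "((\<lambda>x. h (f x)) has_derivative (\<lambda>v. frechet_derivative f (at x) v * h' (f x))) (at x)" for x
    using has_derivative_in_compose[OF has_derivative_frechet[OF assms(2), of x], of h "\<lambda>v. v * h' (f x)"]
      assms(1)[of "f x"]
    by (simp add: has_field_derivative_def mult.commute[of _ "h' (f x)"] has_derivative_at_withinI)
  show "pdiff i (\<lambda>x. h (f x)) = (\<lambda>x. h' (f x) * pdiff i f x)"
    using pdiff_eq[OF *] by (auto simp: pdiff_def)
  show "(\<lambda>x. h (f x)) differentiable_on UNIV"
    using * by (auto simp: differentiable_on_def differentiable_def)
qed

lemma ck_add: "ck k f \<Longrightarrow> ck k g \<Longrightarrow> ck k (\<lambda>x. f x + g x)"
  by (induction k arbitrary: f g) (auto simp: pdiff_add)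

lemma ck_mult: "ck k f \<Longrightarrow> ck k g \<Longrightarrow> ck k (\<lambda>x. f x * g x)"
proof (induction k arbitrary: f g)
  case (Suc k)
  have "ck k f" "ck k g" using Suc.prems ck_Suc_imp by blast+
  with Suc show ?case by (auto simp: pdiff_mult intro!: ck_add)
qed simp

lemma ck_compose_real: "ck_real k h \<Longrightarrow> ck k f \<Longrightarrow> ck k (\<lambda>x. h (f x))"
proof (induction k arbitrary: h)
  case (Suc k)
  from Suc.prems(1) obtain h' where h: "\<And>t. (h has_real_derivative h' t) (at t)" "ck_real k h'"
    by auto
  from Suc.prems(2) have f: "f differentiable_on UNIV" "\<And>i. ck k (pdiff i f)" by auto
  have "ck k f" using Suc.prems ck_Suc_imp by blast
  then have "ck k (\<lambda>x. h' (f x))" using Suc.IH h(2) by blast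
  then show ?case
    using pdiff_compose_real[OF h(1) f(1)] f(2) by (auto intro!: ck_mult)
qed simp

lemma ck_inverse: "ck k f \<Longrightarrow> (\<And>x. f x \<noteq> 0) \<Longrightarrow> ck k (\<lambda>x. inverse (f x))"
proof (induction k)
  case (Suc k)
  then have f: "f differentiable_on UNIV" "\<And>i. ck k (pdiff i f)" by auto
  have "ck k f" using Suc.prems ck_Suc_imp by blast
  then have i: "ck k (\<lambda>x. inverse (f x))" using Suc by blast
  have d: "((\<lambda>x. inverse (f x)) has_derivative
      (\<lambda>v. - (inverse (f x) * frechet_derivative f (at x) v * inverse (f x)))) (at x)" for x
    by (rule Deriv.has_derivative_inverse[where f = f, OF Suc.prems(2) has_derivative_frechet[OF f(1)]])
  then have "pdiff j (\<lambda>x. inverse (f x)) = (\<lambda>x. - 1 * (inverse (f x) * pdiff j f x * inverse (f x)))" for j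
    using pdiff_eq[OF d] by (auto simp: pdiff_def)
  moreover have "(\<lambda>x. inverse (f x)) differentiable_on UNIV"
    using d by (auto simp: differentiable_on_def differentiable_def)
  moreover have "ck k (\<lambda>x. - 1 * (inverse (f x) * pdiff j f x * inverse (f x)))" for j
    using i f(2) by (intro ck_mult ck_const)
  ultimately show ?case unfolding ck.simps by metis
qed simp

lemma pdiff_coordinate: "pdiff i (\<lambda>x. x $ j) = (\<lambda>x. if i = j then 1 else 0)"
proof
  fix x :: "real^'a"
  have "((\<lambda>x. x $ j) has_derivative (\<lambda>x. x $ j)) (at x)"
    by (intro bounded_linear_imp_has_derivative bounded_linear_vec_nth)
  from pdiff_eq[OF this] show "pdiff i (\<lambda>x. x $ j) x = (if i = j then 1 else 0)"
    by (simp add: axis_def)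
qed

lemma differentiable_coordinate: "(\<lambda>x. x $ j) differentiable_on UNIV"
  using bounded_linear_imp_differentiable[OF bounded_linear_vec_nth]
  by (auto simp: differentiable_on_def intro: differentiable_at_withinI)

lemma smooth_const [simp]: "smooth (\<lambda>x. c)"
  by (simp add: smooth_iff_ck ck_const)

lemma smooth_coordinate: "smooth (\<lambda>x. x $ j)"
  unfolding smooth_iff_ck
proof
  fix k
  show "ck k (\<lambda>x. x $ j)"
    using differentiable_coordinate by (cases k) (auto simp: pdiff_coordinate ck_const)
qed

lemma smooth_add: "smooth f \<Longrightarrow> smooth g \<Longrightarrow> smooth (\<lambda>x. f x + g x)"
  by (simp add: smooth_iff_ck ck_add)

lemma smooth_mult: "smooth f \<Longrightarrow> smooth g \<Longrightarrow> smooth (\<lambda>x. f x * g x)"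
  by (simp add: smooth_iff_ck ck_mult)

lemma smooth_diff: "smooth f \<Longrightarrow> smooth g \<Longrightarrow> smooth (\<lambda>x. f x - g x)"
  using smooth_add[of f "\<lambda>x. - 1 * g x"] smooth_mult[of "\<lambda>x. - 1" g] by simp

lemma smooth_sum: "(\<And>i. i \<in> A \<Longrightarrow> smooth (f i)) \<Longrightarrow> smooth (\<lambda>x. \<Sum>i\<in>A. f i x)"
  by (induction A rule: infinite_finite_induct) (auto intro: smooth_add)

lemma smooth_inverse: "smooth f \<Longrightarrow> (\<And>x. f x \<noteq> 0) \<Longrightarrow> smooth (\<lambda>x. inverse (f x))"
  by (simp add: smooth_iff_ck ck_inverse)

lemma smooth_compose_real: "(\<And>k. ck_real k h) \<Longrightarrow> smooth f \<Longrightarrow> smooth (\<lambda>x. h (f x))"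
  by (simp add: smooth_iff_ck ck_compose_real)

lemma smooth_differentiable: "smooth f \<Longrightarrow> f differentiable_on UNIV"
  using smooth_iff_ck[of f] by (metis ck.simps(2))

lemma smooth_continuous: "smooth f \<Longrightarrow> continuous_on UNIV f"
  by (intro differentiable_imp_continuous_on smooth_differentiable)

text \<open>Half the squared distance, rather than the distance itself, is the radial variable: it is
  smooth at the centre, and its Hessian is the identity.\<close>

definition half_sqdist :: "real^'n::finite \<Rightarrow> real^'n \<Rightarrow> real" where
  "half_sqdist a x = (\<Sum>i\<in>UNIV. (x $ i + - a $ i) * (x $ i + - a $ i)) / 2"

lemma half_sqdist_eq: "half_sqdist a x = (norm (x - a))\<^sup>2 / 2"
  by (simp add: half_sqdist_def norm_eq_sqrt_inner inner_vec_def sum_nonneg)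

lemma smooth_half_sqdist: "smooth (half_sqdist a)"
  unfolding half_sqdist_def[abs_def] divide_inverse
  by (intro smooth_mult smooth_sum smooth_add smooth_coordinate smooth_const)

lemma pdiff_half_sqdist: "pdiff i (half_sqdist a) = (\<lambda>x. x $ i - a $ i)"
proof
  fix x
  have 1: "((\<lambda>x. x $ j + - a $ j) has_derivative (\<lambda>v. v $ j)) (at x)" for j
    by (intro has_derivative_add_const bounded_linear_imp_has_derivative bounded_linear_vec_nth)
  have "((\<lambda>x. \<Sum>j\<in>UNIV. (x $ j + - a $ j) * (x $ j + - a $ j)) has_derivative
      (\<lambda>v. \<Sum>j\<in>UNIV. (x $ j + - a $ j) * v $ j + v $ j * (x $ j + - a $ j))) (at x)"
    by (intro has_derivative_sum has_derivative_mult[OF 1 1])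
  from bounded_linear.has_derivative[OF bounded_linear_divide this, of 2]
  have "(half_sqdist a has_derivative
      (\<lambda>v. (\<Sum>j\<in>UNIV. (x $ j + - a $ j) * v $ j + v $ j * (x $ j + - a $ j)) / 2)) (at x)"
    unfolding half_sqdist_def[abs_def] .
  moreover have "(x $ j + - a $ j) * axis i 1 $ j + axis i 1 $ j * (x $ j + - a $ j)
      = (if j = i then 2 * (x $ j - a $ j) else 0)" for j
    by (simp add: axis_def)
  ultimately have "pdiff i (half_sqdist a) x
      = (\<Sum>j\<in>UNIV. if j = i then 2 * (x $ j - a $ j) else 0) / 2"
    using pdiff_eq[of "half_sqdist a" _ x i] by (simp only:)
  then show "pdiff i (half_sqdist a) x = x $ i - a $ i"
    by (simp add: sum.delta)
qed

section \<open>Test functions\<close>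

lemma test_funI:
  assumes "smooth f" "compact K" "\<And>x. f x \<noteq> 0 \<Longrightarrow> x \<in> K"
  shows "test_fun f"
proof -
  have "closure {x. f x \<noteq> 0} \<subseteq> K"
    using assms by (intro closure_minimal) (auto simp: compact_imp_closed)
  then have "compact (closure {x. f x \<noteq> 0})"
    using assms(2) compact_Int_closed[of K "closure {x. f x \<noteq> 0}"] by (simp add: Int_absorb1)
  with assms show ?thesis by (simp add: test_fun_def)
qed

lemma test_fun_smooth: "test_fun f \<Longrightarrow> smooth f"
  by (simp add: test_fun_def)

lemma test_fun_mult: "test_fun f \<Longrightarrow> smooth g \<Longrightarrow> test_fun (\<lambda>x. g x * f x)"
  by (rule test_funI[of _ "closure {x. f x \<noteq> 0}"])
    (auto simp: test_fun_def intro: smooth_mult closure_subset[THEN subsetD])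

lemma test_fun_zero: "test_fun (\<lambda>x. 0)"
  by (simp add: test_fun_def)

lemma test_fun_add: "test_fun f \<Longrightarrow> test_fun g \<Longrightarrow> test_fun (\<lambda>x. f x + g x)"
  by (rule test_funI[of _ "closure {x. f x \<noteq> 0} \<union> closure {x. g x \<noteq> 0}"])
    (auto simp: test_fun_def intro!: smooth_add closure_subset[THEN subsetD])

lemma test_fun_lincomb:
  "test_fun f \<Longrightarrow> test_fun g \<Longrightarrow> test_fun (\<lambda>x. a * f x + b * g x)"
  by (intro test_fun_add test_fun_mult smooth_const)

lemma test_fun_diff: "test_fun f \<Longrightarrow> test_fun g \<Longrightarrow> test_fun (\<lambda>x. f x - g x)"
  using test_fun_lincomb[of f g 1 "- 1"] by simp

lemma test_fun_sum: "(\<And>i. i \<in> A \<Longrightarrow> test_fun (f i)) \<Longrightarrow> test_fun (\<lambda>x. \<Sum>i\<in>A. f i x)"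
  by (induction A rule: infinite_finite_induct) (auto intro: test_fun_add test_fun_zero)

text \<open>The flat function of \<open>r\<^sup>2 - \<bar>x - a\<bar>\<^sup>2\<close>.\<close>

lemma bump_exists:
  fixes a :: "real^'n::finite"
  assumes "r > 0"
  obtains f where "smooth f" "\<And>x. 0 \<le> f x" "\<And>x. f x > 0 \<longleftrightarrow> x \<in> ball a r"
proof
  let ?f = "\<lambda>x. flat_exp 1 (- 1 * half_sqdist a x + r\<^sup>2 / 2)"
  show "smooth ?f"
    using smooth_compose_real[OF ck_real_affine[OF flat_exp_smooth] smooth_half_sqdist] .
  show "0 \<le> ?f x" for x by (simp add: flat_exp_def)
  have "(norm (x - a))\<^sup>2 < r\<^sup>2 \<longleftrightarrow> norm (x - a) < r" for x
    using assms by (meson norm_ge_zero order_less_imp_le power2_less_imp_less power_strict_mono zero_less_numeral)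
  then show "?f x > 0 \<longleftrightarrow> x \<in> ball a r" for x
    by (auto simp: flat_exp_def half_sqdist_eq dist_norm norm_minus_commute[of a])
qed

text \<open>A finite sum of bumps around points of \<open>K\<close> is positive on \<open>K\<close>, hence bounded below there by some
  \<open>c > 0\<close>; a smooth step applied to it flattens it to \<open>1\<close> on an open neighbourhood \<open>V\<close> of \<open>K\<close>.  That \<open>f\<close> is
  \<open>1\<close> on an open set, not only on \<open>K\<close>, makes it possible to split supports along open covers.\<close>

lemma smooth_urysohn:
  fixes K U :: "(real^'n::finite) set"
  assumes "compact K" "open U" "K \<subseteq> U"
  obtains f V C where "test_fun f" "\<And>x. 0 \<le> f x" "\<And>x. f x \<le> 1" "open V" "K \<subseteq> V"
    "\<And>x. x \<in> V \<Longrightarrow> f x = 1" "compact C" "C \<subseteq> U" "\<And>x. f x \<noteq> 0 \<Longrightarrow> x \<in> C"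
proof -
  have "\<exists>e. e > 0 \<and> cball x e \<subseteq> U" if "x \<in> K" for x
    using that assms open_contains_cball[of U] by blast
  then obtain e where e: "\<And>x. x \<in> K \<Longrightarrow> e x > 0 \<and> cball x (e x) \<subseteq> U" by metis
  obtain F where F: "F \<subseteq> K" "finite F" "K \<subseteq> (\<Union>x\<in>F. ball x (e x))"
    by (rule compactE_image[OF assms(1), of K "\<lambda>x. ball x (e x)"]) (use e in auto)
  have "\<exists>f. smooth f \<and> (\<forall>y. 0 \<le> f y) \<and> (\<forall>y. f y > 0 \<longleftrightarrow> y \<in> ball x (e x))" if "x \<in> K" for x
    by (metis bump_exists e that)
  then obtain b where b: "\<And>x. x \<in> K \<Longrightarrow> smooth (b x)" "\<And>x y. x \<in> K \<Longrightarrow> 0 \<le> b x y"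
    "\<And>x y. x \<in> K \<Longrightarrow> b x y > 0 \<longleftrightarrow> y \<in> ball x (e x)" by metis
  define g where "g y = (\<Sum>x\<in>F. b x y)" for y
  define C where "C = (\<Union>x\<in>F. cball x (e x))"
  have gs: "smooth g" unfolding g_def[abs_def] using F b by (intro smooth_sum) auto
  have g0: "0 \<le> g y" for y unfolding g_def using F b by (intro sum_nonneg) auto
  have gC: "y \<in> C" if "g y \<noteq> 0" for y
  proof -
    from that obtain x where "x \<in> F" "b x y \<noteq> 0" unfolding g_def by (meson sum.neutral)
    then have "b x y > 0" using b(2)[of x y] F by fastforce
    then show ?thesis using b(3) F \<open>x \<in> F\<close> unfolding C_def by (meson UN_I ball_subset_cball subsetD)
  qed
  have gK: "g y > 0" if "y \<in> K" for y
  proof -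
    from that F obtain x where "x \<in> F" "y \<in> ball x (e x)" by blast
    then show ?thesis unfolding g_def using b F by (intro sum_pos2[of F x]) auto
  qed
  obtain c where c: "c > 0" "\<And>y. y \<in> K \<Longrightarrow> c < g y"
  proof (cases "K = {}")
    case False
    then obtain z where "z \<in> K" "\<And>y. y \<in> K \<Longrightarrow> g z \<le> g y"
      using continuous_attains_inf[OF assms(1) False, of g] smooth_continuous[OF gs] continuous_on_subset
      by (metis UNIV_I subsetI)
    then show ?thesis using gK[of z] by (intro that[of "g z / 2"]) force+
  qed (use that[of 1] in auto)
  obtain h :: "real \<Rightarrow> real" where h: "\<And>k. ck_real k h" "\<And>t. t \<le> 0 \<Longrightarrow> h t = 0"
    "\<And>t. t \<ge> 1 \<Longrightarrow> h t = 1" "\<And>t. 0 \<le> h t" "\<And>t. h t \<le> 1"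
    using smooth_step_exists by metis
  define f where "f y = h ((1 / c) * g y)" for y
  have "smooth f" unfolding f_def[abs_def]
    by (intro smooth_compose_real[OF h(1)] smooth_mult smooth_const gs)
  have fC: "y \<in> C" if "f y \<noteq> 0" for y
  proof -
    have "g y \<noteq> 0" using that h(2) by (auto simp: f_def)
    then show ?thesis by (rule gC)
  qed
  have "compact C" unfolding C_def using F by (intro compact_UN) auto
  show ?thesis
  proof
    show "test_fun f" using \<open>smooth f\<close> \<open>compact C\<close> fC by (rule test_funI)
    show "open {y. c < g y}"
      using smooth_continuous[OF gs] by (intro open_Collect_less) auto
    show "K \<subseteq> {y. c < g y}" using c by auto
    show "x \<in> {y. c < g y} \<Longrightarrow> f x = 1" for x using c h(3) by (simp add: f_def)
    show "C \<subseteq> U" unfolding C_def using e F by blast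
  qed (use h fC \<open>compact C\<close> in \<open>auto simp: f_def\<close>)
qed

lemma smooth_cutoff:
  fixes K U :: "(real^'n::finite) set"
  assumes "compact K" "open U" "K \<subseteq> U"
  obtains f C where "test_fun f" "\<And>x. 0 \<le> f x" "\<And>x. f x \<le> 1" "\<And>x. x \<in> K \<Longrightarrow> f x = 1"
    "compact C" "C \<subseteq> U" "\<And>x. f x \<noteq> 0 \<Longrightarrow> x \<in> C"
proof -
  obtain f V C where f: "test_fun f" "\<And>x. 0 \<le> f x" "\<And>x. f x \<le> 1" "open V" "K \<subseteq> V"
    "\<And>x. x \<in> V \<Longrightarrow> f x = 1" "compact C" "C \<subseteq> U" "\<And>x. f x \<noteq> 0 \<Longrightarrow> x \<in> C"
    using smooth_urysohn[OF assms] by metis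
  have "f x = 1" if "x \<in> K" for x using f(5,6) that by blast
  then show ?thesis by (rule that[OF f(1-3) _ f(7-9)])
qed

section \<open>Representation of positive functionals by measures\<close>

text \<open>The functions that approximate the indicator function of an open set \<open>U\<close> from below.\<close>

definition subordinate :: "(real^'n::finite) set \<Rightarrow> (real^'n \<Rightarrow> real) \<Rightarrow> bool" where
  "subordinate U f \<longleftrightarrow> test_fun f \<and> (\<forall>x. 0 \<le> f x \<and> f x \<le> 1) \<and>
     (\<exists>C. compact C \<and> C \<subseteq> U \<and> (\<forall>x. f x \<noteq> 0 \<longrightarrow> x \<in> C))"

lemma subordinate_mono: "subordinate U f \<Longrightarrow> U \<subseteq> V \<Longrightarrow> subordinate V f"
  unfolding subordinate_def by blast

lemma subordinate_zero: "subordinate U (\<lambda>x. 0)"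
  unfolding subordinate_def by (auto simp: test_fun_zero intro!: exI[of _ "{}"])

locale positive_functional =
  fixes u :: "(real^'n::finite \<Rightarrow> real) \<Rightarrow> real"
  assumes linear: "test_fun f \<Longrightarrow> test_fun g \<Longrightarrow> u (\<lambda>x. c * f x + d * g x) = c * u f + d * u g"
    and nonneg: "test_fun f \<Longrightarrow> (\<And>x. 0 \<le> f x) \<Longrightarrow> 0 \<le> u f"
begin

lemma add: "test_fun f \<Longrightarrow> test_fun g \<Longrightarrow> u (\<lambda>x. f x + g x) = u f + u g"
  using linear[of f g 1 1] by simp

lemma diff: "test_fun f \<Longrightarrow> test_fun g \<Longrightarrow> u (\<lambda>x. f x - g x) = u f - u g"
  using linear[of f g 1 "- 1"] by simp

lemma scale: "test_fun f \<Longrightarrow> u (\<lambda>x. c * f x) = c * u f"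
  using linear[of f f c 0] by simp

lemma zero: "u (\<lambda>x. 0) = 0"
  using scale[OF test_fun_zero, of 0] by simp

lemma mono: "test_fun f \<Longrightarrow> test_fun g \<Longrightarrow> (\<And>x. f x \<le> g x) \<Longrightarrow> u f \<le> u g"
  using nonneg[of "\<lambda>x. g x - f x"] diff[of g f] test_fun_diff[of g f] by simp

lemma sum: "(\<And>i. i \<in> A \<Longrightarrow> test_fun (f i)) \<Longrightarrow> u (\<lambda>x. \<Sum>i\<in>A. f i x) = (\<Sum>i\<in>A. u (f i))"
  by (induction A rule: infinite_finite_induct) (auto simp: zero add test_fun_sum)

text \<open>The measure of an open set is forced: it must be the supremum of the functional over the functions
  below the indicator function.  The outer measure extends this to all sets by outer regularity.\<close>

definition content :: "(real^'n) set \<Rightarrow> ennreal" where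
  "content U = (SUP f\<in>{f. subordinate U f}. ennreal (u f))"

definition outer :: "(real^'n) set \<Rightarrow> ennreal" where
  "outer E = (INF U\<in>{U. open U \<and> E \<subseteq> U}. content U)"

lemma content_upper: "subordinate U f \<Longrightarrow> ennreal (u f) \<le> content U"
  unfolding content_def by (auto intro: SUP_upper)

lemma content_least: "(\<And>f. subordinate U f \<Longrightarrow> ennreal (u f) \<le> c) \<Longrightarrow> content U \<le> c"
  unfolding content_def by (auto intro: SUP_least)

lemma content_mono: "U \<subseteq> V \<Longrightarrow> content U \<le> content V"
  by (intro content_least content_upper) (rule subordinate_mono)

lemma outer_open: "open U \<Longrightarrow> outer U = content U"
  unfolding outer_def by (intro antisym INF_lower INF_greatest) (auto intro: content_mono)

lemma outer_le: "open U \<Longrightarrow> E \<subseteq> U \<Longrightarrow> outer E \<le> content U"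
  unfolding outer_def by (intro INF_lower) auto

lemma outer_mono: "E \<subseteq> F \<Longrightarrow> outer E \<le> outer F"
  unfolding outer_def by (intro INF_superset_mono) auto

lemma content_empty: "content {} = 0"
proof -
  have "content {} \<le> 0"
  proof (rule content_least)
    fix f :: "real^'n \<Rightarrow> real" assume "subordinate {} f"
    then have "f = (\<lambda>x. 0)" unfolding subordinate_def by auto
    then show "ennreal (u f) \<le> 0" by (simp add: zero)
  qed
  then show ?thesis by simp
qed

text \<open>The part of the support of \<open>f\<close> outside \<open>V\<close> is a compact subset of \<open>U\<close>.  A cutoff \<open>g\<close> equal to \<open>1\<close> near it
  splits \<open>f\<close> into \<open>g f\<close>, supported in \<open>U\<close>, and \<open>f - g f\<close>, supported in \<open>V\<close>.\<close>

lemma content_Un: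
  assumes "open U" "open V"
  shows "content (U \<union> V) \<le> content U + content V"
proof (rule content_least)
  fix f assume f: "subordinate (U \<union> V) f"
  then obtain C where C: "compact C" "C \<subseteq> U \<union> V" "\<And>x. f x \<noteq> 0 \<Longrightarrow> x \<in> C"
    and tf: "test_fun f" and f01: "\<And>x. 0 \<le> f x" "\<And>x. f x \<le> 1"
    unfolding subordinate_def by blast
  have "compact (C - V)" "C - V \<subseteq> U" using C assms by (auto intro: compact_diff)
  from smooth_urysohn[OF this(1) assms(1) this(2)]
  obtain g W D where g: "test_fun g" "\<And>x. 0 \<le> g x" "\<And>x. g x \<le> 1" "open W" "C - V \<subseteq> W"
    "\<And>x. x \<in> W \<Longrightarrow> g x = 1" "compact D" "D \<subseteq> U" "\<And>x. g x \<noteq> 0 \<Longrightarrow> x \<in> D" by metis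
  have t1: "test_fun (\<lambda>x. g x * f x)" by (rule test_fun_mult[OF tf test_fun_smooth[OF g(1)]])
  have s1: "subordinate U (\<lambda>x. g x * f x)"
    unfolding subordinate_def using t1 g f01 by (auto intro!: exI[of _ D] mult_le_one)
  have t2: "test_fun (\<lambda>x. f x - g x * f x)" by (rule test_fun_diff[OF tf t1])
  have s2: "subordinate V (\<lambda>x. f x - g x * f x)"
    unfolding subordinate_def
  proof (intro conjI allI exI[of _ "C - W"] impI)
    fix x
    show "0 \<le> f x - g x * f x" using g(3)[of x] f01(1)[of x] by (simp add: mult_left_le_one_le g(2))
    show "f x - g x * f x \<le> 1" using f01[of x] g(2)[of x] by (smt (verit) mult_nonneg_nonneg)
    show "f x - g x * f x \<noteq> 0 \<Longrightarrow> x \<in> C - W" using g(6) C(3) by fastforce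
  qed (use t2 C g in \<open>auto intro: compact_diff\<close>)
  have "u f = u (\<lambda>x. g x * f x) + u (\<lambda>x. f x - g x * f x)"
    using add[OF t1 t2] by simp
  moreover have "0 \<le> u (\<lambda>x. g x * f x)" "0 \<le> u (\<lambda>x. f x - g x * f x)"
    using s1 s2 t1 t2 unfolding subordinate_def by (auto intro: nonneg)
  ultimately have "ennreal (u f) = ennreal (u (\<lambda>x. g x * f x)) + ennreal (u (\<lambda>x. f x - g x * f x))"
    by (simp add: ennreal_plus)
  also have "\<dots> \<le> content U + content V" by (intro add_mono content_upper s1 s2)
  finally show "ennreal (u f) \<le> content U + content V" .
qed

lemma content_UN_finite:
  assumes "\<And>i::nat. open (U i)"
  shows "content (\<Union>i<n. U i) \<le> (\<Sum>i<n. content (U i))"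
proof (induction n)
  case (Suc n)
  have "content (\<Union>i<Suc n. U i) = content ((\<Union>i<n. U i) \<union> U n)"
    by (simp add: lessThan_Suc Un_commute)
  also have "\<dots> \<le> content (\<Union>i<n. U i) + content (U n)"
    using assms by (intro content_Un) auto
  also have "\<dots> \<le> (\<Sum>i<Suc n. content (U i))"
    using Suc by (simp add: add_right_mono)
  finally show ?case .
qed (simp add: content_empty)

text \<open>Supports are compact, so finite subadditivity is enough.\<close>

lemma content_UN:
  assumes "\<And>i::nat. open (U i)"
  shows "content (\<Union>i. U i) \<le> (\<Sum>i. content (U i))"
proof (rule content_least)
  fix f assume f: "subordinate (\<Union>i. U i) f"
  then obtain C where C: "compact C" "C \<subseteq> (\<Union>i. U i)" "\<And>x. f x \<noteq> 0 \<Longrightarrow> x \<in> C"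
    unfolding subordinate_def by blast
  obtain F where F: "finite F" "C \<subseteq> (\<Union>i\<in>F. U i)"
    by (rule compactE_image[OF C(1), of UNIV U]) (use assms C(2) in auto)
  then obtain n where "\<forall>i\<in>F. i < n" by (meson finite_nat_set_iff_bounded)
  with F have "C \<subseteq> (\<Union>i<n. U i)" by blast
  with f C have "subordinate (\<Union>i<n. U i) f" unfolding subordinate_def by blast
  then have "ennreal (u f) \<le> content (\<Union>i<n. U i)" by (rule content_upper)
  also have "\<dots> \<le> (\<Sum>i<n. content (U i))" by (rule content_UN_finite[OF assms])
  also have "\<dots> \<le> (\<Sum>i. content (U i))" by (intro sum_le_suminf) auto
  finally show "ennreal (u f) \<le> (\<Sum>i. content (U i))" .
qed

lemma outer_countably_subadditive: "outer (\<Union>i::nat. E i) \<le> (\<Sum>i. outer (E i))"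
proof (rule ennreal_le_epsilon)
  fix e :: real assume e: "(\<Sum>i. outer (E i)) < top" "0 < e"
  have "\<exists>U. open U \<and> E i \<subseteq> U \<and> content U \<le> outer (E i) + ennreal (e * (1/2)^Suc i)" for i
  proof -
    have "outer (E i) \<le> (\<Sum>i. outer (E i))"
      using sum_le_suminf[of "\<lambda>i. outer (E i)" "{i}"] by simp
    with e have "outer (E i) \<noteq> \<infinity>" by auto
    from INF_approx_ennreal[OF _ outer_def this, of "e * (1/2)^Suc i"] e
    show ?thesis by (auto intro: less_imp_le)
  qed
  then obtain U where U: "\<And>i. open (U i)" "\<And>i. E i \<subseteq> U i"
    "\<And>i. content (U i) \<le> outer (E i) + ennreal (e * (1/2)^Suc i)" by metis
  have "outer (\<Union>i. E i) \<le> content (\<Union>i. U i)" using U by (intro outer_le) auto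
  also have "\<dots> \<le> (\<Sum>i. content (U i))" using U by (intro content_UN)
  also have "\<dots> \<le> (\<Sum>i. outer (E i) + ennreal (e * (1/2)^Suc i))"
    using U by (intro suminf_le) auto
  also have "\<dots> = (\<Sum>i. outer (E i)) + (\<Sum>i. ennreal (e * (1/2)^Suc i))"
    by (intro suminf_add[symmetric]) auto
  also have "(\<Sum>i. ennreal (e * (1/2)^Suc i)) = ennreal e"
  proof -
    have "(\<lambda>i. e * (1/2)^Suc i) sums (e * 1)" by (intro sums_mult power_half_series)
    then show ?thesis using e by (intro suminf_ennreal_eq) auto
  qed
  finally show "outer (\<Union>i. E i) \<le> (\<Sum>i. outer (E i)) + ennreal e" .
qed

lemma outer_Un: "outer (E \<union> F) \<le> outer E + outer F"
proof -
  let ?A = "\<lambda>i::nat. if i = 0 then E else if i = 1 then F else {}"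
  have "outer {} = 0" using outer_open[of "{}"] content_empty by simp
  have "(\<Union>i. ?A i) = E \<union> F" by (auto split: if_splits)
  moreover have "(\<Sum>i. outer (?A i)) = (\<Sum>i\<in>{0, 1}. outer (?A i))"
    using \<open>outer {} = 0\<close> by (intro suminf_finite) auto
  ultimately show ?thesis using outer_countably_subadditive[of ?A] by simp
qed

text \<open>Caratheodory's criterion.  For an open \<open>V\<close> containing \<open>E\<close>: if \<open>f\<close> is supported in a compact
  \<open>C \<subseteq> U \<inter> V\<close> and \<open>g\<close> in \<open>V - C\<close>, then \<open>f + g\<close> is still bounded by \<open>1\<close>, and \<open>V - C\<close> covers what \<open>U\<close>
  leaves of \<open>E\<close>.\<close>

lemma open_measurable:
  assumes "open U"
  shows "outer (U \<inter> E) + outer (E - U) = outer E"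
proof (rule antisym)
  have "outer ((U \<inter> E) \<union> (E - U)) \<le> outer (U \<inter> E) + outer (E - U)" by (rule outer_Un)
  moreover have "(U \<inter> E) \<union> (E - U) = E" by blast
  ultimately show "outer E \<le> outer (U \<inter> E) + outer (E - U)" by simp
  have split_open: "content (U \<inter> V) + outer (V - U) \<le> content V" if "open V" for V
  proof -
    have "ennreal (u f) + outer (V - U) \<le> content V" if f: "subordinate (U \<inter> V) f" for f
    proof -
      obtain C where C: "compact C" "C \<subseteq> U \<inter> V" "\<And>x. f x \<noteq> 0 \<Longrightarrow> x \<in> C" and tf: "test_fun f"
        and f01: "\<And>x. 0 \<le> f x" "\<And>x. f x \<le> 1"
        using f unfolding subordinate_def by blast
      have "open (V - C)" using \<open>open V\<close> C by (simp add: open_Diff compact_imp_closed)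
      then have "outer (V - U) \<le> content (V - C)" using C by (intro outer_le) auto
      then have "ennreal (u f) + outer (V - U) \<le> ennreal (u f) + content (V - C)"
        by (rule add_left_mono)
      also have "\<dots> = (SUP g\<in>{g. subordinate (V - C) g}. ennreal (u f) + ennreal (u g))"
        unfolding content_def using subordinate_zero by (intro ennreal_SUP_add_right) auto
      also have "\<dots> \<le> content V"
      proof (intro SUP_least)
        fix g assume "g \<in> {g. subordinate (V - C) g}"
        then obtain D where D: "compact D" "D \<subseteq> V - C" "\<And>x. g x \<noteq> 0 \<Longrightarrow> x \<in> D" and tg: "test_fun g"
          and g01: "\<And>x. 0 \<le> g x" "\<And>x. g x \<le> 1"
          unfolding subordinate_def by blast
        have "g x = 0" if "f x \<noteq> 0" for x using C(3)[OF that] D(2,3) by blast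
        then have "f x + g x \<le> 1" for x
          using f01(2)[of x] g01(2)[of x] by (cases "f x = 0") auto
        moreover have "x \<in> C \<union> D" if "f x + g x \<noteq> 0" for x
          using that C(3)[of x] D(3)[of x] by (cases "g x = 0") auto
        ultimately have "subordinate V (\<lambda>x. f x + g x)"
          unfolding subordinate_def using C(1,2) D(1,2) f01(1) g01(1) test_fun_add[OF tf tg]
          by (intro conjI allI impI exI[of _ "C \<union> D"]) (auto simp: compact_Un)
        then have "ennreal (u (\<lambda>x. f x + g x)) \<le> content V" by (rule content_upper)
        then show "ennreal (u f) + ennreal (u g) \<le> content V"
          using add[OF tf tg] nonneg[OF tf f01(1)] nonneg[OF tg g01(1)] by (simp add: ennreal_plus)
      qed
      finally show ?thesis .
    qed
    then have "(SUP f\<in>{f. subordinate (U \<inter> V) f}. ennreal (u f) + outer (V - U)) \<le> content V"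
      by (intro SUP_least) auto
    moreover have "(SUP f\<in>{f. subordinate (U \<inter> V) f}. ennreal (u f) + outer (V - U))
        = content (U \<inter> V) + outer (V - U)"
      unfolding content_def using subordinate_zero by (intro ennreal_SUP_add_left) auto
    ultimately show ?thesis by simp
  qed
  have "outer (U \<inter> E) + outer (E - U) \<le> content V" if "open V" "E \<subseteq> V" for V
  proof -
    have "outer (U \<inter> E) \<le> content (U \<inter> V)" using that assms by (intro outer_le) auto
    moreover have "outer (E - U) \<le> outer (V - U)" using that by (intro outer_mono) auto
    ultimately have "outer (U \<inter> E) + outer (E - U) \<le> content (U \<inter> V) + outer (V - U)"
      by (rule add_mono)
    with split_open[OF that(1)] show ?thesis by simp
  qed
  then show "outer (U \<inter> E) + outer (E - U) \<le> outer E"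
    unfolding outer_def[of E] by (intro INF_greatest) auto
qed

definition representing_measure :: "(real^'n) measure" where
  "representing_measure = measure_of UNIV (sets borel) outer"

lemma sets_representing_measure: "sets representing_measure = sets borel"
  unfolding representing_measure_def by (metis sets.sets_measure_of_eq space_borel)

lemma emeasure_representing_measure:
  assumes "A \<in> sets borel"
  shows "emeasure representing_measure A = outer A"
proof -
  interpret sigma_algebra UNIV "Pow UNIV :: (real^'n) set set" by (rule sigma_algebra_Pow)
  let ?L = "lambda_system UNIV (Pow UNIV) outer"
  have e: "outer {} = 0" using outer_open[of "{}"] content_empty by simp
  have "outer_measure_space (Pow UNIV) outer"
    unfolding outer_measure_space_def positive_def increasing_def countably_subadditive_def
    using e outer_countably_subadditive by (auto intro: outer_mono)
  then have ms: "measure_space UNIV ?L outer" by (rule caratheodory_lemma)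
  then have sa: "sigma_algebra UNIV ?L" and ca: "countably_additive ?L outer"
    by (auto simp: measure_space_def)
  have "{S. open S} \<subseteq> ?L"
    unfolding lambda_system_def using open_measurable by (auto simp: Diff_eq Int_commute)
  then have sub: "sets borel \<subseteq> ?L"
    unfolding sets_borel by (rule sigma_algebra.sigma_sets_subset[OF sa])
  have "countably_additive (sets representing_measure) outer"
    unfolding countably_additive_def sets_representing_measure
  proof (intro allI impI)
    fix A :: "nat \<Rightarrow> (real^'n) set"
    assume A: "range A \<subseteq> sets borel" "disjoint_family A" "(\<Union>i. A i) \<in> sets borel"
    with sub have "range A \<subseteq> ?L" "(\<Union>i. A i) \<in> ?L" by blast+
    with ca A(2) show "(\<Sum>i. outer (A i)) = outer (\<Union>i. A i)"
      unfolding countably_additive_def by blast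
  qed
  moreover have "positive (sets representing_measure) outer" using e by (simp add: positive_def)
  ultimately show ?thesis
    using assms
    by (intro emeasure_measure_of[OF representing_measure_def]) (auto simp: sets_representing_measure)
qed

lemma emeasure_representing_open: "open U \<Longrightarrow> emeasure representing_measure U = content U"
  by (simp add: emeasure_representing_measure outer_open)

lemma compact_in_open_of_finite_content:
  assumes "compact K"
  obtains U where "open U" "K \<subseteq> U" "content U < \<infinity>"
proof -
  obtain g V D where g: "test_fun g" "\<And>x. 0 \<le> g x" "\<And>x. g x \<le> 1" "open V" "K \<subseteq> V"
    "\<And>x. x \<in> V \<Longrightarrow> g x = 1" "compact D" "D \<subseteq> UNIV" "\<And>x. g x \<noteq> 0 \<Longrightarrow> x \<in> D"
    using smooth_urysohn[OF assms open_UNIV subset_UNIV] by metis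
  have "content V \<le> ennreal (u g)"
  proof (rule content_least)
    fix f assume f: "subordinate V f"
    then have "f x \<le> g x" for x
      unfolding subordinate_def by (cases "f x = 0") (use g in force)+
    then have "u f \<le> u g" using f g(1) unfolding subordinate_def by (intro mono) auto
    then show "ennreal (u f) \<le> ennreal (u g)" by (rule ennreal_leI)
  qed
  then have "content V < \<infinity>" using le_less_trans[OF _ ennreal_less_top] by simp
  with g show ?thesis using that by blast
qed

lemma finite_on_compact: "compact K \<Longrightarrow> emeasure representing_measure K < \<infinity>"
proof -
  assume "compact K"
  then obtain U where U: "open U" "K \<subseteq> U" "content U < \<infinity>"
    by (rule compact_in_open_of_finite_content)
  then have "emeasure representing_measure K \<le> emeasure representing_measure U"
    by (intro emeasure_mono) (auto simp: sets_representing_measure)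
  with U emeasure_representing_open show ?thesis by (simp add: order_le_less_trans)
qed

end

lemma test_fun_bounded:
  assumes "test_fun f"
  obtains B where "B > 0" "\<And>x. \<bar>f x\<bar> \<le> B"
proof -
  let ?C = "closure {x. f x \<noteq> 0}"
  have "compact (f ` ?C)"
    using assms smooth_continuous continuous_on_subset unfolding test_fun_def
    by (intro compact_continuous_image) blast+
  from compact_imp_bounded[OF this]
  obtain B where B: "B > 0" "\<And>y. y \<in> f ` ?C \<Longrightarrow> norm y \<le> B"
    unfolding bounded_pos by blast
  have "\<bar>f x\<bar> \<le> B" for x
    using B closure_subset[of "{x. f x \<noteq> 0}"] by (cases "f x = 0") fastforce+
  with B(1) show ?thesis using that by blast
qed

lemma test_fun_integrable:
  fixes \<mu> :: "(real^'n::finite) measure"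
  assumes s: "sets \<mu> = sets borel" and fin: "\<And>K. compact K \<Longrightarrow> emeasure \<mu> K < \<infinity>"
    and f: "test_fun f"
  shows "integrable \<mu> f"
proof -
  let ?C = "closure {x. f x \<noteq> 0}"
  obtain B where B: "B > 0" "\<And>x. \<bar>f x\<bar> \<le> B" using test_fun_bounded[OF f] by metis
  have C: "compact ?C" using f by (simp add: test_fun_def)
  have "integrable \<mu> (\<lambda>x. indicator ?C x *\<^sub>R B)"
    using fin[OF C] by (intro integrable_indicator integrable_scaleR_left) (auto simp: s)
  moreover have "f \<in> borel_measurable \<mu>"
    using smooth_continuous[OF test_fun_smooth[OF f]] borel_measurable_continuous_onI
      measurable_cong_sets[OF s refl] by blast
  moreover have "norm (f x) \<le> norm (indicator ?C x *\<^sub>R B)" for x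
    using B closure_subset[of "{x. f x \<noteq> 0}"] by (cases "f x = 0") (auto simp: indicator_def)
  ultimately show ?thesis by (rule Bochner_Integration.integrable_bound[OF _ _ AE_I2])
qed

text \<open>The sum of the shifted steps recovers \<open>y\<close> up to a bounded error, since the steps with
  \<open>j + 2 \<le> y\<close> are already complete.\<close>

lemma smooth_step_sum_lower:
  fixes h :: "real \<Rightarrow> real"
  assumes h: "\<And>t. t \<ge> 1 \<Longrightarrow> h t = 1" "\<And>t. 0 \<le> h t" and y: "0 \<le> y" "y \<le> real N"
  shows "y - 2 \<le> (\<Sum>j<N. h (y - real j - 1))"
proof -
  define k where "k = nat \<lfloor>y\<rfloor> - 1"
  have yk: "y - 2 \<le> real k" using y unfolding k_def by linarith
  have "k \<le> N" using y unfolding k_def by linarith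
  have "(\<Sum>j<k. h (y - real j - 1)) = (\<Sum>j<k. 1)"
  proof (rule sum.cong[OF refl])
    fix j assume "j \<in> {..<k}"
    then have "real j + 2 \<le> y" using y unfolding k_def by simp linarith
    then show "h (y - real j - 1) = 1" by (intro h) simp
  qed
  moreover have "(\<Sum>j<k. h (y - real j - 1)) \<le> (\<Sum>j<N. h (y - real j - 1))"
    using \<open>k \<le> N\<close> h(2) by (intro sum_mono2) auto
  ultimately show ?thesis using yk by simp
qed

lemma layer_count_upper:
  assumes "0 \<le> y"
  shows "(\<Sum>j<N. if real j < y then 1 else 0) \<le> y + (1::real)"
proof -
  have "(\<Sum>j<N. if real j < y then 1 else 0) = real (card {j. j < N \<and> real j < y})"
    by (simp add: sum.If_cases Int_def)
  also have "card {j. j < N \<and> real j < y} \<le> card {..<nat \<lceil>y\<rceil>}"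
    by (intro card_mono) (auto simp: zless_nat_eq_int_zless less_ceiling_iff)
  also have "real (card {..<nat \<lceil>y\<rceil>}) \<le> y + 1" using assms by simp
  finally show ?thesis by simp
qed

context positive_functional
begin

lemma integrable: "test_fun f \<Longrightarrow> integrable representing_measure f"
  by (rule test_fun_integrable[OF sets_representing_measure]) (rule finite_on_compact)

text \<open>The layer cake argument with smooth layers: \<open>N f\<close> is, up to an error bounded independently of \<open>N\<close>, the
  sum of smoothed indicator functions \<open>l j\<close> of the superlevel sets \<open>{f > j/N}\<close>, and \<open>u (l j)\<close> is at most the
  measure of the superlevel set.  Dividing by \<open>N\<close> removes the error.\<close>

lemma functional_le_integral:
  assumes f: "test_fun f" "\<And>x. 0 \<le> f x" "\<And>x. f x \<le> 1"
  shows "u f \<le> (LINT x|representing_measure. f x)"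
proof -
  let ?M = representing_measure
  let ?C = "closure {x. f x \<noteq> 0}"
  have C: "compact ?C" using f by (simp add: test_fun_def)
  have fC: "x \<in> ?C" if "f x \<noteq> 0" for x using that closure_subset[of "{x. f x \<noteq> 0}"] by blast
  have Cfin: "emeasure ?M ?C < \<infinity>" by (rule finite_on_compact[OF C])
  obtain g D where g: "test_fun g" "\<And>x. 0 \<le> g x" "\<And>x. g x \<le> 1" "\<And>x. x \<in> ?C \<Longrightarrow> g x = 1"
      "compact D" "D \<subseteq> UNIV" "\<And>x. g x \<noteq> 0 \<Longrightarrow> x \<in> D"
    using smooth_cutoff[OF C open_UNIV subset_UNIV] by metis
  obtain h :: "real \<Rightarrow> real" where h: "\<And>k. ck_real k h" "\<And>t. t \<le> 0 \<Longrightarrow> h t = 0"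
    "\<And>t. t \<ge> 1 \<Longrightarrow> h t = 1" "\<And>t. 0 \<le> h t" "\<And>t. h t \<le> 1"
    using smooth_step_exists by metis
  have int_f: "integrable ?M f"
    by (rule integrable[OF f(1)])
  have cont: "continuous_on UNIV f" by (rule smooth_continuous[OF test_fun_smooth[OF f(1)]])
  have main: "real N * u f \<le> real N * (LINT x|?M. f x) + (measure ?M ?C + 2 * u g)" for N
  proof -
    define U where "U j = {x. real j < real N * f x}" for j
    \<comment> \<open>The shift by one makes the support of \<open>l j\<close> a compact subset of \<open>U j\<close>.\<close>
    define l where "l j x = h (real N * f x - real j - 1)" for j x
    have U: "open (U j)" for j unfolding U_def
      by (intro open_Collect_less continuous_intros cont)
    have U_C: "U j \<subseteq> ?C" for j unfolding U_def using fC by force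
    have Ufin: "emeasure ?M (U j) < \<infinity>" for j
    proof -
      have "emeasure ?M (U j) \<le> emeasure ?M ?C"
        using U_C by (intro emeasure_mono) (auto simp: sets_representing_measure)
      with Cfin show ?thesis by simp
    qed
    have Uint: "integrable ?M (indicator (U j) :: _ \<Rightarrow> real)" for j
      using U Ufin by (intro integrable_real_indicator) (auto simp: sets_representing_measure)
    have lsub: "subordinate (U j) (l j)" for j
      unfolding subordinate_def
    proof (intro conjI allI impI exI[of _ "?C \<inter> {x. real j + 1 \<le> real N * f x}"])
      have lC: "x \<in> ?C \<inter> {x. real j + 1 \<le> real N * f x}" if "l j x \<noteq> 0" for x
      proof -
        have "real N * f x - real j - 1 > 0" 
          by (rule ccontr) (use that h(2) in \<open>simp add: l_def\<close>)
        moreover from this have "f x \<noteq> 0" by auto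
        ultimately show ?thesis using fC by auto
      qed
      then show "x \<in> ?C \<inter> {x. real j + 1 \<le> real N * f x}" if "l j x \<noteq> 0" for x using that by blast
      show K: "compact (?C \<inter> {x. real j + 1 \<le> real N * f x})"
        by (intro compact_Int_closed C closed_Collect_le continuous_intros cont)
      have "smooth (l j)"
        unfolding l_def[abs_def]
        by (intro smooth_compose_real[OF h(1)] smooth_diff smooth_mult smooth_const test_fun_smooth f)
      then show "test_fun (l j)" using K lC by (rule test_funI)
    qed (auto simp: l_def h U_def)
    have lt: "test_fun (l j)" for j using lsub unfolding subordinate_def by blast
    have ul: "u (l j) \<le> measure ?M (U j)" for j
    proof -
      have "ennreal (u (l j)) \<le> emeasure ?M (U j)"
        using content_upper[OF lsub] by (simp add: emeasure_representing_open U)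
      also have "\<dots> = ennreal (measure ?M (U j))"
        using Ufin by (simp add: emeasure_eq_ennreal_measure less_top[symmetric])
      finally show ?thesis by simp
    qed
    have "u (\<lambda>x. real N * f x) \<le> u (\<lambda>x. (\<Sum>j<N. l j x) + 2 * g x)"
    proof (rule mono)
      fix x
      have "real N * f x \<le> real N" using f(3)[of x] by (simp add: mult_left_le)
      then have "real N * f x - 2 \<le> (\<Sum>j<N. l j x)"
        unfolding l_def using f(2) by (intro smooth_step_sum_lower h) auto
      moreover have "0 \<le> (\<Sum>j<N. l j x)" by (simp add: l_def sum_nonneg h)
      ultimately show "real N * f x \<le> (\<Sum>j<N. l j x) + 2 * g x"
        using g fC[of x] by (cases "f x = 0") auto
    qed (intro test_fun_mult test_fun_add test_fun_sum smooth_const f g lt)+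
    then have "real N * u f \<le> (\<Sum>j<N. u (l j)) + 2 * u g"
      using lt g f by (simp add: add scale sum test_fun_sum test_fun_mult)
    also have "(\<Sum>j<N. u (l j)) \<le> (\<Sum>j<N. measure ?M (U j))" by (intro sum_mono ul)
    also have "\<dots> = (LINT x|?M. (\<Sum>j<N. indicator (U j) x))"
      using Ufin U by (subst Bochner_Integration.integral_sum)
        (auto simp: sets_representing_measure intro!: integrable_real_indicator)
    also have "\<dots> \<le> (LINT x|?M. real N * f x + indicator ?C x)"
    proof (rule integral_mono)
      show "integrable ?M (\<lambda>x. \<Sum>j<N. indicator (U j) x :: real)"
        using Uint by (intro Bochner_Integration.integrable_sum)
      show "integrable ?M (\<lambda>x. real N * f x + indicator ?C x)"
        using Cfin int_f by (auto simp: sets_representing_measure intro!: integrable_real_indicator)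
      fix x
      show "(\<Sum>j<N. indicator (U j) x) \<le> real N * f x + indicator ?C x"
      proof (cases "x \<in> ?C")
        case True
        then show ?thesis using layer_count_upper[of "real N * f x" N] f(2)
          by (simp add: U_def indicator_def of_bool_def)
      next
        case False
        then have "x \<notin> U j" for j using U_C by blast
        with False f(2) show ?thesis by simp
      qed
    qed
    also have "\<dots> = real N * (LINT x|?M. f x) + measure ?M ?C"
      using Cfin int_f by (subst Bochner_Integration.integral_add)
        (auto simp: sets_representing_measure intro!: integrable_real_indicator)
    finally show ?thesis by simp
  qed
  show ?thesis
  proof (rule ccontr)
    assume "\<not> ?thesis"
    then have "0 < u f - (LINT x|?M. f x)" by simp
    from ex_less_of_nat_mult[OF this] obtain N
      where "measure ?M ?C + 2 * u g < real N * (u f - (LINT x|?M. f x))" by blast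
    with main[of N] show False by (simp add: algebra_simps)
  qed
qed

text \<open>The opposite inequality follows from the first one applied to \<open>w - f\<close>, where \<open>w\<close> dominates \<open>f\<close> and nearly
  realises the supremum in the definition of \<open>content U\<close> for a neighbourhood \<open>U\<close> of the support of \<open>f\<close>.\<close>

lemma integral_le_functional:
  assumes f: "test_fun f" "\<And>x. 0 \<le> f x" "\<And>x. f x \<le> 1"
  shows "(LINT x|representing_measure. f x) \<le> u f"
proof (rule field_le_epsilon)
  fix e :: real assume "e > 0"
  let ?M = representing_measure
  let ?C = "closure {x. f x \<noteq> 0}"
  have C: "compact ?C" using f by (simp add: test_fun_def)
  have fC: "x \<in> ?C" if "f x \<noteq> 0" for x using that closure_subset[of "{x. f x \<noteq> 0}"] by blast
  obtain U where U: "open U" "?C \<subseteq> U" "content U < \<infinity>"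
    by (rule compact_in_open_of_finite_content[OF C])
  have "\<exists>g\<in>{g. subordinate U g}. content U < ennreal (u g) + ennreal e"
    using U(3) subordinate_zero[of U] by (intro SUP_approx_ennreal[OF \<open>e > 0\<close> _ content_def]) auto
  then obtain g where g: "subordinate U g" "content U < ennreal (u g) + ennreal e" by blast
  obtain k D where k: "test_fun k" "\<And>x. 0 \<le> k x" "\<And>x. k x \<le> 1" "\<And>x. x \<in> ?C \<Longrightarrow> k x = 1"
     "compact D" "D \<subseteq> U" "\<And>x. k x \<noteq> 0 \<Longrightarrow> x \<in> D"
    using smooth_cutoff[OF C U(1,2)] by metis
  obtain D' where g': "test_fun g" "\<And>x. 0 \<le> g x" "\<And>x. g x \<le> 1"
    "compact D'" "D' \<subseteq> U" "\<And>x. g x \<noteq> 0 \<Longrightarrow> x \<in> D'" using g(1) unfolding subordinate_def by blast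
  \<comment> \<open>A smooth substitute for the maximum of \<open>g\<close> and \<open>k\<close>: it is the form \<open>1 - (1 - g) (1 - k)\<close>.\<close>
  define w where "w x = g x + k x - g x * k x" for x
  have w_eq: "1 - w x = (1 - g x) * (1 - k x)" for x by (simp add: w_def algebra_simps)
  have w1: "w x \<le> 1" for x
    using w_eq[of x] g'(3)[of x] k(3)[of x] mult_nonneg_nonneg[of "1 - g x" "1 - k x"] by linarith
  have gw: "g x \<le> w x" for x
    using mult_right_mono[OF g'(3)[of x] k(2)[of x]] by (simp add: w_def)
  have wt: "test_fun w" unfolding w_def[abs_def]
    using g' k by (intro test_fun_diff test_fun_add test_fun_mult test_fun_smooth)
  have wC: "w x = 1" if "x \<in> ?C" for x using k(4)[OF that] by (simp add: w_def)
  have w0: "0 \<le> w x" for x using gw[of x] g'(2)[of x] by linarith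
  have fw: "f x \<le> w x" for x using wC fC[of x] f(3) w0 by (cases "f x = 0") auto
  have wD: "x \<in> D \<union> D'" if "w x \<noteq> 0" for x
    using that k(7)[of x] g'(6)[of x] by (cases "g x = 0") (auto simp: w_def)
  have ws: "subordinate U w"
    unfolding subordinate_def using wt w0 w1 wD k(5,6) g'(4,5)
    by (intro conjI allI impI exI[of _ "D \<union> D'"]) (auto simp: compact_Un)
  have Mfin: "emeasure ?M U < \<infinity>" using U by (simp add: emeasure_representing_open)
  have "u w - u f = u (\<lambda>x. w x - f x)" using diff[OF wt f(1)] by simp
  also have "\<dots> \<le> (LINT x|?M. w x - f x)"
  proof (rule functional_le_integral[OF test_fun_diff[OF wt f(1)]])
    show "0 \<le> w x - f x" "w x - f x \<le> 1" for x
      using fw[of x] f(2)[of x] w1[of x] by simp_all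
  qed
  also have "\<dots> = (LINT x|?M. w x) - (LINT x|?M. f x)"
    by (intro Bochner_Integration.integral_diff integrable wt f)
  also have "(LINT x|?M. w x) \<le> (LINT x|?M. indicator U x)"
  proof (rule integral_mono)
    show "integrable ?M (indicator U :: _ \<Rightarrow> real)"
      using U Mfin by (auto simp: sets_representing_measure intro!: integrable_real_indicator)
    show "w x \<le> indicator U x" for x
      using w1[of x] wD[of x] k(6) g'(5) by (cases "w x = 0") (auto simp: indicator_def)
  qed (rule integrable[OF wt])
  also have "(LINT x|?M. indicator U x) = measure ?M U"
    using U Mfin by (simp add: sets_representing_measure)
  also have "measure ?M U < u g + e"
  proof -
    have "ennreal (measure ?M U) = content U"
      using Mfin U by (simp add: emeasure_eq_ennreal_measure[symmetric] less_top[symmetric] emeasure_representing_open)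
    also have "\<dots> < ennreal (u g + e)"
      using g(2) nonneg[OF g'(1,2)] \<open>e > 0\<close> by (simp add: ennreal_plus)
    finally show ?thesis by (simp add: ennreal_less_iff)
  qed
  also have "u g \<le> u w" by (rule mono[OF g'(1) wt gw])
  finally show "(LINT x|?M. f x) \<le> u f + e" by simp
qed

text \<open>A general test function is a linear combination of two test functions with values in \<open>[0, 1]\<close>.\<close>

lemma representing_measure_integral:
  assumes f: "test_fun f"
  shows "(LINT x|representing_measure. f x) = u f"
proof -
  let ?M = representing_measure
  let ?C = "closure {x. f x \<noteq> 0}"
  have C: "compact ?C" using f by (simp add: test_fun_def)
  have fC: "x \<in> ?C" if "f x \<noteq> 0" for x using that closure_subset[of "{x. f x \<noteq> 0}"] by blast
  obtain g D where g: "test_fun g" "\<And>x. 0 \<le> g x" "\<And>x. g x \<le> 1" "\<And>x. x \<in> ?C \<Longrightarrow> g x = 1"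
      "compact D" "D \<subseteq> UNIV" "\<And>x. g x \<noteq> 0 \<Longrightarrow> x \<in> D"
    using smooth_cutoff[OF C open_UNIV subset_UNIV] by metis
  obtain B where B: "B > 0" "\<And>x. \<bar>f x\<bar> \<le> B" using test_fun_bounded[OF f] by metis
  define k where "k x = (1 / (2 * B)) * f x + (1 / 2) * g x" for x
  have kt: "test_fun k" unfolding k_def[abs_def] by (rule test_fun_lincomb[OF f g(1)])
  have k01: "0 \<le> k x \<and> k x \<le> 1" for x
  proof (cases "f x = 0")
    case True
    then show ?thesis using g(2,3)[of x] by (simp add: k_def)
  next
    case False
    then have "g x = 1" using fC g(4) by blast
    then show ?thesis using B(1) B(2)[of x] by (auto simp: k_def field_simps abs_le_iff)
  qed
  have eq: "(LINT x|?M. e x) = u e" if "test_fun e" "\<And>x. 0 \<le> e x \<and> e x \<le> 1" for e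
    using functional_le_integral[of e] integral_le_functional[of e] that by (intro antisym) auto
  have "u f = u (\<lambda>x. (2 * B) * k x + (- B) * g x)" using B(1) by (simp add: k_def algebra_simps)
  also have "\<dots> = (2 * B) * u k + (- B) * u g" by (rule linear[OF kt g(1)])
  also have "\<dots> = (2 * B) * (LINT x|?M. k x) + (- B) * (LINT x|?M. g x)"
    using eq[OF kt] eq[OF g(1)] k01 g by simp
  also have "\<dots> = (LINT x|?M. (2 * B) * k x + (- B) * g x)"
    using integrable[OF kt] integrable[OF g(1)] by simp
  also have "\<dots> = (LINT x|?M. f x)" using B(1) by (simp add: k_def algebra_simps)
  finally show ?thesis by simp
qed

text \<open>Open sets are increasing unions of compact sets, so a Radon measure of an open set is determined by
  its integrals of subordinate functions.  This is the core of uniqueness.\<close>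

lemma radon_measure_open:
  fixes \<mu> :: "(real^'n) measure"
  assumes s: "sets \<mu> = sets borel" and fin: "\<And>K. compact K \<Longrightarrow> emeasure \<mu> K < \<infinity>"
    and int: "\<And>f. test_fun f \<Longrightarrow> (LINT x|\<mu>. f x) = u f" and U: "open U"
  shows "emeasure \<mu> U = content U"
proof (rule antisym)
  have nn: "ennreal (u f) = (\<integral>\<^sup>+ x. ennreal (f x) \<partial>\<mu>)" if "test_fun f" "\<And>x. 0 \<le> f x" for f
    using nn_integral_eq_integral[OF test_fun_integrable[OF s fin that(1)]] that int by simp
  obtain C where C: "\<And>n. compact (C n)" "\<And>n. C n \<subseteq> U" "\<And>n. C n \<subseteq> interior (C (Suc n))"
    "\<Union> (range C) = U" using open_Union_compact_subsets[OF U] by metis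
  have inc: "incseq C" using C(3) interior_subset by (intro incseq_SucI) blast
  have "range C \<subseteq> sets \<mu>" using C(1) by (auto simp: s compact_imp_closed)
  then have "emeasure \<mu> U = (SUP n. emeasure \<mu> (C n))"
    using SUP_emeasure_incseq[OF _ inc, of \<mu>] C(4) by simp
  also have "\<dots> \<le> content U"
  proof (rule SUP_least)
    fix n
    obtain g D where g: "test_fun g" "\<And>x. 0 \<le> g x" "\<And>x. g x \<le> 1" "\<And>x. x \<in> C n \<Longrightarrow> g x = 1"
       "compact D" "D \<subseteq> U" "\<And>x. g x \<noteq> 0 \<Longrightarrow> x \<in> D"
      using smooth_cutoff[OF C(1)[of n] U C(2)] by metis
    have "emeasure \<mu> (C n) = (\<integral>\<^sup>+ x. indicator (C n) x \<partial>\<mu>)"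
      using C(1) by (simp add: s compact_imp_closed)
    also have "\<dots> \<le> (\<integral>\<^sup>+ x. ennreal (g x) \<partial>\<mu>)"
      using g by (intro nn_integral_mono) (auto simp: indicator_def)
    also have "\<dots> = ennreal (u g)" using nn g by simp
    also have "\<dots> \<le> content U" using g by (intro content_upper) (auto simp: subordinate_def)
    finally show "emeasure \<mu> (C n) \<le> content U" .
  qed
  finally show "emeasure \<mu> U \<le> content U" .
  show "content U \<le> emeasure \<mu> U"
  proof (rule content_least)
    fix f assume f: "subordinate U f"
    then have "ennreal (u f) = (\<integral>\<^sup>+ x. ennreal (f x) \<partial>\<mu>)" by (intro nn) (auto simp: subordinate_def)
    also have "\<dots> \<le> (\<integral>\<^sup>+ x. indicator U x \<partial>\<mu>)"
    proof (rule nn_integral_mono)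
      fix x
      have "f x \<noteq> 0 \<Longrightarrow> x \<in> U" "f x \<le> 1" using f unfolding subordinate_def by auto
      then show "ennreal (f x) \<le> indicator U x" by (cases "f x = 0") (auto simp: indicator_def)
    qed
    also have "\<dots> = emeasure \<mu> U" using U by (simp add: s)
    finally show "ennreal (u f) \<le> emeasure \<mu> U" .
  qed
qed

lemma radon_measure_unique:
  fixes \<mu> :: "(real^'n) measure"
  assumes s: "sets \<mu> = sets borel" and fin: "\<And>K. compact K \<Longrightarrow> emeasure \<mu> K < \<infinity>"
    and int: "\<And>f. test_fun f \<Longrightarrow> (LINT x|\<mu>. f x) = u f"
  shows "\<mu> = representing_measure"
proof (rule measure_eqI_generator_eq[where E = "{S. open S}" and \<Omega> = UNIV and A = "\<lambda>n. ball 0 (real n)"])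
  show "Int_stable {S. open (S :: (real^'n) set)}" by (auto simp: Int_stable_def)
  show "sets \<mu> = sigma_sets UNIV {S. open S}" "sets representing_measure = sigma_sets UNIV {S. open S}"
    using s sets_representing_measure by (simp_all add: sets_borel)
  show "emeasure \<mu> X = emeasure representing_measure X" if "X \<in> {S. open S}" for X
    using that radon_measure_open[OF s fin int] emeasure_representing_open by simp
  show "(\<Union>i. ball 0 (real i)) = (UNIV :: (real^'n) set)"
    using reals_Archimedean2 by (auto simp: dist_norm)
  show "emeasure \<mu> (ball 0 (real i)) \<noteq> \<infinity>" for i
  proof -
    have "emeasure \<mu> (ball 0 (real i)) \<le> emeasure \<mu> (cball 0 (real i))"
      by (intro emeasure_mono) (auto simp: s)
    with fin[OF compact_cball, of 0 "real i"] show ?thesis by (auto simp: top_unique)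
  qed
qed auto

lemma density_measure_eq: "density_measure u = representing_measure"
  unfolding density_measure_def
proof (rule the_equality)
  show "sets representing_measure = sets borel \<and>
      (\<forall>K. compact K \<longrightarrow> emeasure representing_measure K < \<infinity>) \<and>
      (\<forall>f. test_fun f \<longrightarrow> (LINT x|representing_measure. f x) = u f)"
    by (intro conjI allI impI sets_representing_measure finite_on_compact representing_measure_integral)
qed (blast intro: radon_measure_unique)

end

section \<open>The exterior algebra of superforms\<close>

lemma merge_sign_empty [simp]: "merge_sign {} B = 1" "merge_sign A {} = 1"
  by (simp_all add: merge_sign_def)

lemma merge_sign_square [simp]: "merge_sign A B * merge_sign A B = 1"
  by (simp add: merge_sign_def power_mult_distrib[symmetric])

lemma merge_sign_Un_left:
  assumes "A \<inter> A' = {}"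
  shows "merge_sign (A \<union> A') B = merge_sign A B * merge_sign A' B"
proof -
  have "{(a, b). a \<in> A \<union> A' \<and> b \<in> B \<and> b < a} =
      {(a, b). a \<in> A \<and> b \<in> B \<and> b < a} \<union> {(a, b). a \<in> A' \<and> b \<in> B \<and> b < a}" by auto
  moreover have "{(a, b). a \<in> A \<and> b \<in> B \<and> b < a} \<inter> {(a, b). a \<in> A' \<and> b \<in> B \<and> b < a} = {}"
    using assms by auto
  ultimately show ?thesis
    unfolding merge_sign_def power_add[symmetric] by (simp add: card_Un_disjoint)
qed

lemma merge_sign_Un_right:
  assumes "B \<inter> B' = {}"
  shows "merge_sign A (B \<union> B') = merge_sign A B * merge_sign A B'"
proof -
  have "{(a, b). a \<in> A \<and> b \<in> B \<union> B' \<and> b < a} =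
      {(a, b). a \<in> A \<and> b \<in> B \<and> b < a} \<union> {(a, b). a \<in> A \<and> b \<in> B' \<and> b < a}" by auto
  moreover have "{(a, b). a \<in> A \<and> b \<in> B \<and> b < a} \<inter> {(a, b). a \<in> A \<and> b \<in> B' \<and> b < a} = {}"
    using assms by auto
  ultimately show ?thesis
    unfolding merge_sign_def power_add[symmetric] by (simp add: card_Un_disjoint)
qed

lemma merge_sign_swap:
  assumes "A \<inter> B = {}"
  shows "merge_sign A B * merge_sign B A = (- 1) ^ (card A * card B)"
proof -
  have "card {(a, b). a \<in> B \<and> b \<in> A \<and> b < a} = card {(a, b). a \<in> A \<and> b \<in> B \<and> a < b}"
    by (rule bij_betw_same_card[of prod.swap]) (auto simp: bij_betw_def inj_on_def image_def)
  moreover have "{(a, b). a \<in> A \<and> b \<in> B \<and> b < a} \<union> {(a, b). a \<in> A \<and> b \<in> B \<and> a < b} = A \<times> B"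
    using assms by auto
  moreover have "{(a, b). a \<in> A \<and> b \<in> B \<and> b < a} \<inter> {(a, b). a \<in> A \<and> b \<in> B \<and> a < b} = {}" by auto
  ultimately have "card {(a, b). a \<in> A \<and> b \<in> B \<and> b < a} + card {(a, b). a \<in> B \<and> b \<in> A \<and> b < a}
      = card A * card B"
    by (simp add: card_Un_disjoint[symmetric] card_cartesian_product)
  then show ?thesis unfolding merge_sign_def power_add[symmetric] by simp
qed

lemma wedge_sign_assoc:
  assumes "K \<inter> K' = {}" "K \<inter> K'' = {}" "K' \<inter> K'' = {}" "L \<inter> L' = {}" "L \<inter> L'' = {}" "L' \<inter> L'' = {}"
  shows "wedge_sign K L K' L' * wedge_sign (K \<union> K') (L \<union> L') K'' L'' =
     wedge_sign K L (K' \<union> K'') (L' \<union> L'') * wedge_sign K' L' K'' L''"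
  using assms
  by (simp add: wedge_sign_def merge_sign_Un_left merge_sign_Un_right card_Un_disjoint power_add
      algebra_simps)

text \<open>Both sides sum over the ordered partitions of \<open>M\<close> into three parts.\<close>

lemma sum_Pow_assoc:
  fixes f :: "'a set \<Rightarrow> 'a set \<Rightarrow> 'a set \<Rightarrow> real"
  assumes "finite M"
  shows "(\<Sum>M'\<in>Pow M. \<Sum>K\<in>Pow M'. f K (M' - K) (M - M'))
     = (\<Sum>K\<in>Pow M. \<Sum>K'\<in>Pow (M - K). f K K' (M - K - K'))"
proof -
  have fin: "\<forall>x\<in>Pow M. finite (Pow x)" "\<forall>x\<in>Pow M. finite (Pow (M - x))"
    using assms finite_subset by auto
  have "(\<Sum>M'\<in>Pow M. \<Sum>K\<in>Pow M'. f K (M' - K) (M - M'))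
     = (\<Sum>(M', K)\<in>Sigma (Pow M) Pow. f K (M' - K) (M - M'))"
    using assms fin by (intro sum.Sigma) auto
  also have "\<dots> = (\<Sum>(K, K')\<in>Sigma (Pow M) (\<lambda>K. Pow (M - K)). f K K' (M - K - K'))"
  proof (rule sum.reindex_bij_witness[where i = "\<lambda>(K, K'). (K \<union> K', K)" and j = "\<lambda>(M', K). (K, M' - K)"])
    fix a assume "a \<in> Sigma (Pow M) Pow"
    then obtain M' K where a: "a = (M', K)" "M' \<subseteq> M" "K \<subseteq> M'" by auto
    then have "M - K - (M' - K) = M - M'" by blast
    with a show "(case case a of (M', K) \<Rightarrow> (K, M' - K) of (K, K') \<Rightarrow> f K K' (M - K - K')) =
      (case a of (M', K) \<Rightarrow> f K (M' - K) (M - M'))" by simp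
  qed auto
  also have "\<dots> = (\<Sum>K\<in>Pow M. \<Sum>K'\<in>Pow (M - K). f K K' (M - K - K'))"
    using assms fin by (intro sum.Sigma[symmetric]) auto
  finally show ?thesis .
qed

text \<open>Currents and forms are treated at once: a form is a current whose coefficients act by evaluation at a
  point.  The set \<open>X\<close> contains the functions on which the coefficients of \<open>T\<close> are known to be linear: all
  functions in the case of forms, the test functions in the case of distributions.\<close>

lemma wedge_current_assoc:
  fixes T :: "'n::{finite,linorder} supercurrent"
  assumes lin: "\<And>K L (I :: ('n set \<times> 'n set) set) c f. (\<And>i. i \<in> I \<Longrightarrow> f i \<in> X) \<Longrightarrow>
      T K L (\<lambda>x. \<Sum>i\<in>I. c i * f i x) = (\<Sum>i\<in>I. c i * T K L (f i))"
    and X: "\<And>K L K' L'. (\<lambda>x. \<alpha> K L x * (\<gamma> K' L' x * \<phi> x)) \<in> X"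
  shows "wedge_current (wedge_current T \<alpha>) \<gamma> M N \<phi> = wedge_current T (wedge \<alpha> \<gamma>) M N \<phi>"
proof -
  define F where "F K K' K'' L L' L'' = wedge_sign K L K' L' * wedge_sign (K \<union> K') (L \<union> L') K'' L'' *
     T K L (\<lambda>x. \<alpha> K' L' x * (\<gamma> K'' L'' x * \<phi> x))" for K K' K'' L L' L''
  define G where "G K K' K'' L L' L'' = wedge_sign K L (K' \<union> K'') (L' \<union> L'') * wedge_sign K' L' K'' L'' *
     T K L (\<lambda>x. \<alpha> K' L' x * (\<gamma> K'' L'' x * \<phi> x))" for K K' K'' L L' L''
  have "wedge_current (wedge_current T \<alpha>) \<gamma> M N \<phi> =
      (\<Sum>M'\<in>Pow M. \<Sum>N'\<in>Pow N. \<Sum>K\<in>Pow M'. \<Sum>L\<in>Pow N'. F K (M' - K) (M - M') L (N' - L) (N - N'))"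
    unfolding wedge_current_def F_def sum_distrib_left
    by (intro sum.cong refl) (simp add: Un_absorb1 Un_Diff_cancel)
  also have "\<dots> = (\<Sum>M'\<in>Pow M. \<Sum>K\<in>Pow M'. \<Sum>N'\<in>Pow N. \<Sum>L\<in>Pow N'.
      F K (M' - K) (M - M') L (N' - L) (N - N'))"
    by (intro sum.cong refl sum.swap)
  also have "\<dots> = (\<Sum>M'\<in>Pow M. \<Sum>K\<in>Pow M'. \<Sum>L\<in>Pow N. \<Sum>L'\<in>Pow (N - L).
      F K (M' - K) (M - M') L L' (N - L - L'))"
    by (intro sum.cong refl sum_Pow_assoc) simp
  also have "\<dots> = (\<Sum>K\<in>Pow M. \<Sum>K'\<in>Pow (M - K). \<Sum>L\<in>Pow N. \<Sum>L'\<in>Pow (N - L).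
      F K K' (M - K - K') L L' (N - L - L'))"
    by (rule sum_Pow_assoc[where f = "\<lambda>K K' K''. \<Sum>L\<in>Pow N. \<Sum>L'\<in>Pow (N - L).
      F K K' K'' L L' (N - L - L')"]) simp
  also have "\<dots> = (\<Sum>K\<in>Pow M. \<Sum>L\<in>Pow N. \<Sum>K'\<in>Pow (M - K). \<Sum>L'\<in>Pow (N - L).
      F K K' (M - K - K') L L' (N - L - L'))"
    by (intro sum.cong refl sum.swap)
  also have "\<dots> = (\<Sum>K\<in>Pow M. \<Sum>L\<in>Pow N. \<Sum>K'\<in>Pow (M - K). \<Sum>L'\<in>Pow (N - L).
      G K K' (M - K - K') L L' (N - L - L'))"
    unfolding F_def G_def
    by (intro sum.cong refl arg_cong2[where f = "(*)"] wedge_sign_assoc) auto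
  also have "\<dots> = wedge_current T (wedge \<alpha> \<gamma>) M N \<phi>"
    unfolding wedge_current_def
  proof (intro sum.cong refl)
    fix K L assume KL: "K \<in> Pow M" "L \<in> Pow N"
    let ?I = "Pow (M - K) \<times> Pow (N - L)"
    let ?s = "\<lambda>(K', L'). wedge_sign K' L' (M - K - K') (N - L - L')"
    let ?f = "\<lambda>(K', L'). \<lambda>x. \<alpha> K' L' x * (\<gamma> (M - K - K') (N - L - L') x * \<phi> x)"
    have "(\<lambda>x. wedge \<alpha> \<gamma> (M - K) (N - L) x * \<phi> x) = (\<lambda>x. \<Sum>i\<in>?I. ?s i * ?f i x)"
      unfolding wedge_def sum_distrib_right sum.cartesian_product
      by (intro ext sum.cong refl) (simp add: split_beta mult.assoc)
    then have "T K L (\<lambda>x. wedge \<alpha> \<gamma> (M - K) (N - L) x * \<phi> x) = (\<Sum>i\<in>?I. ?s i * T K L (?f i))"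
      using X by (simp add: lin split_beta)
    also have "\<dots> = (\<Sum>K'\<in>Pow (M - K). \<Sum>L'\<in>Pow (N - L).
        wedge_sign K' L' (M - K - K') (N - L - L') *
        T K L (\<lambda>x. \<alpha> K' L' x * (\<gamma> (M - K - K') (N - L - L') x * \<phi> x)))"
      unfolding sum.cartesian_product by (simp add: split_beta)
    finally have T: "T K L (\<lambda>x. wedge \<alpha> \<gamma> (M - K) (N - L) x * \<phi> x) =
        (\<Sum>K'\<in>Pow (M - K). \<Sum>L'\<in>Pow (N - L). wedge_sign K' L' (M - K - K') (N - L - L') *
        T K L (\<lambda>x. \<alpha> K' L' x * (\<gamma> (M - K - K') (N - L - L') x * \<phi> x)))" .
    have un: "K' \<union> (M - K - K') = M - K" if "K' \<in> Pow (M - K)" for K' using that by blast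
    have un': "L' \<union> (N - L - L') = N - L" if "L' \<in> Pow (N - L)" for L' using that by blast
    show "(\<Sum>K'\<in>Pow (M - K). \<Sum>L'\<in>Pow (N - L). G K K' (M - K - K') L L' (N - L - L')) =
        wedge_sign K L (M - K) (N - L) * T K L (\<lambda>x. wedge \<alpha> \<gamma> (M - K) (N - L) x * \<phi> x)"
      unfolding T sum_distrib_left G_def
      by (intro sum.cong refl) (simp only: un un' mult.assoc)
  qed
  finally show ?thesis .
qed

lemma wedge_assoc: "wedge (wedge \<alpha> \<gamma>) \<delta> = wedge \<alpha> (wedge \<gamma> \<delta>)"
proof (intro ext)
  fix M N x
  let ?T = "\<lambda>K L \<phi>. \<alpha> K L x * \<phi> x"
  have "wedge_current (wedge_current ?T \<gamma>) \<delta> M N (\<lambda>x. 1) = wedge_current ?T (wedge \<gamma> \<delta>) M N (\<lambda>x. 1)"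
    by (rule wedge_current_assoc[where X = UNIV]) (auto simp: sum_distrib_left intro!: sum.cong)
  then show "wedge (wedge \<alpha> \<gamma>) \<delta> M N x = wedge \<alpha> (wedge \<gamma> \<delta>) M N x"
    by (simp add: wedge_current_def wedge_def mult.assoc sum_distrib_right)
qed

lemma wedge_lincomb_left:
  "wedge (\<lambda>K L x. \<alpha> K L x + c x * \<gamma> K L x) \<delta> = (\<lambda>M N x. wedge \<alpha> \<delta> M N x + c x * wedge \<gamma> \<delta> M N x)"
  by (simp add: wedge_def fun_eq_iff sum_distrib_left sum.distrib[symmetric] algebra_simps)

lemma wedge_lincomb_right:
  "wedge \<delta> (\<lambda>K L x. \<alpha> K L x + c x * \<gamma> K L x) = (\<lambda>M N x. wedge \<delta> \<alpha> M N x + c x * wedge \<delta> \<gamma> M N x)"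
  by (simp add: wedge_def fun_eq_iff sum_distrib_left sum.distrib[symmetric] algebra_simps)

lemma wedge_sign_unit [simp]: "wedge_sign {} {} K L = 1" "wedge_sign K L {} {} = 1"
  by (simp_all add: wedge_sign_def)

lemma wedge_one_left: "wedge (function_form (\<lambda>x. 1)) \<alpha> = \<alpha>"
proof (intro ext)
  fix M N x
  have "(\<Sum>L\<in>Pow N. wedge_sign K L (M - K) (N - L) * (function_form (\<lambda>x. 1) K L x * \<alpha> (M - K) (N - L) x))
      = (if K = {} then \<alpha> M N x else 0)" for K
    by (simp add: function_form_def if_distrib[of "\<lambda>z. z x"] if_distrib[of "\<lambda>z. z * _"]
        if_distrib[of "\<lambda>z. _ * z"] sum.delta cong: if_cong)
  then show "wedge (function_form (\<lambda>x. 1)) \<alpha> M N x = \<alpha> M N x"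
    by (simp add: wedge_def sum.delta)
qed

lemma wedge_one_right: "wedge \<alpha> (function_form (\<lambda>x. 1)) = \<alpha>"
proof (intro ext)
  fix M N :: "'a set" and x
  have iff: "M - K = {} \<and> N - L = {} \<longleftrightarrow> K = M \<and> L = N" if "K \<in> Pow M" "L \<in> Pow N" for K L
    using that by blast
  have "wedge \<alpha> (function_form (\<lambda>x. 1)) M N x =
    (\<Sum>K\<in>Pow M. \<Sum>L\<in>Pow N. if K = M \<and> L = N then \<alpha> M N x else 0)"
    unfolding wedge_def by (intro sum.cong refl) (auto simp: function_form_def iff)
  also have "\<dots> = (\<Sum>K\<in>Pow M. if K = M then (\<Sum>L\<in>Pow N. if L = N then \<alpha> M N x else 0) else 0)"
    by (intro sum.cong refl) simp
  also have "\<dots> = \<alpha> M N x" by (simp add: sum.delta)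
  finally show "wedge \<alpha> (function_form (\<lambda>x. 1)) M N x = \<alpha> M N x" .
qed

lemma form_power_add: "wedge (form_power \<alpha> i) (form_power \<alpha> j) = form_power \<alpha> (i + j)"
  by (induction j) (simp_all add: wedge_one_right wedge_assoc[symmetric])

section \<open>Forms of bidegree (1,1)\<close>

text \<open>The form \<open>\<Sum>\<^sub>i\<^sub>j a\<^sub>i\<^sub>j dx\<^sub>i \<and> d\<xi>\<^sub>j\<close>.\<close>

definition form11 :: "('n::{finite,linorder} \<Rightarrow> 'n \<Rightarrow> real^'n::{finite,linorder} \<Rightarrow> real) \<Rightarrow> 'n superform" where
  "form11 a = (\<lambda>K L x. if is_singleton K \<and> is_singleton L then a (the_elem K) (the_elem L) x else 0)"

lemma form11_singleton [simp]: "form11 a {i} {j} x = a i j x"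
  by (simp add: form11_def)

lemma sum_Pow_complement_singleton:
  fixes f :: "'a set \<Rightarrow> real"
  assumes "finite M" "\<And>K. K \<subseteq> M \<Longrightarrow> \<not> is_singleton (M - K) \<Longrightarrow> f K = 0"
  shows "sum f (Pow M) = (\<Sum>i\<in>M. f (M - {i}))"
proof -
  have inj: "inj_on (\<lambda>i. M - {i}) M" by (auto simp: inj_on_def)
  have "sum f ((\<lambda>i. M - {i}) ` M) = sum f (Pow M)"
  proof (rule sum.mono_neutral_left)
    show "\<forall>K\<in>Pow M - (\<lambda>i. M - {i}) ` M. f K = 0"
    proof
      fix K assume K: "K \<in> Pow M - (\<lambda>i. M - {i}) ` M"
      have "\<not> is_singleton (M - K)"
      proof
        assume "is_singleton (M - K)"
        then obtain i where "M - K = {i}" by (auto simp: is_singleton_def)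
        with K have "i \<in> M" "K = M - {i}" by auto
        with K show False by blast
      qed
      with K assms(2) show "f K = 0" by blast
    qed
  qed (use assms in auto)
  then show ?thesis using sum.reindex[OF inj, of f] by simp
qed

lemma sum_Pow_complement_singletons:
  fixes f :: "'a set \<Rightarrow> 'b set \<Rightarrow> real"
  assumes "finite M" "finite N"
    "\<And>K L. K \<subseteq> M \<Longrightarrow> L \<subseteq> N \<Longrightarrow> \<not> (is_singleton (M - K) \<and> is_singleton (N - L)) \<Longrightarrow> f K L = 0"
  shows "(\<Sum>K\<in>Pow M. \<Sum>L\<in>Pow N. f K L) = (\<Sum>i\<in>M. \<Sum>j\<in>N. f (M - {i}) (N - {j}))"
proof -
  have "(\<Sum>K\<in>Pow M. \<Sum>L\<in>Pow N. f K L) = (\<Sum>i\<in>M. \<Sum>L\<in>Pow N. f (M - {i}) L)"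
    by (rule sum_Pow_complement_singleton) (use assms in \<open>auto intro!: sum.neutral\<close>)
  also have "\<dots> = (\<Sum>i\<in>M. \<Sum>j\<in>N. f (M - {i}) (N - {j}))"
    by (intro sum.cong refl sum_Pow_complement_singleton) (use assms in auto)
  finally show ?thesis .
qed

lemma double_diff_singleton: "i \<in> M \<Longrightarrow> M - (M - {i}) = {i}"
  by blast

lemma wedge_form11:
  "wedge \<gamma> (form11 a) M N x = (\<Sum>i\<in>M. \<Sum>j\<in>N.
     wedge_sign (M - {i}) (N - {j}) {i} {j} * (\<gamma> (M - {i}) (N - {j}) x * a i j x))"
proof -
  have "wedge \<gamma> (form11 a) M N x = (\<Sum>i\<in>M. \<Sum>j\<in>N.
     wedge_sign (M - {i}) (N - {j}) (M - (M - {i})) (N - (N - {j})) *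
     (\<gamma> (M - {i}) (N - {j}) x * form11 a (M - (M - {i})) (N - (N - {j})) x))"
    unfolding wedge_def by (rule sum_Pow_complement_singletons) (auto simp: form11_def)
  then show ?thesis by (simp add: double_diff_singleton cong: sum.cong)
qed

lemma wedge_current_form11:
  assumes "\<And>K L. T K L (\<lambda>x. 0) = 0"
  shows "wedge_current T (form11 a) M N \<phi> = (\<Sum>i\<in>M. \<Sum>j\<in>N.
     wedge_sign (M - {i}) (N - {j}) {i} {j} * T (M - {i}) (N - {j}) (\<lambda>x. a i j x * \<phi> x))"
proof -
  have "wedge_current T (form11 a) M N \<phi> = (\<Sum>i\<in>M. \<Sum>j\<in>N.
     wedge_sign (M - {i}) (N - {j}) (M - (M - {i})) (N - (N - {j})) *
     T (M - {i}) (N - {j}) (\<lambda>x. form11 a (M - (M - {i})) (N - (N - {j})) x * \<phi> x))"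
    unfolding wedge_current_def
    by (rule sum_Pow_complement_singletons) (auto simp: form11_def assms)
  then show ?thesis by (simp add: double_diff_singleton cong: sum.cong)
qed

lemma wedge_dx_dxi: "wedge (dx i) (dxi i) M N x = (if M = {i} \<and> N = {i} then 1 else 0)"
proof -
  have "wedge (dx i) (dxi i) M N x =
    (\<Sum>K\<in>Pow M. \<Sum>L\<in>Pow N. if K = {i} then (if L = {} then (if M = {i} \<and> N = {i} then 1 else 0) else 0) else 0)"
    unfolding wedge_def
  proof (intro sum.cong refl)
    fix K L assume "K \<in> Pow M" "L \<in> Pow N"
    then have "K = {i} \<Longrightarrow> M - K = {} \<longleftrightarrow> M = {i}" by blast
    then show "wedge_sign K L (M - K) (N - L) * (dx i K L x * dxi i (M - K) (N - L) x) =
      (if K = {i} then (if L = {} then (if M = {i} \<and> N = {i} then 1 else 0) else 0) else 0)"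
      by (auto simp: dx_def dxi_def wedge_sign_def)
  qed
  also have "\<dots> = (\<Sum>K\<in>Pow M. if K = {i} then (if M = {i} \<and> N = {i} then 1 else 0) else 0)"
    by (intro sum.cong refl) (simp add: sum.delta)
  also have "\<dots> = (if M = {i} \<and> N = {i} then 1 else 0)"
    by (simp add: sum.delta)
  finally show ?thesis .
qed

lemma beta_eq_form11: "beta = form11 (\<lambda>i j x. if i = j then 1 else 0)"
proof (intro ext)
  fix K L :: "'a set" and x
  have "beta K L x = (\<Sum>i\<in>UNIV. if K = {i} \<and> L = {i} then 1 else 0)"
    unfolding beta_def wedge_dx_dxi ..
  also have "\<dots> = form11 (\<lambda>i j x. if i = j then 1 else 0) K L x"
  proof (cases "is_singleton K \<and> is_singleton L")
    case True
    then obtain k l where kl: "K = {k}" "L = {l}" by (auto simp: is_singleton_def)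
    have "(\<Sum>i\<in>UNIV. if K = {i} \<and> L = {i} then 1 else 0) =
      (\<Sum>i\<in>UNIV. if i = k then (if k = l then 1 else 0) else (0::real))"
      unfolding kl by (intro sum.cong refl) auto
    then show ?thesis by (simp add: kl)
  next
    case False
    then show ?thesis by (auto simp: form11_def is_singleton_def intro!: sum.neutral)
  qed
  finally show "beta K L x = form11 (\<lambda>i j x. if i = j then 1 else 0) K L x" .
qed

lemma wedge_sign_singletons_swap:
  assumes "i \<noteq> i'" "j \<noteq> j'"
  shows "wedge_sign {i} {j} {i'} {j'} = wedge_sign {i'} {j'} {i} {j}"
proof -
  have m: "merge_sign {k} {l} = (if l < k then - 1 else 1)" for k l :: 'a
  proof -
    have "{(a, b). a \<in> {k} \<and> b \<in> {l} \<and> b < a} = (if l < k then {(k, l)} else {})" by auto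
    then show ?thesis by (simp add: merge_sign_def)
  qed
  show ?thesis using assms by (auto simp: wedge_sign_def m)
qed

lemma sum_Pow_complement:
  fixes f :: "'a set \<Rightarrow> real"
  shows "sum f (Pow M) = (\<Sum>K\<in>Pow M. f (M - K))"
  by (rule sum.reindex_bij_witness[where i = "\<lambda>K. M - K" and j = "\<lambda>K. M - K"]) (auto simp: double_diff)

text \<open>Forms of even degree commute.\<close>

lemma wedge_form11_commute: "wedge (form11 a) (form11 b) = wedge (form11 b) (form11 a)"
proof (intro ext)
  fix M N x
  define F where "F K L = wedge_sign K L (M - K) (N - L) * (form11 a K L x * form11 b (M - K) (N - L) x)" for K L
  have "wedge (form11 a) (form11 b) M N x = (\<Sum>K\<in>Pow M. \<Sum>L\<in>Pow N. F K L)"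
    by (simp add: wedge_def F_def)
  also have "\<dots> = (\<Sum>K\<in>Pow M. \<Sum>L\<in>Pow N. F (M - K) L)"
    by (rule sum_Pow_complement[where f = "\<lambda>K. \<Sum>L\<in>Pow N. F K L"])
  also have "\<dots> = (\<Sum>K\<in>Pow M. \<Sum>L\<in>Pow N. F (M - K) (N - L))"
    by (intro sum.cong refl sum_Pow_complement)
  also have "\<dots> = (\<Sum>K\<in>Pow M. \<Sum>L\<in>Pow N.
      wedge_sign (M - K) (N - L) (M - (M - K)) (N - (N - L)) *
      (form11 a (M - K) (N - L) x * form11 b (M - (M - K)) (N - (N - L)) x))"
    by (simp only: F_def)
  also have "\<dots> = wedge (form11 b) (form11 a) M N x"
    unfolding wedge_def
  proof (intro sum.cong refl)
    fix K L assume KL: "K \<in> Pow M" "L \<in> Pow N"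
    then have [simp]: "M - (M - K) = K" "N - (N - L) = L" by blast+
    show "wedge_sign (M - K) (N - L) (M - (M - K)) (N - (N - L)) *
      (form11 a (M - K) (N - L) x * form11 b (M - (M - K)) (N - (N - L)) x) =
      wedge_sign K L (M - K) (N - L) * (form11 b K L x * form11 a (M - K) (N - L) x)"
    proof (cases "is_singleton K \<and> is_singleton L \<and> is_singleton (M - K) \<and> is_singleton (N - L)")
      case True
      then obtain i j i' j' where s: "K = {i}" "L = {j}" "M - K = {i'}" "N - L = {j'}"
        by (auto simp: is_singleton_def)
      then have "i \<noteq> i'" "j \<noteq> j'" by auto
      then show ?thesis
        unfolding \<open>M - (M - K) = K\<close> \<open>N - (N - L) = L\<close>
        unfolding s(3,4)
        unfolding s(1,2)
        using wedge_sign_singletons_swap[of i' i j' j] by simp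
    next
      case False
      then show ?thesis by (auto simp: form11_def)
    qed
  qed
  finally show "wedge (form11 a) (form11 b) M N x = wedge (form11 b) (form11 a) M N x" .
qed

text \<open>The form \<open>v \<and> J v\<close> of a \<open>(1,0)\<close>-form \<open>v\<close>.\<close>

definition rank_one :: "('n::{finite,linorder} \<Rightarrow> real^'n::{finite,linorder} \<Rightarrow> real) \<Rightarrow> 'n superform" where
  "rank_one v = form11 (\<lambda>i j x. v i x * v j x)"

text \<open>The coefficient of \<open>dx\<^sub>M \<and> d\<xi>\<^sub>N\<close> factors into a sum over splittings of \<open>M\<close> and one over splittings of \<open>N\<close>.
  The first changes sign when the two parts of \<open>M\<close> are exchanged, so it vanishes; this is \<open>v \<and> v = 0\<close>.\<close>

lemma rank_one_square: "wedge (rank_one v) (rank_one v) = (\<lambda>K L x. 0)"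
proof (intro ext)
  fix M N x
  define w where "w K = (if is_singleton K then v (the_elem K) x else 0)" for K
  define f where "f K = merge_sign K (M - K) * (w K * w (M - K))" for K
  have r: "rank_one v K L x = w K * w L" for K L
    by (simp add: rank_one_def form11_def w_def)
  have anti: "f (M - K) = - f K" if "K \<in> Pow M" for K
  proof (cases "is_singleton K \<and> is_singleton (M - K)")
    case True
    have [simp]: "M - (M - K) = K" using that by blast
    have p: "merge_sign K (M - K) * merge_sign (M - K) K = - 1"
    proof -
      have "card K = 1" "card (M - K) = 1" using True by (simp_all add: is_singleton_altdef)
      moreover have "K \<inter> (M - K) = {}" by blast
      ultimately show ?thesis using merge_sign_swap[of K "M - K"] by simp
    qed
    have "merge_sign (M - K) K = (merge_sign K (M - K) * merge_sign K (M - K)) * merge_sign (M - K) K"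
      by simp
    also have "\<dots> = - merge_sign K (M - K)" by (simp add: mult.assoc p del: merge_sign_square)
    finally have "merge_sign (M - K) K = - merge_sign K (M - K)" .
    then show ?thesis by (simp add: f_def)
  next
    case False
    have [simp]: "M - (M - K) = K" using that by blast
    from False show ?thesis by (auto simp: f_def w_def)
  qed
  have "sum f (Pow M) = (\<Sum>K\<in>Pow M. - f K)"
    by (subst sum_Pow_complement) (intro sum.cong refl anti)
  then have f0: "sum f (Pow M) = 0" by (simp add: sum_negf)
  have "wedge (rank_one v) (rank_one v) M N x =
      (\<Sum>K\<in>Pow M. \<Sum>L\<in>Pow N. f K * (- (merge_sign L (N - L) * (w L * w (N - L)))))"
    unfolding wedge_def
  proof (intro sum.cong refl)
    fix K L
    show "wedge_sign K L (M - K) (N - L) * (rank_one v K L x * rank_one v (M - K) (N - L) x) =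
       f K * (- (merge_sign L (N - L) * (w L * w (N - L))))"
    proof (cases "is_singleton L \<and> is_singleton (M - K)")
      case True
      then have "card L = 1" "card (M - K) = 1" by (auto simp: is_singleton_def)
      then show ?thesis by (simp add: wedge_sign_def r f_def)
    next
      case False
      then show ?thesis by (auto simp: r f_def w_def)
    qed
  qed
  also have "\<dots> = sum f (Pow M) * (\<Sum>L\<in>Pow N. - (merge_sign L (N - L) * (w L * w (N - L))))"
    by (simp add: sum_product)
  finally show "wedge (rank_one v) (rank_one v) M N x = 0" by (simp add: f0)
qed

lemma form_power_form11_commute:
  "wedge (form_power (form11 a) k) (form11 b) = wedge (form11 b) (form_power (form11 a) k)"
proof (induction k)
  case 0
  show ?case by (simp add: wedge_one_left wedge_one_right)
next
  case (Suc k)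
  have "wedge (form_power (form11 a) (Suc k)) (form11 b)
      = wedge (form_power (form11 a) k) (wedge (form11 b) (form11 a))"
    by (simp add: wedge_assoc wedge_form11_commute[of a b])
  also have "\<dots> = wedge (form11 b) (form_power (form11 a) (Suc k))"
    by (simp add: wedge_assoc[symmetric] Suc)
  finally show ?case .
qed

text \<open>The binomial expansion stops after the linear term because the square of a rank one form is zero.\<close>

lemma power_beta_plus_rank_one:
  fixes v :: "'n::{finite,linorder} \<Rightarrow> real^'n::{finite,linorder} \<Rightarrow> real"
  shows "form_power (\<lambda>K L x. beta K L x + c x * rank_one v K L x) (Suc k) =
    (\<lambda>K L x. form_power beta (Suc k) K L x + (real (Suc k) * c x) * wedge (form_power beta k) (rank_one v) K L x)"
proof (induction k)
  case 0
  show ?case by (simp add: wedge_one_left)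
next
  case (Suc k)
  let ?b = "form_power beta" and ?w = "rank_one v"
  let ?a = "\<lambda>K L x. beta K L x + c x * rank_one v K L x"
  have 1: "wedge (wedge (?b k) ?w) beta = wedge (?b (Suc k)) ?w"
    by (simp add: wedge_assoc beta_eq_form11 rank_one_def wedge_form11_commute)
  have 2: "wedge (wedge (?b k) ?w) ?w = (\<lambda>K L x. 0)"
    by (simp add: wedge_assoc rank_one_square) (simp add: wedge_def)
  have "form_power ?a (Suc (Suc k)) = wedge (form_power ?a (Suc k)) ?a" by simp
  also have "\<dots> = (\<lambda>M N x. wedge (?b (Suc k)) ?a M N x +
      (real (Suc k) * c x) * wedge (wedge (?b k) ?w) ?a M N x)"
    unfolding Suc by (rule wedge_lincomb_left)
  also have "\<dots> = (\<lambda>M N x. ?b (Suc (Suc k)) M N x +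
      (real (Suc (Suc k)) * c x) * wedge (?b (Suc k)) ?w M N x)"
    unfolding wedge_lincomb_right 1 2 by (simp add: fun_eq_iff algebra_simps)
  finally show ?case .
qed

text \<open>The number \<open>(- 1)\<^bsup>k(k-1)/2\<^esup> k!\<close>; the sign comes from reordering
  \<open>dx\<^sub>1 \<and> d\<xi>\<^sub>1 \<and> \<dots> \<and> dx\<^sub>k \<and> d\<xi>\<^sub>k\<close> so that the \<open>dx\<^sub>i\<close> come first.\<close>

primrec beta_power_coeff :: "nat \<Rightarrow> real" where
  "beta_power_coeff 0 = 1"
| "beta_power_coeff (Suc k) = real (Suc k) * (- 1) ^ k * beta_power_coeff k"

lemma form_power_beta:
  "form_power beta k M N x = (if M = N \<and> card M = k then beta_power_coeff k else 0)"
proof (induction k arbitrary: M N)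
  case 0
  show ?case by (auto simp: function_form_def)
next
  case (Suc k)
  have "form_power beta (Suc k) M N x = (\<Sum>i\<in>M. \<Sum>j\<in>N. wedge_sign (M - {i}) (N - {j}) {i} {j} *
     (form_power beta k (M - {i}) (N - {j}) x * (if i = j then 1 else 0)))"
    using wedge_form11[of "form_power beta k" _ M N x] by (simp add: beta_eq_form11)
  also have "\<dots> = (if M = N \<and> card M = Suc k then beta_power_coeff (Suc k) else 0)"
  proof (cases "M = N \<and> card M = Suc k")
    case True
    then have M: "N = M" "card M = Suc k" by auto
    have "(\<Sum>j\<in>M. wedge_sign (M - {i}) (M - {j}) {i} {j} *
       (form_power beta k (M - {i}) (M - {j}) x * (if i = j then 1 else 0)))
       = (- 1) ^ k * beta_power_coeff k" if "i \<in> M" for i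
    proof -
      have "card (M - {i}) = k" using M that by simp
      have "(\<Sum>j\<in>M. wedge_sign (M - {i}) (M - {j}) {i} {j} *
         (form_power beta k (M - {i}) (M - {j}) x * (if i = j then 1 else 0)))
         = (\<Sum>j\<in>M. if j = i then wedge_sign (M - {i}) (M - {i}) {i} {i} * form_power beta k (M - {i}) (M - {i}) x else 0)"
        by (intro sum.cong refl) auto
      also have "\<dots> = (- 1) ^ k * beta_power_coeff k"
        using that \<open>card (M - {i}) = k\<close> by (simp add: sum.delta Suc wedge_sign_def mult.assoc)
      finally show ?thesis .
    qed
    then have "(\<Sum>i\<in>M. \<Sum>j\<in>N. wedge_sign (M - {i}) (N - {j}) {i} {j} *
       (form_power beta k (M - {i}) (N - {j}) x * (if i = j then 1 else 0)))
       = (\<Sum>i\<in>M. (- 1) ^ k * beta_power_coeff k)"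
      unfolding M(1) by (intro sum.cong refl)
    also have "\<dots> = beta_power_coeff (Suc k)" using M(2) by simp
    finally show ?thesis using M by simp
  next
    case False
    have "wedge_sign (M - {i}) (N - {j}) {i} {j} *
     (form_power beta k (M - {i}) (N - {j}) x * (if i = j then 1 else 0)) = 0" if "i \<in> M" "j \<in> N" for i j
    proof (rule ccontr)
      assume "\<not> ?thesis"
      then have e: "i = j" "M - {i} = N - {j}" "card (M - {i}) = k" by (auto simp: Suc split: if_splits)
      have "insert i (M - {i}) = M" "insert i (N - {j}) = N" using that e(1) by blast+
      with e(2) have "M = N" by metis
      moreover have "card M = Suc k" using that(1) e(3) card_Suc_Diff1[of M i] by simp
      ultimately show False using False by simp
    qed
    then have "(\<Sum>i\<in>M. \<Sum>j\<in>N. wedge_sign (M - {i}) (N - {j}) {i} {j} *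
       (form_power beta k (M - {i}) (N - {j}) x * (if i = j then 1 else 0))) = 0"
      by (intro sum.neutral ballI)
    then show ?thesis by (simp only: False if_False)
  qed
  finally show ?case .
qed

text \<open>Only the diagonal terms \<open>v\<^sub>i\<^sup>2 dx\<^sub>i \<and> d\<xi>\<^sub>i\<close> contribute, and each of the \<open>n\<close> forms
  \<open>dx\<^sub>i \<and> d\<xi>\<^sub>i \<and> \<beta>\<^bsup>n-1\<^esup>\<close> equals \<open>\<beta>\<^sup>n / n\<close>.\<close>

lemma beta_power_wedge_rank_one:
  fixes v :: "'n::{finite,linorder} \<Rightarrow> real^'n::{finite,linorder} \<Rightarrow> real"
  shows "wedge (form_power beta (CARD('n) - 1)) (rank_one v) M N x =
     (\<Sum>i\<in>UNIV. (v i x)\<^sup>2) / real CARD('n) * form_power beta CARD('n) M N x"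
proof -
  let ?n = "CARD('n)"
  have n: "?n = Suc (?n - 1)" by simp
  let ?t = "\<lambda>i j. wedge_sign (M - {i}) (N - {j}) {i} {j} *
    (form_power beta (?n - 1) (M - {i}) (N - {j}) x * (v i x * v j x))"
  have w: "wedge (form_power beta (?n - 1)) (rank_one v) M N x = (\<Sum>i\<in>M. \<Sum>j\<in>N. ?t i j)"
    unfolding rank_one_def by (rule wedge_form11)
  have full: "A = UNIV" if "card A = ?n" for A :: "'n set"
    using that by (simp add: card_eq_UNIV_imp_eq_UNIV)
  show ?thesis
  proof (cases "M = UNIV \<and> N = UNIV")
    case True
    have c: "card (UNIV - {i}) = ?n - 1" for i :: 'n by (simp add: card_Diff_subset)
    have "(\<Sum>j\<in>N. ?t i j) = (- 1) ^ (?n - 1) * beta_power_coeff (?n - 1) * (v i x)\<^sup>2" for i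
    proof -
      have "(\<Sum>j\<in>N. ?t i j) = (\<Sum>j\<in>UNIV. if j = i then (- 1) ^ (?n - 1) * beta_power_coeff (?n - 1) * (v i x)\<^sup>2 else 0)"
      proof (rule sum.cong)
        fix j
        show "?t i j = (if j = i then (- 1) ^ (?n - 1) * beta_power_coeff (?n - 1) * (v i x)\<^sup>2 else 0)"
          using c[of i] c[of j] True
          by (auto simp: form_power_beta wedge_sign_def power2_eq_square)
      qed (use True in simp)
      then show ?thesis by simp
    qed
    then have "wedge (form_power beta (?n - 1)) (rank_one v) M N x =
        (- 1) ^ (?n - 1) * beta_power_coeff (?n - 1) * (\<Sum>i\<in>UNIV. (v i x)\<^sup>2)"
      using True unfolding w by (simp add: sum_distrib_left)
    moreover have "beta_power_coeff ?n = real ?n * (- 1) ^ (?n - 1) * beta_power_coeff (?n - 1)"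
      using n beta_power_coeff.simps(2)[of "?n - 1"] by simp
    ultimately show ?thesis using True by (simp add: form_power_beta)
  next
    case False
    have "?t i j = 0" if "i \<in> M" "j \<in> N" for i j
    proof (rule ccontr)
      assume "?t i j \<noteq> 0"
      then have e: "M - {i} = N - {j}" "card (M - {i}) = ?n - 1"
        by (auto simp: form_power_beta split: if_splits)
      have "card M = ?n" using that(1) e(2) n card_Suc_Diff1[of M i] by simp
      moreover have "card N = ?n" using that(2) e n card_Suc_Diff1[of N j] by simp
      ultimately show False using False full by blast
    qed
    then have "wedge (form_power beta (?n - 1)) (rank_one v) M N x = 0"
      unfolding w by (intro sum.neutral ballI)
    then show ?thesis using False full by (auto simp: form_power_beta)
  qed
qed

lemma smooth_form_power_beta: "smooth (form_power beta k M N)"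
proof -
  have "form_power beta k M N = (\<lambda>x. if M = N \<and> card M = k then beta_power_coeff k else 0)"
    by (simp add: form_power_beta fun_eq_iff)
  then show ?thesis by simp
qed

lemma smooth_form11: "(\<And>i j. smooth (a i j)) \<Longrightarrow> smooth (form11 a K L)"
  unfolding form11_def by (cases "is_singleton K \<and> is_singleton L") auto

lemma smooth_wedge: "(\<And>K L. smooth (\<alpha> K L)) \<Longrightarrow> (\<And>K L. smooth (\<gamma> K L)) \<Longrightarrow> smooth (wedge \<alpha> \<gamma> M N)"
  unfolding wedge_def by (intro smooth_sum smooth_mult smooth_const) auto

lemma smooth_form_power: "(\<And>K L. smooth (\<alpha> K L)) \<Longrightarrow> smooth (form_power \<alpha> k M N)"
proof (induction k arbitrary: M N)
  case 0
  then show ?case by (simp add: function_form_def)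
next
  case (Suc k)
  then show ?case by (simp add: smooth_wedge)
qed

text \<open>The symmetric matrix of \<open>\<beta> - c v \<and> J v\<close> has eigenvalues \<open>1\<close> (\<open>n - 1\<close> times) and \<open>1 - c \<bar>v\<bar>\<^sup>2\<close>, so its
  \<open>j\<close>-th normalised elementary symmetric function is \<open>1 - j c \<bar>v\<bar>\<^sup>2 / n\<close>.  The condition for \<open>j = m\<close>
  implies those for smaller \<open>j\<close>.\<close>

lemma m_positive_beta_minus_rank_one:
  fixes v :: "'n::{finite,linorder} \<Rightarrow> real^'n::{finite,linorder} \<Rightarrow> real"
  assumes m: "m \<le> CARD('n)"
    and v: "\<And>i. smooth (v i)" and c: "smooth c" "\<And>x. 0 \<le> c x"
    and bound: "\<And>x. real m * (c x * (\<Sum>i\<in>UNIV. (v i x)\<^sup>2)) \<le> real CARD('n)"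
  shows "m_positive_form m (\<lambda>K L x. beta K L x + (- 1 * c x) * rank_one v K L x)"
    (is "m_positive_form m ?a")
  unfolding m_positive_form_def
proof (intro conjI ballI)
  let ?n = "CARD('n)"
  have eq: "?a = form11 (\<lambda>i j x. (if i = j then 1 else 0) + (- 1 * c x) * (v i x * v j x))"
    by (intro ext) (auto simp: beta_eq_form11 rank_one_def form11_def)
  show "superform 1 1 ?a"
    unfolding superform_def eq
  proof (intro conjI allI impI)
    show "smooth (form11 (\<lambda>i j x. (if i = j then 1 else 0) + (- 1 * c x) * (v i x * v j x)) K L)" for K L
      by (intro smooth_form11 smooth_add smooth_mult smooth_const c v)
    show "form11 (\<lambda>i j x. (if i = j then 1 else 0) + (- 1 * c x) * (v i x * v j x)) K L = (\<lambda>x. 0)"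
      if "card K \<noteq> 1 \<or> card L \<noteq> 1" for K L
      using that by (auto simp: form11_def is_singleton_altdef)
  qed
  show "symmetric_form ?a"
    unfolding symmetric_form_def eq by (auto simp: form11_def fun_eq_iff mult.commute)
  fix j assume "j \<in> {1..m}"
  then obtain k where k: "j = Suc k" "j \<le> m" by (cases j) auto
  have jn: "j \<le> ?n" using k m by simp
  let ?q = "form_power beta (?n - j) :: 'n superform"
  have 1: "wedge (form_power beta j) ?q = form_power beta ?n"
    using jn by (simp add: form_power_add)
  have kn: "k + (?n - j) = ?n - 1" using k jn by simp
  have "wedge ?q (rank_one v) = wedge (rank_one v) ?q"
    unfolding rank_one_def beta_eq_form11 by (rule form_power_form11_commute)
  then have "wedge (wedge (form_power beta k) (rank_one v)) ?q
      = wedge (form_power beta k) (wedge ?q (rank_one v))"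
    by (simp add: wedge_assoc)
  also have "\<dots> = wedge (form_power beta (?n - 1)) (rank_one v)"
    by (simp add: wedge_assoc[symmetric] form_power_add kn)
  finally have 2: "wedge (wedge (form_power beta k) (rank_one v)) ?q =
    wedge (form_power beta (?n - 1)) (rank_one v)" .
  let ?s = "\<lambda>x. \<Sum>i\<in>UNIV. (v i x)\<^sup>2"
  have "wedge (form_power ?a j) ?q = (\<lambda>M N x. form_power beta ?n M N x +
     (real j * (- 1 * c x)) * wedge (form_power beta (?n - 1)) (rank_one v) M N x)"
    unfolding k(1) power_beta_plus_rank_one[of "\<lambda>x. - 1 * c x"] wedge_lincomb_left
    unfolding k(1)[symmetric] 1 2 ..
  also have "\<dots> = (\<lambda>M N x. (1 - real j * (c x * ?s x) / real ?n) * form_power beta ?n M N x)"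
    unfolding beta_power_wedge_rank_one by (simp add: fun_eq_iff algebra_simps)
  finally have w: "wedge (form_power ?a j) ?q =
     (\<lambda>M N x. (1 - real j * (c x * ?s x) / real ?n) * form_power beta ?n M N x)" .
  have "0 \<le> 1 - real j * (c x * ?s x) / real ?n" for x
  proof -
    have "real j * (c x * ?s x) \<le> real m * (c x * ?s x)"
      using k c by (intro mult_right_mono) (auto intro!: mult_nonneg_nonneg sum_nonneg)
    with bound[of x] have "real j * (c x * ?s x) \<le> real ?n" by linarith
    then show ?thesis by simp
  qed
  then show "nonneg_top_form (wedge (form_power ?a j) ?q)"
    unfolding nonneg_top_form_def w
    by (intro exI[of _ "\<lambda>x. 1 - real j * (c x * ?s x) / real ?n"]) auto
qed

section \<open>Currents as linear functionals on test functions\<close>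

text \<open>The identities between currents below follow from this property of the coefficients, which is
  stable under wedging with smooth forms.\<close>

definition linear_on_tests :: "'n::{finite,linorder} supercurrent \<Rightarrow> bool" where
  "linear_on_tests T \<longleftrightarrow> (\<forall>K L \<phi> \<psi> a b. test_fun \<phi> \<longrightarrow> test_fun \<psi> \<longrightarrow>
     T K L (\<lambda>x. a * \<phi> x + b * \<psi> x) = a * T K L \<phi> + b * T K L \<psi>)"

lemma supercurrent_linear: "supercurrent p q T \<Longrightarrow> linear_on_tests T"
  unfolding supercurrent_def distribution_def linear_on_tests_def by blast

lemma linear_on_tests_zero:
  assumes "linear_on_tests T"
  shows "T K L (\<lambda>x. 0) = 0"
proof -
  have "T K L (\<lambda>x. 0 * 0 + 0 * 0) = 0 * T K L (\<lambda>x. 0) + 0 * T K L (\<lambda>x. 0)"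
    using assms test_fun_zero unfolding linear_on_tests_def by blast
  then show ?thesis by simp
qed

lemma linear_on_tests_sum:
  assumes T: "linear_on_tests T" and f: "\<And>i. i \<in> I \<Longrightarrow> test_fun (f i)"
  shows "T K L (\<lambda>x. \<Sum>i\<in>I. c i * f i x) = (\<Sum>i\<in>I. c i * T K L (f i))"
  using f
proof (induction I rule: infinite_finite_induct)
  case (insert i I)
  have "test_fun (\<lambda>x. \<Sum>i\<in>I. c i * f i x)"
    using insert by (intro test_fun_sum test_fun_mult smooth_const) auto
  then have "T K L (\<lambda>x. c i * f i x + 1 * (\<Sum>i\<in>I. c i * f i x)) =
      c i * T K L (f i) + 1 * T K L (\<lambda>x. \<Sum>i\<in>I. c i * f i x)"
    using T insert.prems unfolding linear_on_tests_def by blast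
  with insert show ?case by simp
qed (simp_all add: linear_on_tests_zero[OF T])

lemma linear_on_tests_wedge_current:
  fixes T :: "'n::{finite,linorder} supercurrent"
  assumes T: "linear_on_tests T" and \<alpha>: "\<And>K L. smooth (\<alpha> K L)"
  shows "linear_on_tests (wedge_current T \<alpha>)"
  unfolding linear_on_tests_def
proof (intro allI impI)
  fix M N and \<phi> \<psi> :: "real^'n::{finite,linorder} \<Rightarrow> real" and a b
  assume t: "test_fun \<phi>" "test_fun \<psi>"
  have "T K L (\<lambda>x. \<alpha> K' L' x * (a * \<phi> x + b * \<psi> x)) =
     a * T K L (\<lambda>x. \<alpha> K' L' x * \<phi> x) + b * T K L (\<lambda>x. \<alpha> K' L' x * \<psi> x)" for K L K' L'
  proof -
    have "T K L (\<lambda>x. a * (\<alpha> K' L' x * \<phi> x) + b * (\<alpha> K' L' x * \<psi> x)) =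
      a * T K L (\<lambda>x. \<alpha> K' L' x * \<phi> x) + b * T K L (\<lambda>x. \<alpha> K' L' x * \<psi> x)"
      using T test_fun_mult[OF t(1) \<alpha>] test_fun_mult[OF t(2) \<alpha>] unfolding linear_on_tests_def by blast
    then show ?thesis by (simp add: algebra_simps)
  qed
  then show "wedge_current T \<alpha> M N (\<lambda>x. a * \<phi> x + b * \<psi> x) =
      a * wedge_current T \<alpha> M N \<phi> + b * wedge_current T \<alpha> M N \<psi>"
    by (simp add: wedge_current_def sum_distrib_left sum.distrib[symmetric] algebra_simps)
qed

lemma wedge_current_wedge:
  assumes "linear_on_tests T" "\<And>K L. smooth (\<alpha> K L)" "\<And>K L. smooth (\<gamma> K L)" "test_fun \<phi>"
  shows "wedge_current (wedge_current T \<alpha>) \<gamma> M N \<phi> = wedge_current T (wedge \<alpha> \<gamma>) M N \<phi>"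
  by (rule wedge_current_assoc[where X = "Collect test_fun"])
    (use assms in \<open>auto intro!: linear_on_tests_sum test_fun_mult\<close>)

lemma wedge_current_lincomb:
  assumes T: "linear_on_tests T" and \<alpha>: "\<And>K L. smooth (\<alpha> K L)" and \<gamma>: "\<And>K L. smooth (\<gamma> K L)"
    and c: "smooth c" and \<phi>: "test_fun \<phi>"
  shows "wedge_current T (\<lambda>K L x. \<alpha> K L x + c x * \<gamma> K L x) M N \<phi> =
     wedge_current T \<alpha> M N \<phi> + wedge_current T \<gamma> M N (\<lambda>x. c x * \<phi> x)"
proof -
  have "T K L (\<lambda>x. (\<alpha> K' L' x + c x * \<gamma> K' L' x) * \<phi> x) =
     T K L (\<lambda>x. \<alpha> K' L' x * \<phi> x) + T K L (\<lambda>x. \<gamma> K' L' x * (c x * \<phi> x))" for K L K' L'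
  proof -
    have "test_fun (\<lambda>x. \<alpha> K' L' x * \<phi> x)" "test_fun (\<lambda>x. \<gamma> K' L' x * (c x * \<phi> x))"
      using \<alpha> \<gamma> c \<phi> by (auto intro!: test_fun_mult)
    then have "T K L (\<lambda>x. 1 * (\<alpha> K' L' x * \<phi> x) + 1 * (\<gamma> K' L' x * (c x * \<phi> x))) =
      1 * T K L (\<lambda>x. \<alpha> K' L' x * \<phi> x) + 1 * T K L (\<lambda>x. \<gamma> K' L' x * (c x * \<phi> x))"
      using T unfolding linear_on_tests_def by blast
    then show ?thesis by (simp add: algebra_simps)
  qed
  then show ?thesis
    by (simp add: wedge_current_def sum.distrib[symmetric] algebra_simps)
qed

lemma wedge_current_one:
  assumes T: "linear_on_tests T"
  shows "wedge_current T (function_form (\<lambda>x. 1)) M N \<phi> = T M N \<phi>"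
proof -
  have iff: "M - K = {} \<and> N - L = {} \<longleftrightarrow> K = M \<and> L = N" if "K \<in> Pow M" "L \<in> Pow N" for K L
    using that by blast
  have "wedge_current T (function_form (\<lambda>x. 1)) M N \<phi> =
    (\<Sum>K\<in>Pow M. \<Sum>L\<in>Pow N. if K = M \<and> L = N then T M N \<phi> else 0)"
    unfolding wedge_current_def
    by (intro sum.cong refl) (auto simp: function_form_def iff linear_on_tests_zero[OF T])
  also have "\<dots> = (\<Sum>K\<in>Pow M. if K = M then (\<Sum>L\<in>Pow N. if L = N then T M N \<phi> else 0) else 0)"
    by (intro sum.cong refl) simp
  also have "\<dots> = T M N \<phi>" by (simp add: sum.delta)
  finally show ?thesis .
qed

lemma foldl_wedge_current_replicate:
  assumes T: "linear_on_tests T" and \<alpha>: "\<And>K L. smooth (\<alpha> K L)" and \<phi>: "test_fun \<phi>"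
  shows "foldl wedge_current T (replicate k \<alpha>) M N \<phi> = wedge_current T (form_power \<alpha> k) M N \<phi>"
  using \<phi>
proof (induction k arbitrary: M N \<phi>)
  case 0
  then show ?case by (simp add: wedge_current_one[OF T])
next
  case (Suc k)
  have "foldl wedge_current T (replicate (Suc k) \<alpha>) M N \<phi> =
      wedge_current (foldl wedge_current T (replicate k \<alpha>)) \<alpha> M N \<phi>"
    by (simp only: replicate.simps replicate_append_same[symmetric] foldl_append foldl.simps)
  also have "\<dots> = wedge_current (wedge_current T (form_power \<alpha> k)) \<alpha> M N \<phi>"
    unfolding wedge_current_def[of _ \<alpha>]
    by (intro sum.cong refl arg_cong2[where f = "(*)"] Suc.IH test_fun_mult Suc.prems \<alpha>)
  also have "\<dots> = wedge_current T (form_power \<alpha> (Suc k)) M N \<phi>"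
    using T \<alpha> Suc.prems by (simp add: wedge_current_wedge smooth_form_power)
  finally show ?case .
qed

lemma current_pairing_function:
  fixes S :: "'n::{finite,linorder} supercurrent"
  assumes "\<And>K L. S K L (\<lambda>x. 0) = 0"
  shows "current_pairing S (function_form \<phi>) = vol_sign TYPE('n) * S UNIV UNIV \<phi>"
proof -
  have iff: "- K = {} \<and> - L = {} \<longleftrightarrow> K = UNIV \<and> L = UNIV" for K L :: "'n set" by auto
  have "(\<Sum>K\<in>UNIV. \<Sum>L\<in>UNIV. wedge_sign K L (- K) (- L) * S K L (function_form \<phi> (- K) (- L))) =
    (\<Sum>(K :: 'n set)\<in>UNIV. \<Sum>(L :: 'n set)\<in>UNIV.
       if K = UNIV then (if L = UNIV then S UNIV UNIV \<phi> else 0) else 0)"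
    by (intro sum.cong refl) (auto simp: function_form_def assms iff)
  also have "\<dots> = (\<Sum>K\<in>UNIV. if K = (UNIV :: 'n set) then S UNIV UNIV \<phi> else 0)"
    by (intro sum.cong refl) simp
  also have "\<dots> = S UNIV UNIV \<phi>" by simp
  finally show ?thesis by (simp add: current_pairing_def)
qed

text \<open>The coefficient of \<open>S \<and> dd\<^sup># \<phi>\<close>: the two derivatives are moved to \<open>\<phi>\<close>, and the signs of \<open>d\<close> and \<open>d\<^sup>#\<close>
  together are those of wedging with \<open>dx\<^sub>i \<and> d\<xi>\<^sub>j\<close>.\<close>

lemma d_d_sharp_top_coefficient:
  fixes S :: "'n::{finite,linorder} supercurrent"
  shows "d_current (d_sharp_current S) UNIV UNIV \<phi> = (\<Sum>i\<in>UNIV. \<Sum>j\<in>UNIV.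
    wedge_sign (UNIV - {i}) (UNIV - {j}) {i} {j} * S (UNIV - {i}) (UNIV - {j}) (pdiff j (pdiff i \<phi>)))"
proof -
  have sign: "wedge_sign {i} {} (UNIV - {i}) UNIV * wedge_sign {} {j} (UNIV - {i}) (UNIV - {j})
    = wedge_sign (UNIV - {i}) (UNIV - {j}) {i} {j}" for i j :: 'n
  proof -
    let ?m = "\<lambda>k :: 'n. merge_sign {k} (UNIV - {k})" and ?m' = "\<lambda>k :: 'n. merge_sign (UNIV - {k}) {k}"
    have c: "card (UNIV - {k}) = CARD('n) - 1" for k :: 'n by (simp add: card_Diff_subset)
    have eq: "?m k = (- 1) ^ (CARD('n) - 1) * ?m' k" for k
    proof -
      have "?m k = ?m k * (?m' k * ?m' k)" by simp
      also have "\<dots> = (?m k * ?m' k) * ?m' k" by (simp only: mult.assoc)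
      also have "?m k * ?m' k = (- 1) ^ (CARD('n) - 1)"
        by (subst merge_sign_swap) (simp_all add: c)
      finally show ?thesis .
    qed
    have s: "(- 1) ^ (CARD('n) - 1) * ((- 1) ^ (CARD('n) - 1) * z) = (z::real)" for z
      by (simp add: mult.assoc[symmetric] power_mult_distrib[symmetric])
    show ?thesis
      unfolding wedge_sign_def by (simp add: c) (simp add: eq[of i] eq[of j] mult_ac s)
  qed
  show ?thesis
    unfolding d_current_def d_sharp_current_def
    by (simp add: sum_negf sum_distrib_left mult.assoc[symmetric] sign)
qed

section \<open>Monotonicity of radial masses\<close>

lemma radial_test_fun:
  assumes "\<And>k. ck_real k h" "\<And>t. t \<ge> R \<Longrightarrow> h t = 0"
  shows "test_fun (\<lambda>x. h (half_sqdist a x))"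
proof (rule test_funI[of _ "cball a (sqrt (2 * \<bar>R\<bar>))"])
  show "smooth (\<lambda>x. h (half_sqdist a x))"
    by (rule smooth_compose_real[OF assms(1) smooth_half_sqdist])
  fix x assume "h (half_sqdist a x) \<noteq> 0"
  then have "half_sqdist a x < R" using assms(2)[of "half_sqdist a x"] by linarith
  then have "(norm (x - a))\<^sup>2 \<le> 2 * \<bar>R\<bar>" by (simp add: half_sqdist_eq)
  then show "x \<in> cball a (sqrt (2 * \<bar>R\<bar>))"
    by (simp add: dist_norm norm_minus_commute real_le_rsqrt)
qed simp

lemma half_sqdist_less_iff: "0 < r \<Longrightarrow> half_sqdist a x < r\<^sup>2 / 2 \<longleftrightarrow> x \<in> ball a r"
  using power_less_imp_less_base[of "norm (x - a)" 2 r] power_strict_mono[of "norm (x - a)" r 2]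
  by (auto simp: half_sqdist_eq dist_norm norm_minus_commute)

text \<open>The two inequalities that the geometry provides: \<open>u\<close> is the trace measure \<open>T \<and> \<beta>\<^sup>p\<close>, and \<open>B\<close> is its
  radial part \<open>S \<and> \<omega>\<close>.\<close>

locale radial_inequalities = positive_functional u
  for u :: "(real^'n::finite \<Rightarrow> real) \<Rightarrow> real" +
  fixes B :: "(real^'n \<Rightarrow> real) \<Rightarrow> real" and a :: "real^'n" and \<kappa> :: real
  assumes kappa: "0 < \<kappa>"
    and hessian: "\<lbrakk>\<And>k. ck_real k g; \<And>k. ck_real k g'; \<And>k. ck_real k g'';
        \<And>t. (g has_real_derivative g' t) (at t); \<And>t. (g' has_real_derivative g'' t) (at t);
        \<And>t. 0 \<le> g t; \<And>t. t \<ge> R \<Longrightarrow> g t = 0; \<And>t. t \<ge> R \<Longrightarrow> g' t = 0; \<And>t. t \<ge> R \<Longrightarrow> g'' t = 0\<rbrakk> \<Longrightarrow>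
        0 \<le> u (\<lambda>x. g' (half_sqdist a x)) + B (\<lambda>x. g'' (half_sqdist a x))"
    and radial_part: "\<lbrakk>test_fun \<psi>; \<And>x. 0 \<le> \<psi> x\<rbrakk> \<Longrightarrow> \<kappa> * B \<psi> \<le> u (\<lambda>x. half_sqdist a x * \<psi> x)"
begin

text \<open>Convexity applied to an antiderivative \<open>g\<close> of \<open>- h\<close> gives \<open>u(h(s)) \<le> B(- h'(s))\<close>, and
  \<open>- h' \<ge> 0\<close> allows the bound on the radial part.\<close>

lemma decreasing_profile:
  assumes h: "\<And>k. ck_real k h" "\<And>k. ck_real k h'" "\<And>t. (h has_real_derivative h' t) (at t)"
    "\<And>t. h' t \<le> 0" "\<And>t. t \<ge> R \<Longrightarrow> h t = 0" "\<And>t. t \<ge> R \<Longrightarrow> h' t = 0"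
  shows "\<kappa> * u (\<lambda>x. h (half_sqdist a x)) + u (\<lambda>x. half_sqdist a x * h' (half_sqdist a x)) \<le> 0"
proof -
  have h_nonneg: "0 \<le> h t" for t
  proof (cases "t \<le> R")
    case True
    have "h R \<le> h t" by (rule DERIV_nonpos_imp_nonincreasing[OF True]) (use h in blast)
    then show ?thesis using h by simp
  qed (use h in simp)
  obtain F where F: "\<And>t. (F has_real_derivative h t) (at t)"
    using continuous_has_antiderivative[OF ck_real_continuous[OF h(1)]] by blast
  define g where "g t = F R - F t" for t
  have dg: "(g has_real_derivative - 1 * h t) (at t)" for t
    unfolding g_def by (auto intro!: derivative_eq_intros F)
  have dh: "((\<lambda>t. - 1 * h t) has_real_derivative - 1 * h' t) (at t)" for t
    by (rule DERIV_cmult[OF h(3)])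
  have ckh: "ck_real k (\<lambda>t. - 1 * h t)" "ck_real k (\<lambda>t. - 1 * h' t)" for k
    by (intro ck_real_mult ck_real_const h)+
  have ckg: "ck_real k g" for k
  proof (rule ck_real_Suc_imp)
    show "ck_real (Suc k) g"
      unfolding ck_real.simps using dg ckh(1) by (intro exI[of _ "\<lambda>t. - 1 * h t"]) auto
  qed
  have g0: "g t = 0" if "t \<ge> R" for t
  proof -
    have "F R \<le> F t"
      by (rule DERIV_nonneg_imp_nondecreasing[OF that]) (use F h_nonneg in blast)
    moreover have "F t \<le> F R"
      by (rule DERIV_nonpos_imp_nonincreasing[OF that]) (use F h(5) in fastforce)
    ultimately show ?thesis by (simp add: g_def)
  qed
  have g_nonneg: "0 \<le> g t" for t
  proof (cases "t \<le> R")
    case True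
    have "F t \<le> F R"
      by (rule DERIV_nonneg_imp_nondecreasing[OF True]) (use F h_nonneg in blast)
    then show ?thesis by (simp add: g_def)
  qed (use g0 in simp)
  let ?s = "half_sqdist a"
  have th: "test_fun (\<lambda>x. h (?s x))" by (rule radial_test_fun[OF h(1,5)])
  have th': "test_fun (\<lambda>x. - 1 * h' (?s x))"
    by (rule radial_test_fun[OF ckh(2), of R]) (simp add: h)
  have "0 \<le> u (\<lambda>x. - 1 * h (?s x)) + B (\<lambda>x. - 1 * h' (?s x))"
    by (rule hessian[where R = R, OF ckg ckh dg dh g_nonneg g0]) (simp_all add: h)
  then have "\<kappa> * u (\<lambda>x. h (?s x)) \<le> \<kappa> * B (\<lambda>x. - 1 * h' (?s x))"
    using kappa scale[OF th, of "- 1"] by simp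
  also have "\<dots> \<le> u (\<lambda>x. ?s x * (- 1 * h' (?s x)))"
    by (rule radial_part[OF th']) (simp add: h)
  also have "(\<lambda>x. ?s x * (- 1 * h' (?s x))) = (\<lambda>x. - 1 * (?s x * h' (?s x)))" by auto
  also have "u (\<lambda>x. - 1 * (?s x * h' (?s x))) = - 1 * u (\<lambda>x. ?s x * h' (?s x))"
    by (intro scale test_fun_mult radial_test_fun[OF h(2,6)] smooth_half_sqdist)
  finally show ?thesis by simp
qed

text \<open>Instead of differentiating \<open>t \<mapsto> t\<^bsup>-\<kappa>\<^esup> u(h(s/t))\<close>, the inequality for a single profile is applied to the
  average \<open>H\<close> of the profiles \<open>h(s/t)\<close> over \<open>t1 \<le> t \<le> t2\<close> with weight \<open>t\<^bsup>-\<kappa>-1\<^esup>\<close>.  For it \<open>\<kappa> H + s H'\<close> is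
  the integral of \<open>- d/dt (t\<^bsup>-\<kappa>\<^esup> h(s/t))\<close>, so no derivative has to be exchanged with \<open>u\<close>.\<close>

lemma scaled_profile_monotone:
  assumes h: "\<And>k. ck_real k h" "\<And>k. ck_real k h'" "\<And>t. (h has_real_derivative h' t) (at t)"
    "\<And>t. h' t \<le> 0" "\<And>t. t \<ge> 1 \<Longrightarrow> h t = 0" "\<And>t. t \<ge> 1 \<Longrightarrow> h' t = 0"
    and t: "0 < t1" "t1 \<le> t2"
  shows "t1 powr (- \<kappa>) * u (\<lambda>x. h (half_sqdist a x / t1)) \<le> t2 powr (- \<kappa>) * u (\<lambda>x. h (half_sqdist a x / t2))"
proof -
  define e where "e = - \<kappa> - 1"
  define H where "H s = integral {t1..t2} (\<lambda>t. t powr e * h (s / t))" for s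
  define H' where "H' s = integral {t1..t2} (\<lambda>t. t powr (e - 1) * h' (s / t))" for s
  have ckH: "ck_real k H" "ck_real k H'" for k
    unfolding H_def[abs_def] H'_def[abs_def] by (intro ck_real_scale_integral h t)+
  have dH: "(H has_real_derivative H' s) (at s)" for s
    unfolding H_def H'_def
    by (rule scale_integral_has_derivative[OF h(3) ck_real_continuous[OF h(2)] t(1)])
  have int: "(\<lambda>t. t powr d * f (s / t)) integrable_on {t1..t2}" if "continuous_on UNIV f" for d f s
    using t(1) by (intro integrable_continuous_real continuous_intros continuous_on_compose2[OF that]) auto
  have ch: "continuous_on UNIV h" "continuous_on UNIV h'" using ck_real_continuous h by blast+
  have H'_nonpos: "H' s \<le> 0" for s
  proof -
    have "H' s \<le> integral {t1..t2} (\<lambda>t. 0)"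
      unfolding H'_def using h(4) by (intro integral_le int ch integrable_0) (auto intro: mult_nonneg_nonpos)
    then show ?thesis by simp
  qed
  have H_zero: "H s = 0" "H' s = 0" if "s \<ge> t2" for s
  proof -
    have one: "s / t \<ge> 1" if "t \<in> {t1..t2}" for t using that \<open>s \<ge> t2\<close> t by simp
    have "h (s / t) = 0" "h' (s / t) = 0" if "t \<in> {t1..t2}" for t
      using h(5,6)[OF one[OF that]] by simp_all
    then have "H s = integral {t1..t2} (\<lambda>t. 0)" "H' s = integral {t1..t2} (\<lambda>t. 0)"
      unfolding H_def H'_def by (intro integral_cong; simp)+
    then show "H s = 0" "H' s = 0" by simp_all
  qed
  have id: "\<kappa> * H s + s * H' s = t1 powr (- \<kappa>) * h (s / t1) - t2 powr (- \<kappa>) * h (s / t2)" for s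
  proof -
    have "((\<lambda>t. - (\<kappa> * (t powr e * h (s / t)) + s * (t powr (e - 1) * h' (s / t)))) has_integral
        t2 powr (- \<kappa>) * h (s / t2) - t1 powr (- \<kappa>) * h (s / t1)) {t1..t2}"
    proof (rule fundamental_theorem_of_calculus[OF t(2)])
      fix y assume "y \<in> {t1..t2}"
      then have y: "y > 0" using t by simp
      have 1: "((\<lambda>t. s / t) has_real_derivative - (s / y\<^sup>2)) (at y)"
        using y by (auto intro!: derivative_eq_intros simp: power2_eq_square)
      have 2: "((\<lambda>t. t powr (- \<kappa>)) has_real_derivative (- \<kappa>) * y powr (- \<kappa> - 1)) (at y)"
        using y by (rule has_real_derivative_powr)
      have "((\<lambda>t. t powr (- \<kappa>) * h (s / t)) has_real_derivative
         (- \<kappa>) * y powr (- \<kappa> - 1) * h (s / y) + h' (s / y) * - (s / y\<^sup>2) * y powr (- \<kappa>)) (at y)"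
        by (rule DERIV_mult[OF 2 DERIV_chain2[OF h(3) 1]])
      moreover have "y powr (e - 1) = y powr (- \<kappa>) / y\<^sup>2"
      proof -
        have "e - 1 = - \<kappa> - 2" by (simp add: e_def)
        then have "y powr (e - 1) = y powr (- \<kappa>) / y powr 2" by (simp only: powr_diff)
        then show ?thesis using y by simp
      qed
      ultimately have "((\<lambda>t. t powr (- \<kappa>) * h (s / t)) has_real_derivative
         - (\<kappa> * (y powr e * h (s / y)) + s * (y powr (e - 1) * h' (s / y)))) (at y)"
        by (simp add: e_def algebra_simps)
      then show "((\<lambda>t. t powr (- \<kappa>) * h (s / t)) has_vector_derivative
         - (\<kappa> * (y powr e * h (s / y)) + s * (y powr (e - 1) * h' (s / y)))) (at y within {t1..t2})"
        by (simp add: has_real_derivative_iff_has_vector_derivative has_vector_derivative_at_within)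
    qed
    from has_integral_neg[OF this]
    have "((\<lambda>t. \<kappa> * (t powr e * h (s / t)) + s * (t powr (e - 1) * h' (s / t))) has_integral
        t1 powr (- \<kappa>) * h (s / t1) - t2 powr (- \<kappa>) * h (s / t2)) {t1..t2}"
      by (simp add: add.commute)
    then have "integral {t1..t2} (\<lambda>t. \<kappa> * (t powr e * h (s / t)) + s * (t powr (e - 1) * h' (s / t))) =
        t1 powr (- \<kappa>) * h (s / t1) - t2 powr (- \<kappa>) * h (s / t2)"
      by (rule integral_unique)
    moreover have "integral {t1..t2} (\<lambda>t. \<kappa> * (t powr e * h (s / t)) + s * (t powr (e - 1) * h' (s / t)))
       = \<kappa> * H s + s * H' s"
      unfolding H_def H'_def
      by (subst integral_add) (auto intro!: integrable_on_mult_right int ch)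
    ultimately show ?thesis by simp
  qed
  let ?s = "half_sqdist a"
  let ?h = "\<lambda>t x. h (?s x / t)"
  have th: "test_fun (?h t)" if "t > 0" for t
  proof -
    have "test_fun (\<lambda>x. h ((1 / t) * ?s x + 0))"
      using that by (intro radial_test_fun[of "\<lambda>y. h ((1 / t) * y + 0)" t] ck_real_affine h) simp_all
    then show ?thesis by simp
  qed
  have tH: "test_fun (\<lambda>x. H (?s x))" "test_fun (\<lambda>x. H' (?s x))"
    by (rule radial_test_fun[OF ckH(1), of t2], rule H_zero, assumption)
      (rule radial_test_fun[OF ckH(2), of t2], rule H_zero)
  have "\<kappa> * u (\<lambda>x. H (?s x)) + u (\<lambda>x. ?s x * H' (?s x)) \<le> 0"
    by (rule decreasing_profile[OF ckH dH H'_nonpos H_zero])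
  also have "\<kappa> * u (\<lambda>x. H (?s x)) + u (\<lambda>x. ?s x * H' (?s x)) = u (\<lambda>x. \<kappa> * H (?s x) + ?s x * H' (?s x))"
    using linear[OF tH(1) test_fun_mult[OF tH(2) smooth_half_sqdist[of a]], of \<kappa> 1] by simp
  also have "\<dots> = u (\<lambda>x. t1 powr (- \<kappa>) * ?h t1 x + (- (t2 powr (- \<kappa>))) * ?h t2 x)"
    unfolding id by simp
  also have "\<dots> = t1 powr (- \<kappa>) * u (?h t1) + (- (t2 powr (- \<kappa>))) * u (?h t2)"
    using t by (intro linear th) auto
  finally show ?thesis by simp
qed

text \<open>The profile \<open>h\<close> is \<open>1\<close> up to \<open>c\<close> and \<open>0\<close> from \<open>1\<close> on.  At scale \<open>r\<^sup>2 / (2 c)\<close> it lies above the indicator function of the smaller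
  ball, at scale \<open>r'\<^sup>2 / 2\<close> below that of the larger one.\<close>

lemma mass_ratio_scaled:
  assumes r: "0 < r" "0 < r'" and c: "0 < c" "c < 1" "r\<^sup>2 \<le> c * r'\<^sup>2"
  shows "(r\<^sup>2 / (2 * c)) powr (- \<kappa>) * measure representing_measure (ball a r) \<le>
    (r'\<^sup>2 / 2) powr (- \<kappa>) * measure representing_measure (ball a r')"
proof -
  let ?M = representing_measure
  let ?s = "half_sqdist a"
  obtain f f' :: "real \<Rightarrow> real" where f: "\<And>k. ck_real k f" "\<And>k. ck_real k f'"
    "\<And>t. (f has_real_derivative f' t) (at t)" "\<And>t. f' t \<ge> 0"
    "\<And>t. t \<le> 0 \<Longrightarrow> f t = 0" "\<And>t. t \<ge> 1 \<Longrightarrow> f t = 1" "\<And>t. 0 \<le> f t" "\<And>t. f t \<le> 1"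
    using smooth_step_exists by metis
  have f'0: "f' t = 0" if "t \<le> 0" for t
  proof (rule DERIV_local_min[OF f(3), of 1])
    show "\<forall>y. \<bar>t - y\<bar> < 1 \<longrightarrow> f t \<le> f y" using that f(5,7) by simp
  qed simp
  define b where "b = 1 / (1 - c)"
  have b: "b > 0" using c by (simp add: b_def)
  define h where "h t = f ((- b) * t + b)" for t
  define h' where "h' t = (- b) * f' ((- b) * t + b)" for t
  have h: "ck_real k h" "ck_real k h'" for k
    unfolding h_def[abs_def] h'_def[abs_def] by (intro ck_real_mult ck_real_const ck_real_affine f)+
  have dh: "(h has_real_derivative h' t) (at t)" for t
  proof -
    have 1: "((\<lambda>t. (- b) * t + b) has_real_derivative - b) (at t)"
      by (auto intro!: derivative_eq_intros)
    show ?thesis using DERIV_chain2[OF f(3) 1] unfolding h_def h'_def by (simp add: mult.commute)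
  qed
  have h'_nonpos: "h' t \<le> 0" for t using b f(4) by (simp add: h'_def)
  have arg0: "(- b) * t + b \<le> 0" if "t \<ge> 1" for t
    using mult_left_mono[OF that, of b] b by simp
  have h0: "h t = 0" "h' t = 0" if "t \<ge> 1" for t
    using arg0[OF that] f(5) f'0 by (simp_all add: h_def h'_def)
  have h1: "h t = 1" if "t \<le> c" for t
  proof -
    have "b * (1 - c) \<le> b * (1 - t)" using that b by (intro mult_left_mono) auto
    moreover have "b * (1 - c) = 1" using c by (simp add: b_def)
    moreover have "b * (1 - t) = (- b) * t + b" by (simp add: algebra_simps)
    ultimately have "(- b) * t + b \<ge> 1" by linarith
    then show ?thesis by (simp add: h_def f)
  qed
  define t1 where "t1 = r\<^sup>2 / (2 * c)"
  define t2 where "t2 = r'\<^sup>2 / 2"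
  have t: "0 < t1" "t1 \<le> t2" "0 < t2" using r c by (simp_all add: t1_def t2_def field_simps)
  have th: "test_fun (\<lambda>x. h (?s x / t))" if "t > 0" for t
  proof -
    have "test_fun (\<lambda>x. h ((1 / t) * ?s x + 0))"
      using that by (intro radial_test_fun[of "\<lambda>y. h ((1 / t) * y + 0)" t] ck_real_affine h)
        (simp_all add: h0)
    then show ?thesis by simp
  qed
  have ball_int: "integrable ?M (indicator (ball a \<rho>) :: _ \<Rightarrow> real)" for \<rho>
  proof (rule integrable_real_indicator)
    have "emeasure ?M (ball a \<rho>) \<le> emeasure ?M (cball a \<rho>)"
      by (intro emeasure_mono) (auto simp: sets_representing_measure)
    with finite_on_compact[OF compact_cball[of a \<rho>]]
    show "emeasure ?M (ball a \<rho>) < \<infinity>" by (rule order_le_less_trans[rotated])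
  qed (simp add: sets_representing_measure)
  have ball_meas: "(LINT x|?M. indicator (ball a \<rho>) x) = measure ?M (ball a \<rho>)" for \<rho>
    by (simp add: sets_representing_measure)
  have "measure ?M (ball a r) \<le> (LINT x|?M. h (?s x / t1))"
    unfolding ball_meas[symmetric]
  proof (rule integral_mono[OF ball_int integrable[OF th[OF t(1)]]])
    fix x
    have "h (?s x / t1) = 1" if "x \<in> ball a r"
    proof (rule h1)
      have "?s x < r\<^sup>2 / 2" using that half_sqdist_less_iff[OF r(1)] by blast
      then show "?s x / t1 \<le> c" using r c by (simp add: t1_def field_simps)
    qed
    then show "indicator (ball a r) x \<le> h (?s x / t1)"
      by (auto simp: indicator_def h_def f simp del: mem_ball)
  qed
  then have 1: "measure ?M (ball a r) \<le> u (\<lambda>x. h (?s x / t1))"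
    by (simp add: representing_measure_integral[OF th[OF t(1)]])
  have "(LINT x|?M. h (?s x / t2)) \<le> measure ?M (ball a r')"
    unfolding ball_meas[symmetric]
  proof (rule integral_mono[OF integrable[OF th[OF t(3)]] ball_int])
    fix x
    have "h (?s x / t2) = 0" if "x \<notin> ball a r'"
    proof (rule h0)
      have "\<not> ?s x < r'\<^sup>2 / 2" using that half_sqdist_less_iff[OF r(2)] by blast
      then show "1 \<le> ?s x / t2" using t(3) by (simp add: t2_def)
    qed
    moreover have "h (?s x / t2) \<le> 1" by (simp add: h_def f)
    ultimately show "h (?s x / t2) \<le> indicator (ball a r') x"
      by (auto simp: indicator_def simp del: mem_ball)
  qed
  then have 2: "u (\<lambda>x. h (?s x / t2)) \<le> measure ?M (ball a r')"
    by (simp add: representing_measure_integral[OF th[OF t(3)]])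
  have "t1 powr (- \<kappa>) * measure ?M (ball a r) \<le> t1 powr (- \<kappa>) * u (\<lambda>x. h (?s x / t1))"
    by (intro mult_left_mono 1) simp
  also have "\<dots> \<le> t2 powr (- \<kappa>) * u (\<lambda>x. h (?s x / t2))"
    by (rule scaled_profile_monotone[OF h dh h'_nonpos h0 t(1,2)])
  also have "\<dots> \<le> t2 powr (- \<kappa>) * measure ?M (ball a r')"
    by (intro mult_left_mono 2) simp
  finally show ?thesis by (simp add: t1_def t2_def)
qed

text \<open>The previous inequality as \<open>c\<close> tends to \<open>1\<close>.\<close>

lemma mass_ratio_monotone:
  assumes r: "0 < r" "r \<le> r'"
  shows "r powr (- (2 * \<kappa>)) * measure representing_measure (ball a r) \<le>
    r' powr (- (2 * \<kappa>)) * measure representing_measure (ball a r')"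
proof (cases "r = r'")
  case False
  let ?m = "\<lambda>r. measure representing_measure (ball a r)"
  have rr: "r < r'" "0 < r'" using r False by auto
  have sq: "(y\<^sup>2 / 2) powr (- \<kappa>) = 2 powr \<kappa> * y powr (- (2 * \<kappa>))" if "0 < y" for y :: real
  proof -
    have "y\<^sup>2 = y powr 2" using that by simp
    then have "(y\<^sup>2) powr (- \<kappa>) = y powr (- (2 * \<kappa>))" using that by (simp only: powr_powr) simp
    then show ?thesis using that by (simp add: powr_divide powr_minus field_simps)
  qed
  have lim: "((\<lambda>c. (r\<^sup>2 / (2 * c)) powr (- \<kappa>) * ?m r) \<longlongrightarrow> (r\<^sup>2 / (2 * 1)) powr (- \<kappa>) * ?m r) (at_left 1)"
    using r by (intro tendsto_intros) auto
  have "r\<^sup>2 / r'\<^sup>2 < 1" using r rr by (simp add: power_strict_mono)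
  then have "\<forall>\<^sub>F c in at_left 1. c \<in> {r\<^sup>2 / r'\<^sup>2<..<1}"
    by (intro eventually_at_leftI[of "r\<^sup>2 / r'\<^sup>2"]) auto
  then have "\<forall>\<^sub>F c in at_left 1. (r\<^sup>2 / (2 * c)) powr (- \<kappa>) * ?m r \<le> (r'\<^sup>2 / 2) powr (- \<kappa>) * ?m r'"
  proof eventually_elim
    case (elim c)
    then have "r\<^sup>2 \<le> c * r'\<^sup>2" using rr by (simp add: pos_divide_less_eq)
    moreover have "0 < c" using elim le_less_trans[of 0 "r\<^sup>2 / r'\<^sup>2" c] by simp
    ultimately show ?case using elim r rr by (intro mass_ratio_scaled) auto
  qed
  from tendsto_upperbound[OF lim this]
  have "(r\<^sup>2 / 2) powr (- \<kappa>) * ?m r \<le> (r'\<^sup>2 / 2) powr (- \<kappa>) * ?m r'" by simp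
  then show ?thesis using r rr by (simp add: sq)
qed simp

lemma mass_ratio_converges:
  "\<exists>\<nu>::real. ((\<lambda>r. r powr (- (2 * \<kappa>)) * measure representing_measure (ball a r)) \<longlongrightarrow> \<nu>) (at_right 0)"
proof -
  let ?f = "\<lambda>r. r powr (- (2 * \<kappa>)) * measure representing_measure (ball a r)"
  define l where "l = Inf (?f ` {0<..})"
  have bdd: "bdd_below (?f ` {0<..})" by (rule bdd_belowI2[of _ 0]) simp
  have "(?f \<longlongrightarrow> l) (at_right 0)"
  proof (rule decreasing_tendsto)
    show "\<forall>\<^sub>F r in at_right 0. l \<le> ?f r"
      using eventually_at_right_less[of "0::real"]
      by eventually_elim (auto simp: l_def intro!: cInf_lower bdd)
    fix y assume "l < y"
    then obtain r where r: "r > 0" "?f r < y"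
      unfolding l_def using cInf_less_iff[OF _ bdd] by auto
    have "\<forall>\<^sub>F r' in at_right 0. r' \<in> {0<..<r}"
      using r by (intro eventually_at_rightI[of 0 r]) auto
    then show "\<forall>\<^sub>F r' in at_right 0. ?f r' < y"
    proof eventually_elim
      case (elim r')
      then have "?f r' \<le> ?f r" by (intro mass_ratio_monotone) auto
      with r show ?case by simp
    qed
  qed
  then show ?thesis by blast
qed

end

section \<open>The two inequalities for currents\<close>

definition offset :: "real^'n::finite \<Rightarrow> 'n \<Rightarrow> real^'n \<Rightarrow> real" where
  "offset a i x = x $ i - a $ i"

lemma smooth_offset: "smooth (offset a i)"
  unfolding offset_def[abs_def] by (intro smooth_diff smooth_coordinate smooth_const)

lemma sum_offset_square: "(\<Sum>i\<in>UNIV. (offset a i x)\<^sup>2) = 2 * half_sqdist a x"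
  by (simp add: half_sqdist_def offset_def power2_eq_square)

lemma smooth_rank_one: "(\<And>i. smooth (v i)) \<Longrightarrow> smooth (rank_one v K L)"
  unfolding rank_one_def by (intro smooth_form11 smooth_mult)

lemma smooth_beta: "smooth (beta K L)"
  unfolding beta_eq_form11 by (intro smooth_form11 smooth_const)

text \<open>The coefficient of \<open>T \<and> \<alpha>\<close> with respect to \<open>dx\<^sub>1 \<and> d\<xi>\<^sub>1 \<and> \<dots> \<and> dx\<^sub>n \<and> d\<xi>\<^sub>n\<close>, as a functional.  The sign
  of that volume form is kept abstract: it is a factor common to all the inequalities.\<close>

definition top_mass :: "'n::{finite,linorder} supercurrent \<Rightarrow> 'n superform \<Rightarrow> (real^'n::{finite,linorder} \<Rightarrow> real) \<Rightarrow> real" where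
  "top_mass T \<alpha> \<phi> = vol_sign TYPE('n) * wedge_current T \<alpha> UNIV UNIV \<phi>"

lemma top_mass_linear:
  assumes "linear_on_tests T" "\<And>K L. smooth (\<alpha> K L)" "test_fun \<phi>" "test_fun \<psi>"
  shows "top_mass T \<alpha> (\<lambda>x. c * \<phi> x + d * \<psi> x) = c * top_mass T \<alpha> \<phi> + d * top_mass T \<alpha> \<psi>"
  using linear_on_tests_wedge_current[OF assms(1,2)] assms(3,4)
  unfolding linear_on_tests_def top_mass_def by (simp add: algebra_simps)

lemma top_mass_scale:
  assumes "linear_on_tests T" "\<And>K L. smooth (\<alpha> K L)" "test_fun \<phi>"
  shows "top_mass T \<alpha> (\<lambda>x. c * \<phi> x) = c * top_mass T \<alpha> \<phi>"
  using top_mass_linear[OF assms assms(3), where c = c and d = 0] by simp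

text \<open>All the \<open>m - n + p\<close> forms in the definition of \<open>m\<close>-positivity are taken equal to \<open>\<beta> - c v \<and> J v\<close>.
  Using one such form and \<open>\<beta>\<close> for the others would lose the factor \<open>m - n + p\<close>, and with it the exponent.\<close>

lemma m_positive_current_rank_one_inequality:
  fixes T :: "'n::{finite,linorder} supercurrent" and v :: "'n \<Rightarrow> real^'n::{finite,linorder} \<Rightarrow> real"
  assumes m: "m \<le> CARD('n)" "p \<le> CARD('n)" "m + p > CARD('n)"
    and pos: "m_positive_current m (CARD('n) - p) T"
    and v: "\<And>i. smooth (v i)" and c: "smooth c" "\<And>x. 0 \<le> c x"
    and bound: "\<And>x. real m * (c x * (\<Sum>i\<in>UNIV. (v i x)\<^sup>2)) \<le> real CARD('n)"
    and \<phi>: "test_fun \<phi>" "\<And>x. 0 \<le> \<phi> x"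
  shows "real (m + p - CARD('n)) * top_mass T (wedge (form_power beta (p - 1)) (rank_one v)) (\<lambda>x. c x * \<phi> x)
     \<le> top_mass T (form_power beta p) \<phi>"
proof -
  let ?n = "CARD('n)"
  define k where "k = m - (?n - p) - 1"
  have k: "m - (?n - p) = Suc k" "m + p - ?n = Suc k" "(?n - m) + Suc k = p" "(?n - m) + k = p - 1"
    using m by (simp_all add: k_def)
  define \<alpha> :: "'n superform" where "\<alpha> = (\<lambda>K L x. beta K L x + (- 1 * c x) * rank_one v K L x)"
  let ?W = "wedge (form_power beta (p - 1)) (rank_one v) :: 'n superform"
  have lin: "linear_on_tests T"
    using pos supercurrent_linear unfolding m_positive_current_def by blast
  have sb: "smooth (form_power beta j K L)" for j and K L :: "'n set" by (rule smooth_form_power_beta)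
  have s\<alpha>: "smooth (\<alpha> K L)" for K L
    unfolding \<alpha>_def by (intro smooth_add smooth_mult smooth_beta smooth_rank_one smooth_const v c)
  have sW: "smooth (?W K L)" for K L by (intro smooth_wedge sb smooth_rank_one v)
  have "m_positive_form m \<alpha>"
    unfolding \<alpha>_def by (rule m_positive_beta_minus_rank_one[OF m(1) v c bound])
  moreover have "nonneg_top_current (foldl wedge_current (wedge_current T (form_power beta (?n - m))) \<alpha>s)"
    if "length \<alpha>s = m - (?n - p)" "\<forall>\<alpha>\<in>set \<alpha>s. m_positive_form m \<alpha>" for \<alpha>s
    using pos that unfolding m_positive_current_def by blast
  ultimately have "nonneg_top_current
     (foldl wedge_current (wedge_current T (form_power beta (?n - m))) (replicate (Suc k) \<alpha>))"
    using k(1) by (metis in_set_replicate length_replicate)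
  then have ge: "0 \<le> current_pairing
     (foldl wedge_current (wedge_current T (form_power beta (?n - m))) (replicate (Suc k) \<alpha>)) (function_form \<phi>)"
    using \<phi> unfolding nonneg_top_current_def by blast
  let ?T' = "wedge_current T (form_power beta (?n - m))"
  have lin': "linear_on_tests ?T'" by (rule linear_on_tests_wedge_current[OF lin sb])
  have fold: "foldl wedge_current ?T' (replicate (Suc k) \<alpha>) M N \<psi> =
      wedge_current T (wedge (form_power beta (?n - m)) (form_power \<alpha> (Suc k))) M N \<psi>"
    if "test_fun \<psi>" for M N \<psi>
    using foldl_wedge_current_replicate[OF lin' s\<alpha> that, where k = "Suc k"]
      wedge_current_wedge[OF lin sb smooth_form_power[OF s\<alpha>] that] by (simp only:)
  have "wedge_current T (wedge (form_power beta (?n - m)) (form_power \<alpha> (Suc k))) M N (\<lambda>x. 0) = 0" for M N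
    by (rule linear_on_tests_zero[OF linear_on_tests_wedge_current[OF lin smooth_wedge[OF sb smooth_form_power[OF s\<alpha>]]]])
  then have zero: "foldl wedge_current ?T' (replicate (Suc k) \<alpha>) M N (\<lambda>x. 0) = 0" for M N
    using fold[OF test_fun_zero] by simp
  have wb: "wedge (form_power beta (?n - m)) (wedge (form_power beta k) (rank_one v)) = ?W"
    by (simp add: wedge_assoc[symmetric] form_power_add k(4))
  have expand: "wedge (form_power beta (?n - m)) (form_power \<alpha> (Suc k)) =
      (\<lambda>K L x. form_power beta p K L x + (real (Suc k) * (- 1 * c x)) * ?W K L x)"
    unfolding \<alpha>_def power_beta_plus_rank_one[of "\<lambda>x. - 1 * c x"] wedge_lincomb_right wb form_power_add k(3) ..
  have sc: "smooth (\<lambda>x. real (Suc k) * (- 1 * c x))" by (intro smooth_mult smooth_const c)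
  have "0 \<le> vol_sign TYPE('n) *
      wedge_current T (\<lambda>K L x. form_power beta p K L x + (real (Suc k) * (- 1 * c x)) * ?W K L x) UNIV UNIV \<phi>"
    using ge by (simp only: current_pairing_function zero fold[OF \<phi>(1)] expand)
  also have "\<dots> = top_mass T (form_power beta p) \<phi> + top_mass T ?W (\<lambda>x. (real (Suc k) * (- 1 * c x)) * \<phi> x)"
    unfolding top_mass_def
    by (simp only: wedge_current_lincomb[OF lin sb sW sc \<phi>(1)] distrib_left)
  also have "(\<lambda>x. (real (Suc k) * (- 1 * c x)) * \<phi> x) = (\<lambda>x. (- real (Suc k)) * (c x * \<phi> x))"
    by (rule ext) (simp add: algebra_simps)
  also have "top_mass T ?W (\<lambda>x. (- real (Suc k)) * (c x * \<phi> x)) = (- real (Suc k)) * top_mass T ?W (\<lambda>x. c x * \<phi> x)"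
    by (rule top_mass_scale[OF lin sW test_fun_mult[OF \<phi>(1) c(1)]])
  finally show ?thesis unfolding k(2) by (simp only: mult_minus_left)
qed

lemma pdiff_radial:
  assumes g: "\<And>t. (g has_real_derivative g' t) (at t)" "\<And>t. (g' has_real_derivative g'' t) (at t)"
  shows "pdiff j (pdiff i (\<lambda>x. g (half_sqdist a x))) = (\<lambda>x. (if i = j then 1 else 0) * g' (half_sqdist a x)
     + (offset a i x * offset a j x) * g'' (half_sqdist a x))"
proof -
  have s: "half_sqdist a differentiable_on UNIV"
    by (rule smooth_differentiable[OF smooth_half_sqdist])
  have o: "(\<lambda>x. x $ i - a $ i) differentiable_on UNIV"
    using smooth_differentiable[OF smooth_offset[of a i]] by (simp add: offset_def[abs_def])
  have po: "pdiff j (\<lambda>x. x $ i - a $ i) = (\<lambda>x. if i = j then 1 else 0)"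
    using pdiff_add[OF differentiable_coordinate differentiable_on_const[of "- a $ i"], of j i]
    by (simp add: pdiff_coordinate pdiff_eq[OF has_derivative_const] eq_commute)
  have "pdiff i (\<lambda>x. g (half_sqdist a x)) = (\<lambda>x. g' (half_sqdist a x) * (x $ i - a $ i))"
    by (simp only: pdiff_compose_real(1)[OF g(1) s] pdiff_half_sqdist)
  moreover have "pdiff j (\<lambda>x. g' (half_sqdist a x) * (x $ i - a $ i)) =
     (\<lambda>x. g' (half_sqdist a x) * (if i = j then 1 else 0)
       + (g'' (half_sqdist a x) * (x $ j - a $ j)) * (x $ i - a $ i))"
    by (simp only: pdiff_mult[OF pdiff_compose_real(2)[OF g(2) s] o] pdiff_compose_real(1)[OF g(2) s]
        pdiff_half_sqdist po)
  ultimately show ?thesis by (simp add: offset_def mult_ac)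
qed

text \<open>The convexity of \<open>T \<and> \<beta>\<^bsup>p-1\<^esup>\<close> is tested on \<open>g(s)\<close>, whose Hessian is
  \<open>g'(s) \<delta>\<^sub>i\<^sub>j + g''(s) (x\<^sub>i - a\<^sub>i) (x\<^sub>j - a\<^sub>j)\<close>.\<close>

lemma convex_current_radial_inequality:
  fixes T :: "'n::{finite,linorder} supercurrent" and a :: "real^'n::{finite,linorder}"
  assumes lin: "linear_on_tests T" and p: "1 \<le> p"
    and conv: "convex_current (CARD('n) - 1) (wedge_current T (form_power beta (p - 1)))"
    and ck: "\<And>k. ck_real k g" "\<And>k. ck_real k g'" "\<And>k. ck_real k g''"
    and g: "\<And>t. (g has_real_derivative g' t) (at t)" "\<And>t. (g' has_real_derivative g'' t) (at t)"
    and nonneg: "\<And>t. 0 \<le> g t"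
    and R: "\<And>t. t \<ge> R \<Longrightarrow> g t = 0" "\<And>t. t \<ge> R \<Longrightarrow> g' t = 0" "\<And>t. t \<ge> R \<Longrightarrow> g'' t = 0"
  shows "0 \<le> top_mass T (form_power beta p) (\<lambda>x. g' (half_sqdist a x)) +
    top_mass T (wedge (form_power beta (p - 1)) (rank_one (offset a))) (\<lambda>x. g'' (half_sqdist a x))"
proof -
  let ?S = "wedge_current T (form_power beta (p - 1))"
  let ?V = "vol_sign TYPE('n)"
  let ?s = "half_sqdist a"
  let ?g = "\<lambda>x. g (?s x)" and ?g1 = "\<lambda>x. g' (?s x)" and ?g2 = "\<lambda>x. g'' (?s x)"
  have sb: "smooth (form_power beta j K L)" for j and K L :: "'n set" by (rule smooth_form_power_beta)
  have linS: "linear_on_tests ?S" by (rule linear_on_tests_wedge_current[OF lin sb])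
  have t1: "test_fun ?g" by (rule radial_test_fun[OF ck(1) R(1)])
  have t2: "test_fun ?g1" by (rule radial_test_fun[OF ck(2) R(2)])
  have t3: "test_fun ?g2" by (rule radial_test_fun[OF ck(3) R(3)])
  note t = t1 t2 t3
  have weak: "weakly_positive_current CARD('n) (d_current (d_sharp_current ?S))"
    using conv unfolding convex_current_def by simp
  have "superform 0 0 (function_form ?g)"
    unfolding superform_def function_form_def using test_fun_smooth[OF t(1)] by auto
  moreover have "compactly_supported_form (function_form ?g)"
    unfolding compactly_supported_form_def function_form_def using t(1) by (auto simp: test_fun_def)
  moreover have "strongly_positive_form 0 (function_form ?g)"
    unfolding strongly_positive_form_def
    by (intro exI[of _ "1::nat"] exI[of _ "\<lambda>_. ?g"] exI[of _ "\<lambda>_. []"])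
      (auto simp: test_fun_smooth[OF t(1)] nonneg function_form_def fun_eq_iff)
  ultimately have "0 \<le> current_pairing (d_current (d_sharp_current ?S)) (function_form ?g)"
    using weak unfolding weakly_positive_current_def by simp
  moreover have "d_current (d_sharp_current ?S) K L (\<lambda>x. 0) = 0" for K L
    using weak supercurrent_linear linear_on_tests_zero unfolding weakly_positive_current_def by blast
  ultimately have ge: "0 \<le> ?V * d_current (d_sharp_current ?S) UNIV UNIV ?g"
    by (simp only: current_pairing_function)
  let ?w = "\<lambda>i j. wedge_sign (UNIV - {i}) (UNIV - {j}) {i} {j} :: real"
  let ?c = "\<lambda>i j. ?S (UNIV - {i}) (UNIV - {j})"
  have split: "?c i j (pdiff j (pdiff i ?g)) =
     ?c i j (\<lambda>x. (if i = j then 1 else 0) * ?g1 x) + ?c i j (\<lambda>x. (offset a i x * offset a j x) * ?g2 x)" for i j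
  proof -
    have "test_fun (\<lambda>x. (if i = j then 1 else 0) * ?g1 x)" by (rule test_fun_mult[OF t2 smooth_const])
    moreover have "test_fun (\<lambda>x. (offset a i x * offset a j x) * ?g2 x)"
      by (rule test_fun_mult[OF t3 smooth_mult[OF smooth_offset smooth_offset]])
    ultimately have "?c i j (\<lambda>x. 1 * ((if i = j then 1 else 0) * ?g1 x) + 1 * ((offset a i x * offset a j x) * ?g2 x)) =
       1 * ?c i j (\<lambda>x. (if i = j then 1 else 0) * ?g1 x) + 1 * ?c i j (\<lambda>x. (offset a i x * offset a j x) * ?g2 x)"
      using linS unfolding linear_on_tests_def by blast
    then show ?thesis unfolding pdiff_radial[OF g] by simp
  qed
  have contract: "wedge_current ?S (form11 b) UNIV UNIV \<phi> =
      (\<Sum>i\<in>UNIV. \<Sum>j\<in>UNIV. ?w i j * ?c i j (\<lambda>x. b i j x * \<phi> x))" for b \<phi>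
    by (rule wedge_current_form11) (rule linear_on_tests_zero[OF linS])
  have "d_current (d_sharp_current ?S) UNIV UNIV ?g = (\<Sum>i\<in>UNIV. \<Sum>j\<in>UNIV. ?w i j *
      (?c i j (\<lambda>x. (if i = j then 1 else 0) * ?g1 x) + ?c i j (\<lambda>x. (offset a i x * offset a j x) * ?g2 x)))"
    unfolding d_d_sharp_top_coefficient split ..
  also have "\<dots> = wedge_current ?S beta UNIV UNIV ?g1 + wedge_current ?S (rank_one (offset a)) UNIV UNIV ?g2"
    unfolding rank_one_def contract
    using contract[of "\<lambda>i j x. if i = j then 1 else 0" ?g1]
    by (simp add: distrib_left sum.distrib beta_eq_form11[symmetric])
  also have "wedge_current ?S beta UNIV UNIV ?g1 = wedge_current T (wedge (form_power beta (p - 1)) beta) UNIV UNIV ?g1"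
    by (rule wedge_current_wedge[OF lin sb smooth_beta t(2)])
  also have "wedge (form_power beta (p - 1)) beta = (form_power beta p :: 'n superform)"
    using p by (cases p) auto
  also have "wedge_current ?S (rank_one (offset a)) UNIV UNIV ?g2 =
      wedge_current T (wedge (form_power beta (p - 1)) (rank_one (offset a))) UNIV UNIV ?g2"
    by (rule wedge_current_wedge[OF lin sb smooth_rank_one[OF smooth_offset] t(3)])
  finally show ?thesis using ge unfolding top_mass_def by (simp add: distrib_left)
qed

section \<open>Existence of the Lelong number\<close>

theorem theorem2:
  fixes T :: "'n::{finite,linorder} supercurrent"
    and a :: "real^'n::{finite,linorder}"
    and m p :: nat
  assumes "1 \<le> m" and "m \<le> CARD('n)" and "p \<le> CARD('n)"
    and "m_positive_current m (CARD('n) - p) T"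
    and "convex_current (CARD('n) - 1) (wedge_current T (form_power beta (p - 1)))"
    and "m + p > CARD('n)"
  shows "\<exists>\<nu>::real.
    ((\<lambda>r. r powr (- (real CARD('n) / real m * (real m - real CARD('n) + real p))) *
          super_integral (ball a r) (wedge_current T (form_power beta p)))
      \<longlongrightarrow> \<nu>) (at_right 0)"
proof -
  let ?n = "CARD('n)"
  let ?s = "half_sqdist a"
  define \<kappa> where "\<kappa> = real ?n / real m * (real m - real ?n + real p) / 2"
  define u where "u = top_mass T (form_power beta p)"
  define W :: "'n superform" where "W = wedge (form_power beta (p - 1)) (rank_one (offset a))"
  define B where "B = top_mass T W"
  have p: "1 \<le> p" using assms by simp
  have lin: "linear_on_tests T"
    using assms(4) supercurrent_linear unfolding m_positive_current_def by blast
  have sb: "smooth (form_power beta j K L)" for j and K L :: "'n set" by (rule smooth_form_power_beta)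
  have sW: "smooth (W K L)" for K L
    unfolding W_def by (intro smooth_wedge sb smooth_rank_one smooth_offset)
  have mr: "real (m + p - ?n) = real m - real ?n + real p" using assms by simp
  have u_linear: "u (\<lambda>x. c * \<phi> x + d * \<psi> x) = c * u \<phi> + d * u \<psi>" if "test_fun \<phi>" "test_fun \<psi>" for c d \<phi> \<psi>
    unfolding u_def by (rule top_mass_linear[OF lin sb that])
  have B_scale: "B (\<lambda>x. c * \<phi> x) = c * B \<phi>" if "test_fun \<phi>" for c \<phi>
    unfolding B_def by (rule top_mass_scale[OF lin sW that])
  have rank_one: "real (m + p - ?n) * B (\<lambda>x. c x * \<phi> x) \<le> u \<phi>"
    if "smooth c" "\<And>x. 0 \<le> c x" "\<And>x. real m * (c x * (2 * ?s x)) \<le> real ?n" "test_fun \<phi>" "\<And>x. 0 \<le> \<phi> x"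
    for c \<phi>
    unfolding B_def W_def u_def
    by (rule m_positive_current_rank_one_inequality[OF assms(2,3,6,4) smooth_offset that(1,2)])
      (simp_all only: sum_offset_square that)
  interpret positive_functional u
  proof
    fix \<phi> :: "real^'n::{finite,linorder} \<Rightarrow> real" assume \<phi>: "test_fun \<phi>" "\<And>x. 0 \<le> \<phi> x"
    have "real (m + p - ?n) * B (\<lambda>x. 0 * \<phi> x) \<le> u \<phi>"
      by (rule rank_one) (simp_all add: \<phi>)
    then show "0 \<le> u \<phi>" using B_scale[OF \<phi>(1), of 0] by simp
  qed (rule u_linear)
  have s0: "0 \<le> ?s x" for x by (simp add: half_sqdist_eq)
  interpret radial_inequalities u B a \<kappa>
  proof
    show "0 < \<kappa>" using assms by (simp add: \<kappa>_def)
  next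
    fix g g' g'' R
    assume "\<And>k. ck_real k g" "\<And>k. ck_real k g'" "\<And>k. ck_real k g''"
      "\<And>t. (g has_real_derivative g' t) (at t)" "\<And>t. (g' has_real_derivative g'' t) (at t)"
      "\<And>t. 0 \<le> g t" "\<And>t. t \<ge> R \<Longrightarrow> g t = 0" "\<And>t. t \<ge> R \<Longrightarrow> g' t = 0" "\<And>t. t \<ge> R \<Longrightarrow> g'' t = 0"
    then show "0 \<le> u (\<lambda>x. g' (?s x)) + B (\<lambda>x. g'' (?s x))"
      unfolding u_def B_def W_def by (rule convex_current_radial_inequality[OF lin p assms(5)])
  next
    fix \<psi> :: "real^'n::{finite,linorder} \<Rightarrow> real" assume \<psi>: "test_fun \<psi>" "\<And>x. 0 \<le> \<psi> x"
    have ts: "test_fun (\<lambda>x. ?s x * \<psi> x)" by (rule test_fun_mult[OF \<psi>(1) smooth_half_sqdist])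
    have eps: "\<kappa> * B \<psi> \<le> u (\<lambda>x. ?s x * \<psi> x) + e * u \<psi>" if "e > 0" for e
    proof -
      \<comment> \<open>The extreme coefficient \<open>(n/m) / \<bar>x - a\<bar>\<^sup>2\<close>, made smooth at \<open>a\<close>; \<open>\<phi>\<close> cancels its denominator.\<close>
      define c where "c x = real ?n / real m * inverse (2 * ?s x + 2 * e)" for x
      define \<phi> where "\<phi> x = (2 * ?s x + 2 * e) * \<psi> x" for x
      have d: "2 * ?s x + 2 * e > 0" for x using s0[of x] that by simp
      have sd: "smooth (\<lambda>x. 2 * ?s x + 2 * e)"
        by (intro smooth_add smooth_mult smooth_const smooth_half_sqdist)
      have nz: "2 * ?s x + 2 * e \<noteq> 0" for x using d[of x] by linarith
      have "smooth c" unfolding c_def[abs_def]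
        by (intro smooth_mult smooth_const smooth_inverse[OF sd nz])
      moreover have "0 \<le> c x" for x using d[of x] by (simp add: c_def)
      moreover have "real m * (c x * (2 * ?s x)) \<le> real ?n" for x
      proof -
        have "real m * (c x * (2 * ?s x)) = real ?n * ((2 * ?s x) / (2 * ?s x + 2 * e))"
          using assms(1) by (simp add: c_def divide_inverse)
        also have "\<dots> \<le> real ?n * 1"
          using d[of x] that by (intro mult_left_mono) (simp_all add: divide_le_eq)
        finally show ?thesis by simp
      qed
      moreover have t\<phi>: "test_fun \<phi>" unfolding \<phi>_def[abs_def] by (rule test_fun_mult[OF \<psi>(1) sd])
      moreover have "0 \<le> \<phi> x" for x using d[of x] \<psi>(2)[of x] by (simp add: \<phi>_def)
      ultimately have "real (m + p - ?n) * B (\<lambda>x. c x * \<phi> x) \<le> u \<phi>" by (rule rank_one)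
      moreover have "(\<lambda>x. c x * \<phi> x) = (\<lambda>x. real ?n / real m * \<psi> x)"
      proof
        fix x
        show "c x * \<phi> x = real ?n / real m * \<psi> x" using d[of x] by (simp add: c_def \<phi>_def)
      qed
      moreover have "u \<phi> = 2 * u (\<lambda>x. ?s x * \<psi> x) + (2 * e) * u \<psi>"
        using linear[OF ts \<psi>(1), of 2 "2 * e"] by (simp add: \<phi>_def[abs_def] algebra_simps)
      ultimately have "real (m + p - ?n) * (real ?n / real m * B \<psi>) \<le> 2 * u (\<lambda>x. ?s x * \<psi> x) + (2 * e) * u \<psi>"
        using B_scale[OF \<psi>(1), of "real ?n / real m"] by simp
      moreover have "real (m + p - ?n) * (real ?n / real m * B \<psi>) = 2 * (\<kappa> * B \<psi>)"
        unfolding mr \<kappa>_def by simp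
      ultimately show ?thesis by simp
    qed
    show "\<kappa> * B \<psi> \<le> u (\<lambda>x. ?s x * \<psi> x)"
    proof (rule field_le_epsilon)
      fix e :: real assume "e > 0"
      have u0: "0 \<le> u \<psi>" by (rule nonneg[OF \<psi>])
      then have "e / (u \<psi> + 1) > 0" using \<open>e > 0\<close> by simp
      from eps[OF this] have "\<kappa> * B \<psi> \<le> u (\<lambda>x. ?s x * \<psi> x) + e / (u \<psi> + 1) * u \<psi>" .
      also have "e / (u \<psi> + 1) * u \<psi> \<le> e" using u0 \<open>e > 0\<close> by (simp add: divide_simps mult_left_mono)
      finally show "\<kappa> * B \<psi> \<le> u (\<lambda>x. ?s x * \<psi> x) + e" by simp
    qed
  qed
  have "(\<lambda>\<phi>. current_pairing (wedge_current T (form_power beta p)) (function_form \<phi>)) = u"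
    unfolding u_def top_mass_def
    by (intro ext current_pairing_function linear_on_tests_zero[OF linear_on_tests_wedge_current[OF lin sb]])
  then have "super_integral (ball a r) (wedge_current T (form_power beta p)) =
      measure representing_measure (ball a r)" for r
    unfolding super_integral_def by (simp only: density_measure_eq)
  then show ?thesis using mass_ratio_converges by (simp add: \<kappa>_def)
qed

end
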